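(* Let $\{X_{ki}\}_{k,i\ge 1}$ be a double array of independent and identically distributed real random variables with mean $0$, variance $1$ and finite fourth moment. Let $p=p(n)$ be positive integers with $p/n\to y\in(0,1)$ as $n\to\infty$. For each $n\ge 2$ put $X_i=(X_{1i},X_{2i},\ldots,X_{pi})^T\in\mathbb{R}^p$ for $i=1,\ldots,n$, and $$K_n=\frac{2}{n(n-1)}\sum_{1\le i<j\le n}\frac{(X_i-X_j)(X_i-X_j)^T}{\|X_i-X_j\|^2}.$$ Then, almost surely, the empirical spectral distribution of $\tfrac12 pK_n$ converges weakly, as $n\to\infty$, to the Marčenko–Pastur distribution with variance parameter $\tfrac12$, i.e. the probability distribution on $\mathbb{R}$ with density $$f_y(x)=\begin{cases}\dfrac{1}{\pi x y}\sqrt{(b-x)(x-a)}, & a\le x\le b,\\[1ex] 0,&\text{otherwise,}\end{cases}$$ where $a=\tfrac12(1-\sqrt y)^2$ and $b=\tfrac12(1+\sqrt y)^2$.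
   Context: $\|\cdot\|$ applied to vectors is the Euclidean norm, and $^T$ denotes transpose. For a real symmetric $p\times p$ matrix $A$ with eigenvalues $\lambda_1,\ldots,\lambda_p$ (counted with multiplicity), its empirical spectral distribution (ESD) is the distribution function $F^A(x)=\frac1p\sum_{i=1}^p \mathbf 1(\lambda_i\le x)$. $K_n$ is the sample multivariate Kendall-$\tau$ matrix. Convention: a summand of $K_n$ with $X_i=X_j$ is interpreted as the zero matrix. *)

theory Defs
  imports "HOL-Probability.Probability" "Jordan_Normal_Form.Char_Poly"
begin

hide_const (open) Finite_Cartesian_Product.vec Finite_Cartesian_Product.mat
no_notation inner (infix \<open>\<bullet>\<close> 70)
unbundle no vec_syntax

definition eucl_norm :: "real Matrix.vec \<Rightarrow> real" where
  "eucl_norm v = sqrt (v \<bullet> v)"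

definition outer_square :: "real Matrix.vec \<Rightarrow> real Matrix.mat" where
  "outer_square v = mat_of_cols (dim_vec v) [v] * mat_of_rows (dim_vec v) [v]"

text \<open>The matrix \<open>v v\<^sup>T / \<parallel>v\<parallel>\<^sup>2\<close>.  For \<open>v = 0\<close> the scalar is \<open>1 / 0 = 0\<close>, so this is the zero
  matrix, which is the convention wanted for coinciding sample points.\<close>
definition sign_outer :: "real Matrix.vec \<Rightarrow> real Matrix.mat" where
  "sign_outer v = (1 / (eucl_norm v)\<^sup>2) \<cdot>\<^sub>m outer_square v"

text \<open>The sum of matrices is written entrywise, since \<open>mat\<close> is not an instance of
  \<open>comm_monoid_add\<close>.  The sample points are \<open>x 1, \<dots>, x n\<close>.\<close>
definition kendall_tau :: "nat \<Rightarrow> nat \<Rightarrow> (nat \<Rightarrow> real Matrix.vec) \<Rightarrow> real Matrix.mat" where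
  "kendall_tau p n x =
     (2 / (real n * (real n - 1))) \<cdot>\<^sub>m
       Matrix.mat p p (\<lambda>(a, b).
         \<Sum>(i, j)\<in>{(i, j). 1 \<le> i \<and> i < j \<and> j \<le> n}. sign_outer (x i - x j) $$ (a, b))"

text \<open>JNF vectors are indexed from \<open>0\<close>, the array \<open>X\<close> from \<open>1\<close>.\<close>
definition sample_vec :: "(nat \<Rightarrow> nat \<Rightarrow> 'a \<Rightarrow> real) \<Rightarrow> nat \<Rightarrow> 'a \<Rightarrow> nat \<Rightarrow> real Matrix.vec" where
  "sample_vec X p \<omega> i = Matrix.vec p (\<lambda>k. X (Suc k) i \<omega>)"

text \<open>The eigenvalues, with multiplicity, are the roots of the characteristic polynomial; for a
  symmetric real matrix all of these are real.\<close>
definition esd :: "real Matrix.mat \<Rightarrow> real \<Rightarrow> real" where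
  "esd A x = real (size {#l \<in># proots (char_poly A). l \<le> x#}) / real (dim_row A)"

definition mp_density :: "real \<Rightarrow> real \<Rightarrow> real" where
  "mp_density y x =
     (let a = (1 - sqrt y)\<^sup>2 / 2; b = (1 + sqrt y)\<^sup>2 / 2
      in if a \<le> x \<and> x \<le> b then 1 / (pi * x * y) * sqrt ((b - x) * (x - a)) else 0)"

definition mp_distr :: "real \<Rightarrow> real measure" where
  "mp_distr y = density lborel (\<lambda>x. ennreal (mp_density y x))"

end

theory Submission
  imports Defs "Jordan_Normal_Form.Schur_Decomposition"
begin

text \<open>
  The proof follows the resolvent method, but at a negative real point \<open>-x\<close> of the spectral axis
  instead of a complex one. All matrices in question are positive semidefinite, so
  \<open>A + x I\<close> is invertible for every \<open>x > 0\<close>, its inverse has norm at most \<open>1/x\<close>, and everything stays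
  real. Write \<open>m(A) = tr (A + x I)\<^sup>-\<^sup>1 / p\<close>; this is the mean of \<open>1 / (\<lambda> + x)\<close> over the eigenvalues.

  The functions \<open>\<lambda> \<mapsto> 1 / (\<lambda> + x)\<close> determine weak convergence on the half line: in the variable
  \<open>t = 1 / (1 + \<lambda>)\<close> they are \<open>t / (1 + s t)\<close> with \<open>s = x - 1\<close>, whose expansion in powers of \<open>s\<close> gives all
  moments of \<open>t\<close>, and polynomials are dense in the continuous functions on the unit interval
  (\<open>weak_conv_of_resolvents\<close>, \<open>esd_weak_conv\<close>). For the Marchenko-Pastur law the mean of
  \<open>1 / (\<lambda> + x)\<close> is the nonnegative root of \<open>x y m\<^sup>2 + (2 x + 1 - y) m - 2 = 0\<close>
  (\<open>mp_resolvent_quadratic\<close>). So it suffices that the Kendall matrix satisfies this equation up to an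
  error tending to \<open>0\<close> almost surely, with \<open>y\<close> replaced by \<open>p/n\<close>.

  The error is controlled in expectation and then by concentration.

  \<^item> Replacing one observation changes only \<open>n - 1\<close> summands of the Kendall matrix, each a multiple of a
    projection of rank one. So the error, seen as a function of the \<open>n\<close> independent columns, has
    differences of order \<open>1/n\<close>, and the fourth moment of its fluctuation is of order \<open>1/n\<^sup>2\<close>
    (\<open>kendall_bounded_difference\<close>, \<open>bounded_differences_fourth_moment\<close>). This is summable, so the error is
    almost surely close to its mean, and bounds in mean are enough. Second moments of the
    statistics below, for which finite fourth moments of the entries suffice, give those bounds.

  \<^item> Since \<open>\<parallel>X\<^sub>i - X\<^sub>j\<parallel>\<^sup>2\<close> is close to \<open>2 p\<close> on average, the Kendall matrix may be replaced by half the
    sample covariance matrix at the cost of a small error in trace norm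
    (\<open>kendall_cov_comparison\<close>, \<open>expected_kendall_cov_comparison\<close>).

  \<^item> For half the sample covariance matrix, removing one column at a time expresses the trace of the
    resolvent through the quadratic forms of the columns in resolvents that are independent of them.
    Each quadratic form is close to a trace, which closes the equation
    (\<open>cov_self_consistent\<close>, \<open>quadratic_form_second_moment\<close>, \<open>expected_cov_quadratic\<close>).
\<close>

section \<open>Resolvents of positive semidefinite matrices\<close>

definition sym_psd :: "nat \<Rightarrow> real mat \<Rightarrow> bool" where
  "sym_psd p A \<longleftrightarrow> A \<in> carrier_mat p p \<and> transpose_mat A = A \<and>
     (\<forall>v \<in> carrier_vec p. 0 \<le> v \<bullet> (A *\<^sub>v v))"

text \<open>The resolvent at \<open>-x\<close>, written through the adjugate: its entries are then visibly quotients of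
  polynomials in the entries of \<open>A\<close>, from which measurability follows.\<close>
definition resolvent :: "real \<Rightarrow> real mat \<Rightarrow> real mat" where
  "resolvent x A = (1 / det (A + x \<cdot>\<^sub>m 1\<^sub>m (dim_row A))) \<cdot>\<^sub>m adj_mat (A + x \<cdot>\<^sub>m 1\<^sub>m (dim_row A))"

definition rank_one_sum :: "nat \<Rightarrow> 'i set \<Rightarrow> ('i \<Rightarrow> real) \<Rightarrow> ('i \<Rightarrow> real Matrix.vec) \<Rightarrow> real mat" where
  "rank_one_sum p I c z = Matrix.mat p p (\<lambda>(a, b). \<Sum>i\<in>I. c i * z i $ a * z i $ b)"

lemma scalar_prod_sum:
  assumes "w \<in> carrier_vec n"
  shows "v \<bullet> w = (\<Sum>i<n. v $ i * w $ i)"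
  using assms by (auto simp: scalar_prod_def atLeast0LessThan)

lemma scalar_prod_self_nonneg: "0 \<le> v \<bullet> (v :: real Matrix.vec)"
  unfolding scalar_prod_def by (intro sum_nonneg) auto

lemma scalar_prod_Cauchy_Schwarz:
  assumes "v \<in> carrier_vec n" "w \<in> carrier_vec n"
  shows "(v \<bullet> w)\<^sup>2 \<le> (v \<bullet> v) * (w \<bullet> (w :: real Matrix.vec))"
  using Cauchy_Schwarz_ineq_sum[of "\<lambda>i. v $ i" "\<lambda>i. w $ i" "{..<n}"] assms
  by (simp add: scalar_prod_sum[of _ n] power2_eq_square)

lemma scalar_prod_self_eq_0:
  assumes "v \<in> carrier_vec n" "v \<bullet> (v :: real Matrix.vec) = 0"
  shows "v = 0\<^sub>v n"
proof -
  have "(\<Sum>i<n. v $ i * v $ i) = 0" using assms by (simp add: scalar_prod_sum)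
  then have "\<forall>i<n. v $ i * v $ i = 0" by (subst (asm) sum_nonneg_eq_0_iff) auto
  then show ?thesis using assms by (intro eq_vecI) auto
qed

lemma mult_mat_vec_sum:
  assumes "A \<in> carrier_mat n n" "v \<in> carrier_vec n" "i < n"
  shows "(A *\<^sub>v v) $ i = (\<Sum>j<n. A $$ (i, j) * v $ j)"
  using assms by (auto simp: scalar_prod_def atLeast0LessThan)

lemma mult_mat_sum:
  assumes "A \<in> carrier_mat n n" "B \<in> carrier_mat n n" "i < n" "k < n"
  shows "(A * B) $$ (i, k) = (\<Sum>j<n. A $$ (i, j) * B $$ (j, k))"
  using assms by (auto simp: scalar_prod_def atLeast0LessThan)

lemma sym_scalar_prod:
  assumes "A \<in> carrier_mat n n" "transpose_mat A = A" "v \<in> carrier_vec n" "w \<in> carrier_vec n"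
  shows "v \<bullet> (A *\<^sub>v w) = (A *\<^sub>v v) \<bullet> (w :: real Matrix.vec)"
  using transpose_vec_mult_scalar[of A n n w v] assms by simp

lemma shift_carrier:
  "A \<in> carrier_mat p p \<Longrightarrow> A + x \<cdot>\<^sub>m 1\<^sub>m p \<in> carrier_mat p p"
  by auto

lemma shift_mult_vec:
  fixes A :: "real mat"
  assumes "A \<in> carrier_mat p p" "v \<in> carrier_vec p"
  shows "(A + x \<cdot>\<^sub>m 1\<^sub>m p) *\<^sub>v v = A *\<^sub>v v + x \<cdot>\<^sub>v v"
proof -
  have "(x \<cdot>\<^sub>m 1\<^sub>m p) *\<^sub>v v = x \<cdot>\<^sub>v (1\<^sub>m p *\<^sub>v v)" 
    using assms by (intro eq_vecI) auto
  then show ?thesis using assms by (subst add_mult_distrib_mat_vec) auto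
qed

lemma sym_psd_coercive:
  assumes A: "sym_psd p A" and v: "v \<in> carrier_vec p"
  shows "x * (v \<bullet> v) \<le> v \<bullet> ((A + x \<cdot>\<^sub>m 1\<^sub>m p) *\<^sub>v v)"
proof -
  have c: "A \<in> carrier_mat p p" using A by (auto simp: sym_psd_def)
  have "v \<bullet> ((A + x \<cdot>\<^sub>m 1\<^sub>m p) *\<^sub>v v) = v \<bullet> (A *\<^sub>v v) + x * (v \<bullet> v)"
    unfolding shift_mult_vec[OF c v] using c v by (subst scalar_prod_add_distrib[of _ p]) auto
  then show ?thesis using A v by (auto simp: sym_psd_def)
qed

lemma sym_psd_shift_det:
  assumes A: "sym_psd p A" and x: "0 < x"
  shows "det (A + x \<cdot>\<^sub>m 1\<^sub>m p) \<noteq> 0"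
proof
  have c: "A \<in> carrier_mat p p" using A by (auto simp: sym_psd_def)
  assume "det (A + x \<cdot>\<^sub>m 1\<^sub>m p) = 0"
  then obtain v where v: "v \<in> carrier_vec p" "v \<noteq> 0\<^sub>v p" "(A + x \<cdot>\<^sub>m 1\<^sub>m p) *\<^sub>v v = 0\<^sub>v p"
    using det_0_iff_vec_prod_zero_field[OF shift_carrier[OF c]] by blast
  have "x * (v \<bullet> v) \<le> 0" using sym_psd_coercive[OF A v(1), of x] v by simp
  then have "v \<bullet> v = 0" using x scalar_prod_self_nonneg[of v] by (simp add: mult_le_0_iff)
  then show False using scalar_prod_self_eq_0 v by blast
qed

text \<open>The arithmetic behind the norm bounds for a resolvent: \<open>a = \<parallel>w\<parallel>\<^sup>2\<close>, \<open>b = v \<bullet> w\<close> and \<open>c = \<parallel>v\<parallel>\<^sup>2\<close> for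
  \<open>w = (A + x I)\<^sup>-\<^sup>1 v\<close>. The first hypothesis is coercivity, the second the Cauchy-Schwarz inequality.\<close>
lemma coercive_inequalities:
  fixes x a b c :: real
  assumes x: "0 < x" and ab: "x * a \<le> b" and cs: "b\<^sup>2 \<le> c * a" and a: "0 \<le> a" and c: "0 \<le> c"
  shows "0 \<le> b" "a \<le> c / x\<^sup>2" "b \<le> c / x"
proof -
  show b: "0 \<le> b" using ab mult_nonneg_nonneg[of x a] x a by linarith
  have ax: "a \<le> b / x" using ab x by (simp add: field_simps)
  have "b * b \<le> c * (b / x)"
    using cs mult_left_mono[OF ax c] by (simp add: power2_eq_square)
  then have "b * b \<le> (c / x) * b" by simp
  then show bc: "b \<le> c / x" 
    using b c x mult_right_le_imp_le[of b b "c / x"] by (cases "b = 0") auto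
  have "b / x \<le> c / x / x" using bc x by (intro divide_right_mono) auto
  then show "a \<le> c / x\<^sup>2" using ax by (simp add: power2_eq_square)
qed

context
  fixes p :: nat and A :: "real mat" and x :: real
  assumes A: "sym_psd p A" and x: "0 < x"
begin

lemma sym_psd_carrier: "A \<in> carrier_mat p p" using A by (auto simp: sym_psd_def)

lemma resolvent_carrier: "resolvent x A \<in> carrier_mat p p"
  using adj_mat(1)[OF shift_carrier[OF sym_psd_carrier]] sym_psd_carrier
  by (auto simp: resolvent_def)

lemma resolvent_right: "(A + x \<cdot>\<^sub>m 1\<^sub>m p) * resolvent x A = 1\<^sub>m p"
proof -
  let ?B = "A + x \<cdot>\<^sub>m 1\<^sub>m p"
  have B: "?B \<in> carrier_mat p p" by (rule shift_carrier[OF sym_psd_carrier])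
  have "?B * resolvent x A = (1 / det ?B) \<cdot>\<^sub>m (?B * adj_mat ?B)"
    using B adj_mat(1)[OF B] sym_psd_carrier unfolding resolvent_def
    by (simp add: mult_smult_distrib[of _ p p _ p])
  also have "\<dots> = 1\<^sub>m p" using sym_psd_shift_det[OF A x] unfolding adj_mat(2)[OF B]
    by (intro eq_matI) auto
  finally show ?thesis .
qed

lemma resolvent_left: "resolvent x A * (A + x \<cdot>\<^sub>m 1\<^sub>m p) = 1\<^sub>m p"
proof -
  have B: "A + x \<cdot>\<^sub>m 1\<^sub>m p \<in> carrier_mat p p" by (rule shift_carrier[OF sym_psd_carrier])
  show ?thesis by (rule mat_mult_left_right_inverse[OF B resolvent_carrier resolvent_right])
qed

lemma resolvent_mult_vec:
  assumes v: "v \<in> carrier_vec p"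
  shows "(A + x \<cdot>\<^sub>m 1\<^sub>m p) *\<^sub>v (resolvent x A *\<^sub>v v) = v"
proof -
  have B: "A + x \<cdot>\<^sub>m 1\<^sub>m p \<in> carrier_mat p p" by (rule shift_carrier[OF sym_psd_carrier])
  show ?thesis using assoc_mult_mat_vec[OF B resolvent_carrier v] by (simp add: resolvent_right v)
qed

lemma resolvent_sym: "transpose_mat (resolvent x A) = resolvent x A"
proof -
  let ?B = "A + x \<cdot>\<^sub>m 1\<^sub>m p" and ?R = "resolvent x A"
  have B: "?B \<in> carrier_mat p p" by (rule shift_carrier[OF sym_psd_carrier])
  have "transpose_mat ?B = transpose_mat A + x \<cdot>\<^sub>m 1\<^sub>m p" using sym_psd_carrier
    by (intro eq_matI) auto
  then have tB: "transpose_mat ?B = ?B" using A by (simp add: sym_psd_def)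
  have "transpose_mat ?R * ?B = 1\<^sub>m p"
    using transpose_mult[OF B resolvent_carrier] tB resolvent_right by simp
  then have "transpose_mat ?R * ?B * ?R = ?R" using resolvent_carrier by simp
  moreover have "transpose_mat ?R * ?B * ?R = transpose_mat ?R * (?B * ?R)"
    using resolvent_carrier B by (intro assoc_mult_mat[of _ p p _ p _ p]) auto
  ultimately show ?thesis
    using resolvent_right resolvent_carrier by simp
qed

lemma resolvent_norm:
  assumes v: "v \<in> carrier_vec p"
  shows "0 \<le> v \<bullet> (resolvent x A *\<^sub>v v)" (is "?a")
    and "(resolvent x A *\<^sub>v v) \<bullet> (resolvent x A *\<^sub>v v) \<le> (v \<bullet> v) / x\<^sup>2" (is "?b")
    and "v \<bullet> (resolvent x A *\<^sub>v v) \<le> (v \<bullet> v) / x" (is "?c")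
proof -
  define w where "w = resolvent x A *\<^sub>v v"
  have w: "w \<in> carrier_vec p" using v resolvent_carrier by (auto simp: w_def)
  have "(A + x \<cdot>\<^sub>m 1\<^sub>m p) *\<^sub>v w = v"
    unfolding w_def by (rule resolvent_mult_vec[OF v])
  then have le: "x * (w \<bullet> w) \<le> v \<bullet> w" 
    using sym_psd_coercive[OF A w, of x] comm_scalar_prod[OF v w] by simp
  show ?a and ?b and ?c
    using coercive_inequalities[OF x le scalar_prod_Cauchy_Schwarz[OF v w]
      scalar_prod_self_nonneg scalar_prod_self_nonneg] by (simp_all add: w_def)
qed

text \<open>The rows of the resolvent are images of unit vectors. The first bound controls the Frobenius norm.\<close>
lemma resolvent_entries:
  assumes k: "k < p"
  shows "(\<Sum>l<p. (resolvent x A $$ (k, l))\<^sup>2) \<le> 1 / x\<^sup>2"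
    and "0 \<le> resolvent x A $$ (k, k)"
    and "resolvent x A $$ (k, k) \<le> 1 / x"
proof -
  let ?R = "resolvent x A"
  have e: "unit_vec p k \<in> carrier_vec p" by simp
  have ee: "unit_vec p k \<bullet> unit_vec p k = (1::real)" using k by simp
  have col: "?R *\<^sub>v unit_vec p k = col ?R k"
    using k resolvent_carrier by (intro eq_vecI) auto
  have colk: "?R $$ (l, k) = ?R $$ (k, l)" if "l < p" for l
  proof -
    have "?R $$ (k, l) = transpose_mat ?R $$ (k, l)" by (simp add: resolvent_sym)
    then show ?thesis using that k resolvent_carrier by auto
  qed
  have "(?R *\<^sub>v unit_vec p k) \<bullet> (?R *\<^sub>v unit_vec p k) = (\<Sum>l<p. (?R $$ (k, l))\<^sup>2)"
    using resolvent_carrier k unfolding col 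
    by (subst scalar_prod_sum[of _ p]) (auto simp: colk power2_eq_square intro!: sum.cong)
  then show "(\<Sum>l<p. (?R $$ (k, l))\<^sup>2) \<le> 1 / x\<^sup>2"
    using resolvent_norm(2)[OF e] ee by simp
  have "unit_vec p k \<bullet> (?R *\<^sub>v unit_vec p k) = ?R $$ (k, k)"
    unfolding col using k resolvent_carrier by (auto simp: scalar_prod_left_unit[of _ p])
  then show "0 \<le> ?R $$ (k, k)" "?R $$ (k, k) \<le> 1 / x"
    using resolvent_norm(1,3)[OF e] ee by simp_all
qed

lemma resolvent_entry_bound:
  assumes "k < p" "l < p"
  shows "\<bar>resolvent x A $$ (k, l)\<bar> \<le> 1 / x"
proof -
  have "(resolvent x A $$ (k, l))\<^sup>2 \<le> (\<Sum>l<p. (resolvent x A $$ (k, l))\<^sup>2)"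
    using assms by (intro member_le_sum) auto
  also have "\<dots> \<le> (1 / x)\<^sup>2" using resolvent_entries(1)[OF assms(1)] by (simp add: power_divide)
  finally show ?thesis using x by (simp add: abs_le_square_iff[symmetric])
qed

end

definition mtrace :: "real mat \<Rightarrow> real" where
  "mtrace A = (\<Sum>i<dim_row A. A $$ (i, i))"

lemma mtrace_mult:
  assumes "A \<in> carrier_mat p p" "B \<in> carrier_mat p p"
  shows "mtrace (A * B) = (\<Sum>i<p. \<Sum>j<p. A $$ (i, j) * B $$ (j, i))"
  using assms unfolding mtrace_def
  by (auto simp: mult_mat_sum[OF assms] simp del: index_mult_mat(1) intro!: sum.cong)

lemma mtrace_comm:
  assumes "A \<in> carrier_mat p p" "B \<in> carrier_mat p p"
  shows "mtrace (A * B) = mtrace (B * A)"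
  unfolding mtrace_mult[OF assms] mtrace_mult[OF assms(2,1)]
  by (subst sum.swap) (simp add: mult.commute)

lemma mtrace_add:
  assumes "A \<in> carrier_mat p p" "B \<in> carrier_mat p p"
  shows "mtrace (A + B) = mtrace A + mtrace B"
  using assms by (auto simp: mtrace_def sum.distrib)

lemma rank_one_sum_carrier [simp]: "rank_one_sum p I c z \<in> carrier_mat p p"
  by (simp add: rank_one_sum_def)

lemma rank_one_sum_sym: "transpose_mat (rank_one_sum p I c z) = rank_one_sum p I c z"
  by (intro eq_matI) (auto simp: rank_one_sum_def mult.assoc mult.commute intro!: sum.cong)

lemma rank_one_sum_mult_vec:
  assumes v: "v \<in> carrier_vec p" and a: "a < p"
  shows "(rank_one_sum p I c z *\<^sub>v v) $ a = (\<Sum>i\<in>I. c i * (z i \<bullet> v) * z i $ a)"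
proof -
  have "(rank_one_sum p I c z *\<^sub>v v) $ a = (\<Sum>b<p. (\<Sum>i\<in>I. c i * z i $ a * z i $ b) * v $ b)"
    using a by (subst mult_mat_vec_sum[OF _ v a]) (auto simp: rank_one_sum_def)
  also have "\<dots> = (\<Sum>i\<in>I. \<Sum>b<p. c i * z i $ a * z i $ b * v $ b)"
    by (simp add: sum_distrib_right) (rule sum.swap)
  also have "\<dots> = (\<Sum>i\<in>I. c i * (z i \<bullet> v) * z i $ a)"
    by (intro sum.cong) (auto simp: scalar_prod_sum[OF v] sum_distrib_left sum_distrib_right mult_ac)
  finally show ?thesis .
qed

lemma rank_one_sum_form:
  assumes v: "v \<in> carrier_vec p" and w: "w \<in> carrier_vec p" and z: "\<And>i. i \<in> I \<Longrightarrow> z i \<in> carrier_vec p"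
  shows "w \<bullet> (rank_one_sum p I c z *\<^sub>v v) = (\<Sum>i\<in>I. c i * (z i \<bullet> v) * (w \<bullet> z i))"
proof -
  have W: "rank_one_sum p I c z *\<^sub>v v \<in> carrier_vec p"
    by (rule mult_mat_vec_carrier[OF rank_one_sum_carrier v])
  have "w \<bullet> (rank_one_sum p I c z *\<^sub>v v) = (\<Sum>a<p. w $ a * (\<Sum>i\<in>I. c i * (z i \<bullet> v) * z i $ a))"
    unfolding scalar_prod_sum[OF W] by (intro sum.cong) (auto simp: rank_one_sum_mult_vec[OF v])
  also have "\<dots> = (\<Sum>i\<in>I. \<Sum>a<p. w $ a * (c i * (z i \<bullet> v) * z i $ a))"
    by (simp add: sum_distrib_left) (rule sum.swap)
  also have "\<dots> = (\<Sum>i\<in>I. c i * (z i \<bullet> v) * (w \<bullet> z i))"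
    by (intro sum.cong) (auto simp: scalar_prod_sum[OF z] sum_distrib_left mult_ac)
  finally show ?thesis .
qed

lemma rank_one_sum_psd:
  assumes z: "\<And>i. i \<in> I \<Longrightarrow> z i \<in> carrier_vec p" and c: "\<And>i. i \<in> I \<Longrightarrow> 0 \<le> c i"
  shows "sym_psd p (rank_one_sum p I c z)"
  unfolding sym_psd_def
proof (intro conjI ballI)
  fix v :: "real Matrix.vec" assume v: "v \<in> carrier_vec p"
  have "v \<bullet> (rank_one_sum p I c z *\<^sub>v v) = (\<Sum>i\<in>I. c i * (v \<bullet> z i)\<^sup>2)"
    by (subst rank_one_sum_form[OF v v z])
      (auto simp: power2_eq_square comm_scalar_prod[OF v z] intro!: sum.cong)
  then show "0 \<le> v \<bullet> (rank_one_sum p I c z *\<^sub>v v)" using c by (auto intro!: sum_nonneg)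
qed (auto simp: rank_one_sum_sym)

lemma mtrace_rank_one_sum:
  assumes G: "G \<in> carrier_mat p p" and z: "\<And>i. i \<in> I \<Longrightarrow> z i \<in> carrier_vec p"
  shows "mtrace (G * rank_one_sum p I c z) = (\<Sum>i\<in>I. c i * (z i \<bullet> (G *\<^sub>v z i)))"
proof -
  have "mtrace (G * rank_one_sum p I c z) =
      (\<Sum>a<p. \<Sum>b<p. \<Sum>i\<in>I. G $$ (a, b) * (c i * z i $ b * z i $ a))"
    unfolding mtrace_mult[OF G rank_one_sum_carrier]
    by (intro sum.cong) (auto simp: rank_one_sum_def sum_distrib_left)
  also have "\<dots> = (\<Sum>a<p. \<Sum>i\<in>I. \<Sum>b<p. G $$ (a, b) * (c i * z i $ b * z i $ a))"
    by (intro sum.cong refl sum.swap)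
  also have "\<dots> = (\<Sum>i\<in>I. \<Sum>a<p. \<Sum>b<p. G $$ (a, b) * (c i * z i $ b * z i $ a))"
    by (rule sum.swap)
  also have "\<dots> = (\<Sum>i\<in>I. c i * (z i \<bullet> (G *\<^sub>v z i)))"
  proof (intro sum.cong refl)
    fix i assume i: "i \<in> I"
    have Gz: "G *\<^sub>v z i \<in> carrier_vec p" using G z[OF i] by auto
    show "(\<Sum>a<p. \<Sum>b<p. G $$ (a, b) * (c i * z i $ b * z i $ a)) = c i * (z i \<bullet> (G *\<^sub>v z i))"
      unfolding scalar_prod_sum[OF Gz] sum_distrib_left
      by (intro sum.cong) (auto simp: mult_mat_vec_sum[OF G z[OF i]] sum_distrib_left mult_ac)
  qed
  finally show ?thesis .
qed

text \<open>The second resolvent identity \<open>R\<^sub>A - R\<^sub>B = R\<^sub>A (B - A) R\<^sub>B\<close>, from which all comparisons of resolvents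
  below are derived.\<close>
lemma resolvent_difference:
  assumes A: "sym_psd p A" and B: "sym_psd p B" and x: "0 < x" 
    and W: "W \<in> carrier_mat p p" and BA: "B = A + W"
  shows "resolvent x A = resolvent x B + resolvent x A * (W * resolvent x B)"
proof -
  let ?RA = "resolvent x A" and ?RB = "resolvent x B"
  note cA = sym_psd_carrier[OF A x] and RA = resolvent_carrier[OF A x] and RB = resolvent_carrier[OF B x]
  have SA: "A + x \<cdot>\<^sub>m 1\<^sub>m p \<in> carrier_mat p p" by (rule shift_carrier[OF cA])
  have SB: "B + x \<cdot>\<^sub>m 1\<^sub>m p \<in> carrier_mat p p" by (rule shift_carrier[OF sym_psd_carrier[OF B x]])
  have split: "B + x \<cdot>\<^sub>m 1\<^sub>m p = (A + x \<cdot>\<^sub>m 1\<^sub>m p) + W"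
    unfolding BA using cA W by (intro eq_matI) auto
  have "?RA = ?RA * ((B + x \<cdot>\<^sub>m 1\<^sub>m p) * ?RB)" 
    using resolvent_right[OF B x] right_mult_one_mat[OF RA] by simp
  also have "\<dots> = ?RA * ((A + x \<cdot>\<^sub>m 1\<^sub>m p) * ?RB + W * ?RB)"
    unfolding split by (subst add_mult_distrib_mat[OF SA W RB]) simp
  also have "\<dots> = ?RA * ((A + x \<cdot>\<^sub>m 1\<^sub>m p) * ?RB) + ?RA * (W * ?RB)"
    using RA RB SA W by (intro mult_add_distrib_mat) auto
  also have "?RA * ((A + x \<cdot>\<^sub>m 1\<^sub>m p) * ?RB) = ?RA * (A + x \<cdot>\<^sub>m 1\<^sub>m p) * ?RB"
    by (rule assoc_mult_mat[OF RA SA RB, symmetric])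
  also have "\<dots> = ?RB" unfolding resolvent_left[OF A x] by (rule left_mult_one_mat[OF RB])
  finally show ?thesis .
qed

text \<open>Cyclicity turns \<open>tr (R\<^sub>A W R\<^sub>B)\<close> into the sum of \<open>c\<^sub>i (R\<^sub>B z\<^sub>i) \<bullet> (R\<^sub>A z\<^sub>i)\<close>, and both resolvents have norm
  at most \<open>1/x\<close>. The right-hand side bounds the trace norm of the perturbation, so many summands
  of small trace are harmless, whatever their rank.\<close>
lemma trace_resolvent_perturbation:
  assumes A: "sym_psd p A" and B: "sym_psd p B" and x: "0 < x"
    and z: "\<And>i. i \<in> I \<Longrightarrow> z i \<in> carrier_vec p" and BA: "B = A + rank_one_sum p I c z"
  shows "\<bar>mtrace (resolvent x A) - mtrace (resolvent x B)\<bar> \<le> (\<Sum>i\<in>I. \<bar>c i\<bar> * (z i \<bullet> z i)) / x\<^sup>2"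
proof -
  let ?RA = "resolvent x A" and ?RB = "resolvent x B" and ?W = "rank_one_sum p I c z"
  note RA = resolvent_carrier[OF A x] and RB = resolvent_carrier[OF B x]
  have WRB: "?W * ?RB \<in> carrier_mat p p" using RB by (intro mult_carrier_mat) auto
  have "mtrace ?RA = mtrace (?RB + ?RA * (?W * ?RB))"
    using resolvent_difference[OF A B x _ BA] by simp
  also have "\<dots> = mtrace ?RB + mtrace (?RA * (?W * ?RB))"
    using RA RB WRB by (intro mtrace_add[of _ p] mult_carrier_mat) auto
  also have "mtrace (?RA * (?W * ?RB)) = mtrace (?W * ?RB * ?RA)"
    by (rule mtrace_comm[OF RA WRB])
  also have "\<dots> = mtrace (?W * (?RB * ?RA))"
    by (subst assoc_mult_mat[OF rank_one_sum_carrier RB RA]) simp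
  also have "\<dots> = mtrace (?RB * ?RA * ?W)"
    using RA RB by (intro mtrace_comm[of _ p]) auto
  also have "\<dots> = (\<Sum>i\<in>I. c i * (z i \<bullet> ((?RB * ?RA) *\<^sub>v z i)))"
    using RA RB by (intro mtrace_rank_one_sum z) auto
  finally have eq: "mtrace ?RA - mtrace ?RB = (\<Sum>i\<in>I. c i * (z i \<bullet> ((?RB * ?RA) *\<^sub>v z i)))" by simp
  have "\<bar>z i \<bullet> ((?RB * ?RA) *\<^sub>v z i)\<bar> \<le> (z i \<bullet> z i) / x\<^sup>2" if i: "i \<in> I" for i
  proof -
    let ?a = "?RA *\<^sub>v z i" and ?b = "?RB *\<^sub>v z i"
    have a: "?a \<in> carrier_vec p" and b: "?b \<in> carrier_vec p" using RA RB z[OF i] by auto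
    have "z i \<bullet> ((?RB * ?RA) *\<^sub>v z i) = ?b \<bullet> ?a"
      unfolding assoc_mult_mat_vec[OF RB RA z[OF i]]
      by (rule sym_scalar_prod[OF RB resolvent_sym[OF B x] z[OF i] a])
    moreover have "(?b \<bullet> ?a)\<^sup>2 \<le> ((z i \<bullet> z i) / x\<^sup>2)\<^sup>2"
    proof -
      have "(?b \<bullet> ?a)\<^sup>2 \<le> (?b \<bullet> ?b) * (?a \<bullet> ?a)" by (rule scalar_prod_Cauchy_Schwarz[OF b a])
      also have "\<dots> \<le> ((z i \<bullet> z i) / x\<^sup>2) * ((z i \<bullet> z i) / x\<^sup>2)"
        using scalar_prod_self_nonneg[of "z i"] scalar_prod_self_nonneg[of ?a]
        by (intro mult_mono resolvent_norm(2)[OF A x z[OF i]] resolvent_norm(2)[OF B x z[OF i]]) auto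
      finally show ?thesis by (simp add: power2_eq_square)
    qed
    ultimately show ?thesis
      using scalar_prod_self_nonneg[of "z i"] abs_le_square_iff[of "?b \<bullet> ?a" "(z i \<bullet> z i) / x\<^sup>2"] by simp
  qed
  then have "\<bar>mtrace ?RA - mtrace ?RB\<bar> \<le> (\<Sum>i\<in>I. \<bar>c i\<bar> * ((z i \<bullet> z i) / x\<^sup>2))"
    unfolding eq by (intro order_trans[OF sum_abs] sum_mono)
      (auto simp: abs_mult simp del: times_divide_eq_right intro!: mult_left_mono)
  then show ?thesis by (simp add: sum_divide_distrib)
qed

text \<open>The Sherman-Morrison formula for the quadratic form of the updating vector itself.\<close>
lemma resolvent_rank_one_update:
  assumes A: "sym_psd p A" and B: "sym_psd p B" and x: "0 < x"
    and v: "v \<in> carrier_vec p" and BA: "B = A + rank_one_sum p {i} (\<lambda>_. c) (\<lambda>_. v)"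
    and c: "0 \<le> c"
  shows "c * (v \<bullet> (resolvent x B *\<^sub>v v)) =
    c * (v \<bullet> (resolvent x A *\<^sub>v v)) / (1 + c * (v \<bullet> (resolvent x A *\<^sub>v v)))"
proof -
  let ?RA = "resolvent x A" and ?RB = "resolvent x B" and ?W = "rank_one_sum p {i} (\<lambda>_. c) (\<lambda>_. v)"
  note RA = resolvent_carrier[OF A x] and RB = resolvent_carrier[OF B x]
  have W: "?W \<in> carrier_mat p p" by simp
  have WRB: "?W * ?RB \<in> carrier_mat p p" using RB by (intro mult_carrier_mat) auto
  have aRA: "?RA *\<^sub>v v \<in> carrier_vec p" and bRB: "?RB *\<^sub>v v \<in> carrier_vec p" using RA RB v by auto
  have WbRB: "?W *\<^sub>v (?RB *\<^sub>v v) \<in> carrier_vec p" by (rule mult_mat_vec_carrier[OF W bRB])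
  define q where "q = v \<bullet> (?RA *\<^sub>v v)"
  define s where "s = v \<bullet> (?RB *\<^sub>v v)"
  have "?RA *\<^sub>v v = (?RB + ?RA * (?W * ?RB)) *\<^sub>v v"
    using resolvent_difference[OF A B x _ BA] by simp
  also have "\<dots> = ?RB *\<^sub>v v + (?RA * (?W * ?RB)) *\<^sub>v v"
    using RA RB v WRB by (intro add_mult_distrib_mat_vec[of _ p p]) auto
  also have "(?RA * (?W * ?RB)) *\<^sub>v v = ?RA *\<^sub>v (?W *\<^sub>v (?RB *\<^sub>v v))"
    using assoc_mult_mat_vec[OF RA WRB v] assoc_mult_mat_vec[OF W RB v] by simp
  finally have "q = v \<bullet> (?RB *\<^sub>v v + ?RA *\<^sub>v (?W *\<^sub>v (?RB *\<^sub>v v)))" by (simp add: q_def)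
  also have "\<dots> = s + v \<bullet> (?RA *\<^sub>v (?W *\<^sub>v (?RB *\<^sub>v v)))"
    unfolding s_def using RA v bRB WbRB by (intro scalar_prod_add_distrib[of _ p]) auto
  also have "v \<bullet> (?RA *\<^sub>v (?W *\<^sub>v (?RB *\<^sub>v v))) = (?RA *\<^sub>v v) \<bullet> (?W *\<^sub>v (?RB *\<^sub>v v))"
    using RA v bRB WbRB by (intro sym_scalar_prod[OF RA resolvent_sym[OF A x]]) auto
  also have "\<dots> = c * s * ((?RA *\<^sub>v v) \<bullet> v)"
    using v by (subst rank_one_sum_form[OF bRB aRA]) (auto simp: s_def)
  also have "(?RA *\<^sub>v v) \<bullet> v = q" unfolding q_def by (rule comm_scalar_prod[OF aRA v])
  finally have "q = s * (1 + c * q)" by (simp add: algebra_simps)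
  moreover have "0 \<le> c * q" using resolvent_norm(1)[OF A x v] c by (simp add: q_def)
  ultimately have "s = q / (1 + c * q)" by (auto simp: field_simps)
  then show ?thesis unfolding q_def[symmetric] s_def[symmetric] by simp
qed

lemma resolvent_trace_identity:
  assumes z: "\<And>i. i \<in> I \<Longrightarrow> z i \<in> carrier_vec p" and x: "0 < x"
    and A: "sym_psd p A" "A = rank_one_sum p I c z" 
  shows "x * mtrace (resolvent x A) + (\<Sum>i\<in>I. c i * (z i \<bullet> (resolvent x A *\<^sub>v z i))) = real p"
proof -
  let ?R = "resolvent x A"
  note R = resolvent_carrier[OF A(1) x] and cA = sym_psd_carrier[OF A(1) x]
  have X: "x \<cdot>\<^sub>m 1\<^sub>m p \<in> carrier_mat p p" by simp
  have "real p = mtrace (1\<^sub>m p)" by (simp add: mtrace_def)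
  also have "1\<^sub>m p = ?R * (A + x \<cdot>\<^sub>m 1\<^sub>m p)" using resolvent_left[OF A(1) x] by simp
  also have "\<dots> = ?R * A + ?R * (x \<cdot>\<^sub>m 1\<^sub>m p)" by (rule mult_add_distrib_mat[OF R cA X])
  also have "mtrace \<dots> = mtrace (?R * A) + mtrace (?R * (x \<cdot>\<^sub>m 1\<^sub>m p))"
    using R cA X by (intro mtrace_add[of _ p] mult_carrier_mat) auto
  also have "?R * (x \<cdot>\<^sub>m 1\<^sub>m p) = x \<cdot>\<^sub>m ?R"
    using mult_smult_distrib[OF R one_carrier_mat] right_mult_one_mat[OF R] by simp
  also have "mtrace (x \<cdot>\<^sub>m ?R) = x * mtrace ?R" using R by (auto simp: mtrace_def sum_distrib_left)
  also have "mtrace (?R * A) = (\<Sum>i\<in>I. c i * (z i \<bullet> (?R *\<^sub>v z i)))"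
    using mtrace_rank_one_sum[OF R z] A(2) by simp
  finally show ?thesis by simp
qed

lemma mtrace_resolvent_bounds:
  assumes A: "sym_psd p A" and x: "0 < x"
  shows "0 \<le> mtrace (resolvent x A)" "mtrace (resolvent x A) \<le> real p / x"
proof -
  have d: "dim_row (resolvent x A) = p" using resolvent_carrier[OF A x] by auto
  show "0 \<le> mtrace (resolvent x A)" unfolding mtrace_def d
    by (intro sum_nonneg resolvent_entries(2)[OF A x]) auto
  have "mtrace (resolvent x A) \<le> (\<Sum>i<p. 1 / x)" unfolding mtrace_def d
    by (intro sum_mono resolvent_entries(3)[OF A x]) auto
  then show "mtrace (resolvent x A) \<le> real p / x" by simp
qed

section \<open>The spectrum of a real symmetric matrix\<close>

lemma monic_real_rooted_splits:
  fixes f :: "real poly"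
  assumes "lead_coeff f = 1" and "\<And>z. poly (map_poly complex_of_real f) z = 0 \<Longrightarrow> z \<in> \<real>"
  shows "\<exists>es. f = (\<Prod>e\<leftarrow>es. [:- e, 1:])"
  using assms
proof (induction "degree f" arbitrary: f)
  case 0
  then have "f = 1" by (metis degree_0_id lead_coeff_pCons(2) degree_0 one_pCons)
  then show ?case by (intro exI[of _ "[]"]) simp
next
  case (Suc n)
  let ?F = "map_poly complex_of_real f"
  have "degree ?F \<noteq> 0" using Suc.hyps by simp
  then have "\<not> constant (poly ?F)" by (simp add: constant_degree)
  then obtain z where z: "poly ?F z = 0" using fundamental_theorem_of_algebra by blast
  then obtain r where r: "z = complex_of_real r" using Suc.prems(2) by (auto simp: Reals_def)
  then have "poly f r = 0" using z by (simp add: of_real_hom.poly_map_poly)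
  then obtain q where q: "f = [:- r, 1:] * q" by (metis dvdE poly_eq_0_iff_dvd)
  have q0: "q \<noteq> 0" using q Suc.prems(1) by auto
  have "degree f = degree q + 1" unfolding q using q0 by (subst degree_mult_eq) auto
  then have dq: "n = degree q" using Suc.hyps by simp
  have lq: "lead_coeff q = 1" using Suc.prems(1) unfolding q lead_coeff_mult by simp
  have "z \<in> \<real>" if "poly (map_poly complex_of_real q) z = 0" for z
  proof (rule Suc.prems(2))
    have "?F = map_poly of_real [:- r, 1:] * map_poly of_real q"
      unfolding q by (intro poly_eqI) (auto simp: coeff_mult coeff_map_poly coeff_pCons simp del: mult_pCons_left intro!: sum.cong split: nat.splits)
    then show "poly ?F z = 0" using that by simp
  qed
  from Suc.hyps(1)[OF dq lq this] obtain es where "q = (\<Prod>e\<leftarrow>es. [:- e, 1:])" by blast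
  then show ?case using q by (intro exI[of _ "r # es"]) simp
qed

lemma proots_prod_linear:
  "proots (\<Prod>e\<leftarrow>es. [:- e, 1:]) = mset (es :: real list)"
proof (induction es)
  case (Cons e es)
  have "(\<Prod>e\<leftarrow>es. [:- e, 1:]) \<noteq> (0 :: real poly)" by (auto simp: prod_list_zero_iff)
  then show ?case using Cons.IH by (simp add: proots_mult del: mult_pCons_left)
qed simp

text \<open>With \<open>T\<close> the Hermitian form of an eigenvector, symmetry gives \<open>l \<parallel>v\<parallel>\<^sup>2 = T = cnj l \<parallel>v\<parallel>\<^sup>2\<close>.\<close>
lemma complex_eigenvalue_sym_real:
  assumes A: "A \<in> carrier_mat n n" and sym: "transpose_mat A = A"
    and ev: "eigenvalue (map_mat complex_of_real A) l"
  shows "l \<in> \<real>"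
proof -
  let ?M = "map_mat complex_of_real A"
  have M: "?M \<in> carrier_mat n n" using A by auto
  obtain v where v: "v \<in> carrier_vec n" "v \<noteq> 0\<^sub>v n" "?M *\<^sub>v v = l \<cdot>\<^sub>v v"
    using ev M unfolding eigenvalue_def eigenvector_def by auto
  define w where "w = map_vec cnj v"
  have w: "w \<in> carrier_vec n" using v by (auto simp: w_def)
  have Mij: "?M $$ (i, j) = complex_of_real (A $$ (i, j))" if "i < n" "j < n" for i j
    using A that by auto
  have Aji: "A $$ (j, i) = A $$ (i, j)" if "i < n" "j < n" for i j
    using arg_cong[OF sym, of "\<lambda>B. B $$ (i, j)"] A that by auto
  have Mv: "(\<Sum>j<n. ?M $$ (i, j) * v $ j) = l * v $ i" if i: "i < n" for i
  proof -
    have "(?M *\<^sub>v v) $ i = (\<Sum>j<n. ?M $$ (i, j) * v $ j)"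
      using M v(1) i by (auto simp: scalar_prod_def atLeast0LessThan)
    then show ?thesis unfolding v(3) using v(1) i by simp
  qed
  define S where "S = (\<Sum>i<n. cnj (v $ i) * v $ i)"
  define T where "T = (\<Sum>i<n. \<Sum>j<n. cnj (v $ i) * (?M $$ (i, j) * v $ j))"
  have 1: "T = l * S"
    unfolding T_def S_def by (simp add: sum_distrib_left[symmetric] Mv) (simp add: sum_distrib_left mult_ac)
  have "T = (\<Sum>j<n. \<Sum>i<n. cnj (v $ i) * (?M $$ (i, j) * v $ j))"
    unfolding T_def by (rule sum.swap)
  also have "\<dots> = (\<Sum>j<n. v $ j * cnj (\<Sum>i<n. ?M $$ (j, i) * v $ i))"
    by (intro sum.cong) (auto simp: sum_distrib_left Mij Aji mult_ac)
  also have "\<dots> = cnj l * S"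
    unfolding S_def by (simp add: Mv) (simp add: sum_distrib_left mult_ac)
  finally have "l * S = cnj l * S" using 1 by simp
  moreover have "S \<noteq> 0"
  proof
    assume "S = 0"
    have "S = complex_of_real (\<Sum>i<n. (cmod (v $ i))\<^sup>2)"
      unfolding S_def by (simp only: of_real_sum complex_norm_square mult.commute)
    with \<open>S = 0\<close> have "(\<Sum>i<n. (cmod (v $ i))\<^sup>2) = 0" by (metis of_real_eq_0_iff)
    then have "\<forall>i<n. v $ i = 0" by (subst (asm) sum_nonneg_eq_0_iff) auto
    then have "v = 0\<^sub>v n" using v(1) by (intro eq_vecI) auto
    with v(2) show False by simp
  qed
  ultimately show ?thesis by (simp add: Reals_cnj_iff)
qed

text \<open>A left inverse of a triangular matrix is triangular: its entries to the left of the diagonal vanish one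
  after the other.\<close>
lemma triangular_inverse_diagonal:
  fixes C T :: "real mat"
  assumes C: "C \<in> carrier_mat n n" and T: "T \<in> carrier_mat n n" and ut: "upper_triangular T"
    and d: "\<And>i. i < n \<Longrightarrow> T $$ (i, i) \<noteq> 0" and CT: "C * T = 1\<^sub>m n" and i: "i < n"
  shows "C $$ (i, i) = 1 / T $$ (i, i)"
proof -
  have eq: "(\<Sum>k<n. C $$ (i, k) * T $$ (k, j)) = (if i = j then 1 else 0)" if "j < n" for j
    using mult_mat_sum[OF C T i that] CT i that by simp
  have low: "T $$ (k, j) = 0" if "j < k" "k < n" for k j
    using ut T that by (auto simp: upper_triangular_def)
  have trunc: "(\<Sum>k<n. C $$ (i, k) * T $$ (k, j)) = (\<Sum>k<Suc j. C $$ (i, k) * T $$ (k, j))" 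
    if "j < n" for j
    using that low by (intro sum.mono_neutral_right) auto
  have zero: "j < i \<Longrightarrow> C $$ (i, j) = 0" for j
  proof (induction j rule: less_induct)
    case (less j)
    have "j < n" using less i by simp
    have "(\<Sum>k<Suc j. C $$ (i, k) * T $$ (k, j)) = 0"
      using eq[OF \<open>j < n\<close>] trunc[OF \<open>j < n\<close>] less by simp
    moreover have "(\<Sum>k<j. C $$ (i, k) * T $$ (k, j)) = 0"
      using less by (intro sum.neutral) auto
    ultimately show ?case using d[OF \<open>j < n\<close>] by simp
  qed
  have "(\<Sum>k<Suc i. C $$ (i, k) * T $$ (k, i)) = 1" using eq[OF i] trunc[OF i] by simp
  moreover have "(\<Sum>k<i. C $$ (i, k) * T $$ (k, i)) = 0" using zero by (intro sum.neutral) auto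
  ultimately show ?thesis using d[OF i] by (simp add: field_simps)
qed

text \<open>The characteristic polynomial splits over the reals, so a real Schur triangularisation exists; the
  resolvent becomes the inverse of a triangular matrix whose diagonal consists of the numbers \<open>e + x\<close>,
  and the trace does not see the change of basis.\<close>
lemma sym_psd_spectrum:
  assumes A: "sym_psd p A"
  obtains es where "length es = p" and "proots (char_poly A) = mset es" 
    and "\<And>e. e \<in> set es \<Longrightarrow> 0 \<le> e"
    and "\<And>x. 0 < x \<Longrightarrow> mtrace (resolvent x A) = (\<Sum>e\<leftarrow>es. 1 / (e + x))"
proof -
  have cA: "A \<in> carrier_mat p p" and sym: "transpose_mat A = A" using A by (auto simp: sym_psd_def)
  have "lead_coeff (char_poly A) = 1" using degree_monic_char_poly[OF cA] by simp
  moreover have "z \<in> \<real>" if "poly (map_poly complex_of_real (char_poly A)) z = 0" for z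
  proof (rule complex_eigenvalue_sym_real[OF cA sym])
    show "eigenvalue (map_mat complex_of_real A) z"
      using that cA by (subst eigenvalue_root_char_poly[of _ p]) (auto simp: of_real_hom.char_poly_hom[OF cA])
  qed
  ultimately obtain es where es: "char_poly A = (\<Prod>e\<leftarrow>es. [:- e, 1:])"
    using monic_real_rooted_splits by blast
  obtain B P Q where "schur_decomposition A es = (B, P, Q)" by (cases "schur_decomposition A es") auto
  from schur_decomposition[OF cA es this] have wit: "similar_mat_wit A B P Q" 
    and ut: "upper_triangular B" and diag: "diag_mat B = es" by auto
  note W = similar_mat_witD2[OF cA wit]
  have B: "B \<in> carrier_mat p p" and P: "P \<in> carrier_mat p p" and Q: "Q \<in> carrier_mat p p"
    and PQ: "P * Q = 1\<^sub>m p" and QP: "Q * P = 1\<^sub>m p" and AB: "A = P * B * Q" using W by auto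
  have len: "length es = p" using diag B by (auto simp: diag_mat_def)
  have esi: "es ! i = B $$ (i, i)" if "i < p" for i using diag B that by (auto simp: diag_mat_def)
  have roots: "proots (char_poly A) = mset es" unfolding es by (rule proots_prod_linear)
  have nonneg: "0 \<le> e" if e: "e \<in> set es" for e
  proof -
    have "poly (char_poly A) e = 0" unfolding es poly_prod_list using e
      by (auto simp: prod_list_zero_iff intro!: image_eqI)
    then have "eigenvalue A e" by (simp add: eigenvalue_root_char_poly[OF cA])
    then obtain v where v: "v \<in> carrier_vec p" "v \<noteq> 0\<^sub>v p" "A *\<^sub>v v = e \<cdot>\<^sub>v v"
      using cA unfolding eigenvalue_def eigenvector_def by auto
    have "0 \<le> v \<bullet> (A *\<^sub>v v)" using A v by (auto simp: sym_psd_def)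
    then have "0 \<le> e * (v \<bullet> v)" using v by simp
    moreover have "0 < v \<bullet> v"
      using scalar_prod_self_nonneg[of v] scalar_prod_self_eq_0[OF v(1)] v(2) by (cases "v \<bullet> v = 0") auto
    ultimately show ?thesis by (simp add: zero_le_mult_iff)
  qed
  have "mtrace (resolvent x A) = (\<Sum>e\<leftarrow>es. 1 / (e + x))" if x: "0 < x" for x
  proof -
    let ?R = "resolvent x A" and ?T = "B + x \<cdot>\<^sub>m 1\<^sub>m p"
    have R: "?R \<in> carrier_mat p p" by (rule resolvent_carrier[OF A x])
    have T: "?T \<in> carrier_mat p p" and S: "A + x \<cdot>\<^sub>m 1\<^sub>m p \<in> carrier_mat p p" using B cA by auto
    have X: "x \<cdot>\<^sub>m 1\<^sub>m p \<in> carrier_mat p p" by simp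
    have PX: "P * (x \<cdot>\<^sub>m 1\<^sub>m p) = x \<cdot>\<^sub>m P" "(x \<cdot>\<^sub>m 1\<^sub>m p) * P = x \<cdot>\<^sub>m P"
      using mult_smult_distrib[OF P one_carrier_mat] right_mult_one_mat[OF P] 
        mult_smult_assoc_mat[OF one_carrier_mat P] left_mult_one_mat[OF P] by simp_all
    have "A * P = P * B * (Q * P)" unfolding AB using P B Q by (intro assoc_mult_mat[of _ p p _ p _ p]) auto
    also have "\<dots> = P * B" using QP right_mult_one_mat[of "P * B" p p] P B by simp
    finally have AP: "A * P = P * B" .
    have PT: "P * ?T = (A + x \<cdot>\<^sub>m 1\<^sub>m p) * P"
      unfolding mult_add_distrib_mat[OF P B X] add_mult_distrib_mat[OF cA X P] AP PX ..
    let ?C = "Q * ?R * P"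
    have C: "?C \<in> carrier_mat p p" using P Q R by auto
    have "?C * ?T = Q * ?R * (P * ?T)" using P Q R T by (intro assoc_mult_mat[of _ p p _ p _ p]) auto
    also have "\<dots> = Q * (?R * (P * ?T))" using P Q R T by (intro assoc_mult_mat[of _ p p _ p _ p]) auto
    also have "?R * (P * ?T) = ?R * (A + x \<cdot>\<^sub>m 1\<^sub>m p) * P" unfolding PT by (rule assoc_mult_mat[OF R S P, symmetric])
    also have "\<dots> = P" using resolvent_left[OF A x] left_mult_one_mat[OF P] by simp
    finally have CT: "?C * ?T = 1\<^sub>m p" using QP by simp
    have Tii: "?T $$ (i, i) = es ! i + x" if "i < p" for i using that esi B by simp
    have "?T $$ (i, i) \<noteq> 0" if "i < p" for i
      unfolding Tii[OF that] using nonneg[of "es ! i"] that len x nth_mem[of i es] by fastforce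
    moreover have "upper_triangular ?T" using ut B by (auto simp: upper_triangular_def)
    ultimately have Cii: "?C $$ (i, i) = 1 / (es ! i + x)" if "i < p" for i
      using triangular_inverse_diagonal[OF C T _ _ CT that] Tii[OF that] by auto
    have "mtrace ?C = mtrace (P * (Q * ?R))" using P Q R by (intro mtrace_comm[of _ p]) auto
    also have "P * (Q * ?R) = P * Q * ?R" by (rule assoc_mult_mat[OF P Q R, symmetric])
    also have "\<dots> = ?R" using PQ left_mult_one_mat[OF R] by simp
    finally have "mtrace ?R = mtrace ?C" by simp
    also have "\<dots> = (\<Sum>i<p. 1 / (es ! i + x))" 
      using C Cii unfolding mtrace_def by (intro sum.cong) auto
    also have "\<dots> = (\<Sum>e\<leftarrow>es. 1 / (e + x))"
      using len by (simp add: sum_list_sum_nth atLeast0LessThan)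
    finally show ?thesis .
  qed
  with len roots nonneg show thesis by (intro that)
qed

section \<open>The Marchenko-Pastur distribution\<close>

text \<open>By the fundamental theorem of calculus; the antiderivative is elementary, built from the square root and two
  arcsines that run from \<open>-1\<close> to \<open>1\<close> over the interval.\<close>
lemma semicircle_quotient_has_integral:
  fixes A B :: real
  assumes A: "0 < A" and AB: "A < B"
  shows "((\<lambda>u. sqrt ((B - u) * (u - A)) / u) has_integral
    pi * ((A + B) / 2 - sqrt (A * B))) {A..B}"
proof -
  define w1 where "w1 u = (2 * u - A - B) / (B - A)" for u
  define w2 where "w2 u = ((A + B) - 2 * A * B / u) / (B - A)" for u
  define F where "F u = sqrt ((B - u) * (u - A)) + (A + B) / 2 * arcsin (w1 u)
    - sqrt (A * B) * arcsin (w2 u)" for u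
  have w1sq: "1 - (w1 u)\<^sup>2 = 4 * ((B - u) * (u - A)) / (B - A)\<^sup>2" for u
  proof -
    have "1 - (w1 u)\<^sup>2 = ((B - A)\<^sup>2 - (2 * u - A - B)\<^sup>2) / (B - A)\<^sup>2"
      unfolding w1_def power_divide using AB by (simp add: eq_divide_eq left_diff_distrib)
    also have "(B - A)\<^sup>2 - (2 * u - A - B)\<^sup>2 = 4 * ((B - u) * (u - A))"
      by (simp add: power2_eq_square algebra_simps)
    finally show ?thesis .
  qed
  have w2sq: "1 - (w2 u)\<^sup>2 = 4 * (A * B) * ((B - u) * (u - A)) / (u\<^sup>2 * (B - A)\<^sup>2)" if "u \<noteq> 0" for u
    using AB that by (simp add: w2_def power_divide divide_simps) (simp add: power2_eq_square algebra_simps)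
  have rng: "-1 \<le> w1 u \<and> w1 u \<le> 1" "-1 \<le> w2 u \<and> w2 u \<le> 1" if u: "u \<in> {A..B}" for u
  proof -
    have u0: "u \<noteq> 0" using u A by auto
    have "0 \<le> 1 - (w1 u)\<^sup>2" unfolding w1sq using u by (auto intro!: divide_nonneg_nonneg mult_nonneg_nonneg)
    then show "-1 \<le> w1 u \<and> w1 u \<le> 1" using abs_square_le_1[of "w1 u"] by (auto simp: abs_le_iff)
    have "0 \<le> 1 - (w2 u)\<^sup>2" unfolding w2sq[OF u0] using u A AB
      by (auto intro!: divide_nonneg_nonneg mult_nonneg_nonneg)
    then show "-1 \<le> w2 u \<and> w2 u \<le> 1" using abs_square_le_1[of "w2 u"] by (auto simp: abs_le_iff)
  qed
  have cont: "continuous_on {A..B} F"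
    unfolding F_def using rng A AB
    by (intro continuous_intros) (auto simp: w1_def w2_def intro!: continuous_intros)
  have deriv: "(F has_vector_derivative sqrt ((B - u) * (u - A)) / u) (at u)" if u: "u \<in> {A<..<B}" for u
  proof -
    define r where "r = sqrt ((B - u) * (u - A))"
    have pos: "0 < (B - u) * (u - A)" and u0: "0 < u" using u A by auto
    have r: "0 < r" and r2: "r * r = (B - u) * (u - A)" using pos by (auto simp: r_def)
    have AB0: "0 < A * B" and BA: "0 < B - A" using A AB by auto
    define g where "g = sqrt (A * B)"
    have g: "0 < g" "g * g = A * B" using AB0 by (auto simp: g_def)
    have s1: "sqrt (1 - (w1 u)\<^sup>2) = 2 * r / (B - A)"
      unfolding w1sq r_def using BA by (simp add: real_sqrt_divide real_sqrt_mult)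
    have s2: "sqrt (1 - (w2 u)\<^sup>2) = 2 * g * r / (u * (B - A))"
    proof (rule real_sqrt_unique)
      have "(2 * g * r / (u * (B - A)))\<^sup>2 = 4 * (g * g) * (r * r) / (u\<^sup>2 * (B - A)\<^sup>2)"
        by (simp add: power_divide power_mult_distrib power2_eq_square[of g] power2_eq_square[of r])
      then show "(2 * g * r / (u * (B - A)))\<^sup>2 = 1 - (w2 u)\<^sup>2"
        unfolding w2sq[OF less_imp_neq[OF u0, symmetric]] g(2) r2 .
      show "0 \<le> 2 * g * r / (u * (B - A))" using g(1) r u0 BA by simp
    qed
    have "0 < 1 - (w1 u)\<^sup>2" unfolding w1sq using pos BA by simp
    then have i1: "-1 < w1 u" "w1 u < 1" using abs_square_less_1[of "w1 u"] by (auto simp: abs_less_iff)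
    have "0 < 1 - (w2 u)\<^sup>2" unfolding w2sq[OF less_imp_neq[OF u0, symmetric]] using A u AB u0
      by (intro divide_pos_pos mult_pos_pos) auto
    then have i2: "-1 < w2 u" "w2 u < 1" using abs_square_less_1[of "w2 u"] by (auto simp: abs_less_iff)
    have dr: "((\<lambda>u. sqrt ((B - u) * (u - A))) has_real_derivative (A + B - 2 * u) / (2 * r)) (at u)"
      unfolding r_def using pos by (auto intro!: derivative_eq_intros simp: field_simps)
    have d1: "(w1 has_real_derivative 2 / (B - A)) (at u)"
      unfolding w1_def by (intro DERIV_cdivide) (auto intro!: derivative_eq_intros)
    have "((\<lambda>u. (A + B) - 2 * A * B / u) has_real_derivative 2 * A * B / (u * u)) (at u)"
      using u0 by (auto intro!: derivative_eq_intros)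
    from DERIV_cdivide[OF this, of "B - A"]
    have d2: "(w2 has_real_derivative 2 * A * B / (u * u * (B - A))) (at u)"
      unfolding w2_def by (simp add: divide_divide_eq_left)
    have a1: "((\<lambda>u. arcsin (w1 u)) has_real_derivative inverse (sqrt (1 - (w1 u)\<^sup>2)) * (2 / (B - A))) (at u)"
      using DERIV_chain2[OF DERIV_arcsin[OF i1] d1] .
    have a2: "((\<lambda>u. arcsin (w2 u)) has_real_derivative inverse (sqrt (1 - (w2 u)\<^sup>2)) * (2 * A * B / (u * u * (B - A)))) (at u)"
      using DERIV_chain2[OF DERIV_arcsin[OF i2] d2] .
    have "(F has_real_derivative (A + B - 2 * u) / (2 * r) + (A + B) / 2 * (inverse (sqrt (1 - (w1 u)\<^sup>2)) * (2 / (B - A)))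
        - g * (inverse (sqrt (1 - (w2 u)\<^sup>2)) * (2 * A * B / (u * u * (B - A))))) (at u)"
      unfolding F_def g_def by (intro DERIV_add DERIV_diff DERIV_cmult dr a1 a2)
    also have "(A + B) / 2 * (inverse (sqrt (1 - (w1 u)\<^sup>2)) * (2 / (B - A))) = (A + B) / (2 * r)"
      unfolding s1 using r BA by (simp add: field_simps)
    also have "g * (inverse (sqrt (1 - (w2 u)\<^sup>2)) * (2 * A * B / (u * u * (B - A)))) = A * B / (u * r)"
      unfolding s2 using r g BA u0 by (simp add: field_simps)
    also have "(A + B - 2 * u) / (2 * r) + (A + B) / (2 * r) - A * B / (u * r) = ((B - u) * (u - A)) / (u * r)"
      using r u0 by (simp add: field_simps)
    also have "\<dots> = r / u" unfolding r2[symmetric] using r by simp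
    finally show ?thesis unfolding r_def by (simp add: has_real_derivative_iff_has_vector_derivative)
  qed
  have "((\<lambda>u. sqrt ((B - u) * (u - A)) / u) has_integral F B - F A) {A..B}"
    using AB by (intro fundamental_theorem_of_calculus_interior cont deriv) auto
  moreover have "w1 B = 1" "w1 A = -1" "w2 B = 1" "w2 A = -1"
    using A AB by (auto simp: w1_def w2_def field_simps)
  then have "F B - F A = pi * ((A + B) / 2 - sqrt (A * B))"
    by (simp add: F_def field_simps)
  ultimately show ?thesis by simp
qed

definition mp_left :: "real \<Rightarrow> real" where "mp_left y = (1 - sqrt y)\<^sup>2 / 2"
definition mp_right :: "real \<Rightarrow> real" where "mp_right y = (1 + sqrt y)\<^sup>2 / 2"

definition mp_resolvent :: "real \<Rightarrow> real \<Rightarrow> real" where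
  "mp_resolvent y x = (\<integral>u. 1 / (u + x) \<partial>mp_distr y)"

context
  fixes y :: real
  assumes y: "0 < y" "y < 1"
begin

lemma mp_edges: "0 < mp_left y" "mp_left y < mp_right y" "mp_left y + mp_right y = 1 + y"
  "mp_left y * mp_right y = ((1 - y) / 2)\<^sup>2"
proof -
  have s: "0 < sqrt y" "sqrt y < 1" and s2: "sqrt y * sqrt y = y" using y by auto
  show "0 < mp_left y" using s by (simp add: mp_left_def)
  show "mp_left y < mp_right y" using s by (simp add: mp_left_def mp_right_def power2_eq_square algebra_simps)
  have "(1 - sqrt y)\<^sup>2 + (1 + sqrt y)\<^sup>2 = 2 * (1 + y)"
    using s2 by (simp add: power2_eq_square algebra_simps)
  then show "mp_left y + mp_right y = 1 + y" by (simp add: mp_left_def mp_right_def)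
  have "mp_left y * mp_right y = ((1 - sqrt y) * (1 + sqrt y))\<^sup>2 / 4"
    by (simp add: mp_left_def mp_right_def power_mult_distrib)
  also have "(1 - sqrt y) * (1 + sqrt y) = 1 - y" using s2 by (simp add: algebra_simps)
  finally show "mp_left y * mp_right y = ((1 - y) / 2)\<^sup>2" by (simp add: power_divide)
qed

lemma mp_density_eq:
  "mp_density y x = indicator {mp_left y..mp_right y} x * (sqrt ((mp_right y - x) * (x - mp_left y)) / x) / (pi * y)"
  by (auto simp: mp_density_def Let_def mp_left_def mp_right_def indicator_def)

lemma mp_density_measurable [measurable]: "mp_density y \<in> borel_measurable borel"
  unfolding mp_density_eq[abs_def] by measurable

lemma mp_density_nonneg: "0 \<le> mp_density y x"
  unfolding mp_density_eq using mp_edges(1) y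
  by (auto simp: indicator_def intro!: divide_nonneg_nonneg mult_nonneg_nonneg)

lemma shifted_semicircle_lebesgue:
  assumes s: "0 \<le> s"
  shows "has_bochner_integral lborel
    (\<lambda>x. indicator {mp_left y..mp_right y} x * (sqrt ((mp_right y - x) * (x - mp_left y)) / (x + s)))
    (pi * ((1 + y) / 2 + s - sqrt (((1 - y) / 2)\<^sup>2 + (1 + y) * s + s\<^sup>2)))"
proof -
  let ?a = "mp_left y" and ?b = "mp_right y"
  let ?h = "\<lambda>x. sqrt ((?b - x) * (x - ?a)) / (x + s)"
  have cont: "continuous_on {?a..?b} ?h" using mp_edges(1) s by (intro continuous_intros) auto
  have "((\<lambda>u. sqrt ((?b + s - u) * (u - (?a + s))) / u) has_integral
      pi * ((?a + s + (?b + s)) / 2 - sqrt ((?a + s) * (?b + s)))) {?a + s..?b + s}"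
    using mp_edges s by (intro semicircle_quotient_has_integral) auto
  from has_integral_affinity[of _ _ "?a + s" "?b + s" 1 s, unfolded cbox_interval, OF this]
  have "(?h has_integral pi * ((?a + s + (?b + s)) / 2 - sqrt ((?a + s) * (?b + s)))) {?a..?b}"
    by (simp add: algebra_simps image_affinity_atLeastAtMost_diff)
  moreover have "(?a + s + (?b + s)) / 2 - sqrt ((?a + s) * (?b + s))
      = (1 + y) / 2 + s - sqrt (((1 - y) / 2)\<^sup>2 + (1 + y) * s + s\<^sup>2)"
  proof -
    have "(?a + s) * (?b + s) = ?a * ?b + (?a + ?b) * s + s\<^sup>2" by (simp add: power2_eq_square algebra_simps)
    then show ?thesis using mp_edges(3,4) by simp
  qed
  ultimately have I: "(?h has_integral pi * ((1 + y) / 2 + s - sqrt (((1 - y) / 2)\<^sup>2 + (1 + y) * s + s\<^sup>2))) {?a..?b}"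
    by simp
  have si: "set_integrable lborel {?a..?b} ?h"
    by (rule borel_integrable_atLeastAtMost'[OF cont])
  have "(LINT x:{?a..?b}|lborel. ?h x) = integral {?a..?b} ?h"
    by (rule set_borel_integral_eq_integral(2)[OF si])
  then have "(LINT x:{?a..?b}|lborel. ?h x) = pi * ((1 + y) / 2 + s - sqrt (((1 - y) / 2)\<^sup>2 + (1 + y) * s + s\<^sup>2))"
    using I by (simp add: integral_unique)
  then show ?thesis using si
    by (simp add: has_bochner_integral_iff set_integrable_def set_lebesgue_integral_def)
qed

lemma semicircle_lebesgue_at_zero:
  "has_bochner_integral lborel
    (\<lambda>x. indicator {mp_left y..mp_right y} x * (sqrt ((mp_right y - x) * (x - mp_left y)) / (x + 0))) (pi * y)"
proof -
  have "sqrt (((1 - y) / 2)\<^sup>2 + (1 + y) * 0 + 0\<^sup>2) = \<bar>(1 - y) / 2\<bar>"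
    by (simp only: mult_zero_right add_0_right zero_power2 real_sqrt_abs)
  then have "(1 + y) / 2 + 0 - sqrt (((1 - y) / 2)\<^sup>2 + (1 + y) * 0 + 0\<^sup>2) = y"
    using y by (simp add: field_simps)
  with shifted_semicircle_lebesgue[of 0] show ?thesis by (simp only: order_refl)
qed

lemma mp_density_has_integral: "has_bochner_integral lborel (mp_density y) 1"
  using has_bochner_integral_divide_zero[OF semicircle_lebesgue_at_zero, of "pi * y"] y
  unfolding mp_density_eq[abs_def] by simp

lemma mp_distr_real_distribution: "real_distribution (mp_distr y)"
proof -
  have "emeasure (mp_distr y) (space (mp_distr y)) = (\<integral>\<^sup>+x. ennreal (mp_density y x) \<partial>lborel)"
    by (simp add: mp_distr_def emeasure_density)
  also have "\<dots> = 1"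
    using mp_density_has_integral mp_density_nonneg
    by (subst nn_integral_eq_integral) (auto simp: has_bochner_integral_iff)
  finally interpret prob_space "mp_distr y" by (rule prob_spaceI)
  show ?thesis by unfold_locales (auto simp: mp_distr_def)
qed

lemma mp_distr_nonneg: "AE x in mp_distr y. 0 \<le> x"
  unfolding mp_distr_def using mp_edges(1)
  by (subst AE_density) (auto simp: mp_density_eq indicator_def split: if_splits)

text \<open>Partial fractions reduce \<open>1 / (u (u + x))\<close> to the integral above at the shifts \<open>0\<close> and \<open>x\<close>; this
  yields \<open>x y m + x + (1 - y) / 2 = D\<close> with an explicit square root \<open>D\<close>, and squaring gives the equation.\<close>
lemma mp_resolvent_quadratic:
  assumes x: "0 < x"
  shows "x * y * (mp_resolvent y x)\<^sup>2 + (2 * x + 1 - y) * mp_resolvent y x - 2 = 0"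
    and "0 \<le> mp_resolvent y x"
proof -
  define D where "D = sqrt (((1 - y) / 2)\<^sup>2 + (1 + y) * x + x\<^sup>2)"
  let ?h = "\<lambda>s u. indicator {mp_left y..mp_right y} u * (sqrt ((mp_right y - u) * (u - mp_left y)) / (u + s))"
  have D2: "D\<^sup>2 = ((1 - y) / 2)\<^sup>2 + (1 + y) * x + x\<^sup>2" using x y unfolding D_def
    by (intro real_sqrt_pow2 add_nonneg_nonneg) auto
  have h0: "has_bochner_integral lborel (?h 0) (pi * y)" by (rule semicircle_lebesgue_at_zero)
  have hx: "has_bochner_integral lborel (?h x) (pi * ((1 + y) / 2 + x - D))"
    unfolding D_def using x by (intro shifted_semicircle_lebesgue) auto
  have "mp_resolvent y x = (\<integral>u. mp_density y u * (1 / (u + x)) \<partial>lborel)"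
    unfolding mp_resolvent_def mp_distr_def using mp_density_nonneg
    by (subst integral_density) auto
  also have "\<dots> = (\<integral>u. (?h 0 u - ?h x u) / (pi * y * x) \<partial>lborel)"
  proof (intro Bochner_Integration.integral_cong refl)
    fix u
    have "S / u / (pi * y) * (1 / (u + x)) = (S / (u + 0) - S / (u + x)) / (pi * y * x)"
      if "0 < u" for S
      using that x y by (simp add: divide_simps) (simp add: algebra_simps)
    then show "mp_density y u * (1 / (u + x)) = (?h 0 u - ?h x u) / (pi * y * x)"
      using mp_edges(1) unfolding mp_density_eq by (cases "u \<in> {mp_left y..mp_right y}") auto
  qed
  also have "\<dots> = (pi * y - pi * ((1 + y) / 2 + x - D)) / (pi * y * x)"
    using has_bochner_integral_diff[OF h0 hx] by (simp add: has_bochner_integral_iff)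
  also have "\<dots> = (D - (x + (1 - y) / 2)) / (x * y)" using x y by (simp add: field_simps)
  finally have m: "x * y * mp_resolvent y x = D - (x + (1 - y) / 2)" using x y by simp
  then have "(x * y * mp_resolvent y x + (x + (1 - y) / 2))\<^sup>2 = D\<^sup>2" by simp
  then have "x * y * (x * y * (mp_resolvent y x)\<^sup>2 + (2 * x + 1 - y) * mp_resolvent y x - 2) = 0"
    unfolding D2 by (simp add: power2_eq_square field_simps)
  then show "x * y * (mp_resolvent y x)\<^sup>2 + (2 * x + 1 - y) * mp_resolvent y x - 2 = 0" using x y by simp
  have "AE u in mp_distr y. 0 \<le> 1 / (u + x)" using mp_distr_nonneg x by (auto elim!: eventually_mono)
  then show "0 \<le> mp_resolvent y x" unfolding mp_resolvent_def by (rule integral_nonneg_AE)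
qed

end

section \<open>Weak convergence from traces of resolvents\<close>

text \<open>Extraction of coefficients: if \<open>e\<^sub>j\<close> has the expansion with coefficients \<open>d\<^sub>i\<close> in powers of the small
  parameter \<open>-s\<^sub>j\<close>, uniformly in \<open>n\<close>, then vanishing of all \<open>e\<^sub>j\<close> in the limit forces vanishing
  of every coefficient. Once the coefficients below \<open>k\<close> are known to vanish, dividing by \<open>s\<^sub>j ^ k\<close> leaves an
  error of order \<open>s\<^sub>j\<close>, and \<open>j\<close> is arbitrary.\<close>
lemma triangular_tendsto_zero:
  fixes d :: "nat \<Rightarrow> nat \<Rightarrow> real" and e :: "nat \<Rightarrow> nat \<Rightarrow> real" and s :: "nat \<Rightarrow> real"
  assumes s: "\<And>j. 0 < s j" "s \<longlonglongrightarrow> 0"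
    and e: "\<And>j. e j \<longlonglongrightarrow> 0"
    and approx: "\<And>j k n. \<bar>e j n - (\<Sum>i\<le>k. (- s j) ^ i * d i n)\<bar> \<le> B * s j ^ Suc k"
  shows "d k \<longlonglongrightarrow> 0"
proof (induction k rule: less_induct)
  case (less k)
  show ?case
  proof (rule tendstoI)
    fix \<epsilon> :: real assume \<epsilon>: "0 < \<epsilon>"
    have "(\<lambda>j. B * s j) \<longlonglongrightarrow> B * 0" by (intro tendsto_intros s)
    then have "eventually (\<lambda>j. B * s j < \<epsilon> / 2) sequentially" using \<epsilon> by (intro order_tendstoD) auto
    then obtain j where j: "B * s j < \<epsilon> / 2" by (auto simp: eventually_sequentially)
    define q where "q n = \<bar>e j n - (\<Sum>i<k. (- s j) ^ i * d i n)\<bar>" for n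
    have "q \<longlonglongrightarrow> \<bar>0 - (\<Sum>i<k. (- s j) ^ i * 0)\<bar>"
      unfolding q_def using less by (intro tendsto_intros e) auto
    then have "q \<longlonglongrightarrow> 0" by simp
    then have "eventually (\<lambda>n. q n < \<epsilon> / 2 * s j ^ k) sequentially"
      using \<epsilon> s(1)[of j] by (intro order_tendstoD) auto
    then show "eventually (\<lambda>n. dist (d k n) 0 < \<epsilon>) sequentially"
    proof eventually_elim
      case (elim n)
      have "\<bar>(- s j) ^ k * d k n\<bar> \<le> q n + B * s j ^ Suc k"
        using approx[of j n k] unfolding q_def lessThan_Suc_atMost[symmetric] by simp
      also have "\<dots> < \<epsilon> / 2 * s j ^ k + \<epsilon> / 2 * s j ^ k"
      proof (intro add_strict_mono elim)
        have "B * s j ^ Suc k = (B * s j) * s j ^ k" by simp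
        also have "\<dots> < \<epsilon> / 2 * s j ^ k" using j s(1)[of j] by (intro mult_strict_right_mono) auto
        finally show "B * s j ^ Suc k < \<epsilon> / 2 * s j ^ k" .
      qed
      also have "\<dots> = s j ^ k * \<epsilon>" by simp
      finally have "s j ^ k * \<bar>d k n\<bar> < s j ^ k * \<epsilon>"
        using s(1)[of j] by (simp add: abs_mult power_abs)
      then show ?case using s(1)[of j] by simp
    qed
  qed
qed

text \<open>In the variable \<open>t = 1 / (1 + u)\<close> a step function that vanishes for large \<open>u\<close> vanishes near \<open>t = 0\<close>, so it is
  continuous up to that endpoint.\<close>
lemma cts_step_compactified_continuous:
  assumes ab: "a < b"
  shows "continuous_on {0..1} (\<lambda>t. if t \<le> 0 then 0 else cts_step a b (1 / t - 1))"
    (is "continuous_on _ ?h")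
proof -
  \<comment> \<open>For \<open>t \<le> \<delta>\<close> the argument \<open>1 / t - 1\<close> is at least \<open>1 + \<bar>b\<bar>\<close>, beyond the support of the step.\<close>
  define \<delta> where "\<delta> = 1 / (2 + \<bar>b\<bar>)"
  have \<delta>: "0 < \<delta>" "\<delta> \<le> 1" by (auto simp: \<delta>_def)
  have zero: "?h t = 0" if "t \<le> \<delta>" for t
  proof (cases "t \<le> 0")
    case False
    then have "2 + \<bar>b\<bar> \<le> 1 / t" using that by (simp add: \<delta>_def field_simps)
    then have "b \<le> 1 / t - 1" by linarith
    then show ?thesis using ab by (simp add: cts_step_def)
  qed auto
  have "continuous_on {0..\<delta>} ?h" using zero continuous_on_cong[of "{0..\<delta>}" "{0..\<delta>}" ?h "\<lambda>_. 0"] by auto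
  moreover have "continuous_on {\<delta>..1} (\<lambda>t. cts_step a b (1 / t - 1))"
  proof (rule continuous_on_compose2[of UNIV "cts_step a b"])
    show "continuous_on UNIV (cts_step a b)"
      by (rule uniformly_continuous_imp_continuous[OF cts_step_uniformly_continuous[OF ab]])
    show "continuous_on {\<delta>..1} (\<lambda>t. 1 / t - 1)" using \<delta> by (intro continuous_intros) auto
  qed auto
  then have "continuous_on {\<delta>..1} ?h"
    using \<delta> continuous_on_cong[of "{\<delta>..1}" "{\<delta>..1}" ?h "\<lambda>t. cts_step a b (1 / t - 1)"] by auto
  ultimately have "continuous_on ({0..\<delta>} \<union> {\<delta>..1}) ?h" by (intro continuous_on_closed_Un) auto
  moreover have "{0..\<delta>} \<union> {\<delta>..1} = {0..1}" using \<delta> by auto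
  ultimately show ?thesis by simp
qed

text \<open>Let \<open>L\<^sub>n f\<close> be the difference of the integrals of \<open>f (1 / (1 + u))\<close> under the two measures. The hypothesis says
  that \<open>L\<^sub>n\<close> tends to \<open>0\<close> on \<open>t / (1 + s t)\<close> for a null sequence of \<open>s\<close>. Expanding in \<open>s\<close> gives the same on
  monomials, and the Weierstrass theorem extends it to the step functions that test weak convergence.\<close>
lemma weak_conv_of_resolvents:
  fixes \<mu> :: "nat \<Rightarrow> real measure" and \<nu> :: "real measure"
  assumes \<mu>: "\<And>n. real_distribution (\<mu> n)" and \<nu>: "real_distribution \<nu>"
    and \<mu>0: "\<And>n. AE u in \<mu> n. 0 \<le> u" and \<nu>0: "AE u in \<nu>. 0 \<le> u"
    and s: "\<And>j. 0 < s j" "s \<longlonglongrightarrow> (0 :: real)"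
    and conv: "\<And>j. (\<lambda>n. \<integral>u. 1 / (u + (1 + s j)) \<partial>\<mu> n) \<longlonglongrightarrow> (\<integral>u. 1 / (u + (1 + s j)) \<partial>\<nu>)"
  shows "weak_conv_m \<mu> \<nu>"
proof (rule integral_cts_step_conv_imp_weak_conv[OF \<mu> \<nu>])
  fix a b :: real assume ab: "a < b"
  \<comment> \<open>The absolute value makes \<open>t\<close> bounded on the whole line; the measures live where it has no effect.\<close>
  define t :: "real \<Rightarrow> real" where "t u = 1 / (1 + \<bar>u\<bar>)" for u
  have [measurable]: "t \<in> borel_measurable borel" unfolding t_def by measurable
  have t01: "0 < t u" "t u \<le> 1" for u by (auto simp: t_def)
  have bint: "integrable \<kappa> f" if "real_distribution \<kappa>" "f \<in> borel_measurable borel" "\<And>u. \<bar>f u\<bar> \<le> C"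
    for \<kappa> :: "real measure" and f :: "real \<Rightarrow> real" and C
  proof -
    interpret real_distribution \<kappa> by fact
    show ?thesis using that by (intro integrable_const_bound[of _ C]) auto
  qed
  have bval: "\<bar>\<integral>u. f u \<partial>\<kappa>\<bar> \<le> C" if "real_distribution \<kappa>" "f \<in> borel_measurable borel" "\<And>u. \<bar>f u\<bar> \<le> C"
    for \<kappa> :: "real measure" and f :: "real \<Rightarrow> real" and C
  proof -
    interpret real_distribution \<kappa> by fact
    have "\<bar>\<integral>u. f u \<partial>\<kappa>\<bar> \<le> (\<integral>u. \<bar>f u\<bar> \<partial>\<kappa>)" by (rule integral_abs_bound)
    also have "\<dots> \<le> (\<integral>u. C \<partial>\<kappa>)" using that by (intro integral_mono integrable_abs bint) auto
    finally show ?thesis using prob_space by simp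
  qed
  define L where "L n f = (\<integral>u. f (t u) \<partial>\<mu> n) - (\<integral>u. f (t u) \<partial>\<nu>)" for n and f :: "real \<Rightarrow> real"
  have pow: "(\<lambda>u. c * t u ^ i) \<in> borel_measurable borel" "\<bar>c * t u ^ i\<bar> \<le> \<bar>c\<bar>" for c i u
    using t01 less_imp_le[OF t01(1)] by (auto simp: abs_mult power_abs intro!: mult_left_le power_le_one)
  have powint: "integrable \<kappa> (\<lambda>u. c * t u ^ i)" if "real_distribution \<kappa>" for \<kappa> c i
    by (rule bint[OF that pow])
  have powint1: "integrable \<kappa> (\<lambda>u. t u ^ i)" if "real_distribution \<kappa>" for \<kappa> i
    using powint[OF that, of 1 i] by simp
  have powsum: "(\<integral>u. (\<Sum>i\<in>I. c i * t u ^ m i) \<partial>\<kappa>) = (\<Sum>i\<in>I. c i * (\<integral>u. t u ^ m i \<partial>\<kappa>))"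
    if "real_distribution \<kappa>" for \<kappa> I and c :: "nat \<Rightarrow> real" and m
    by (subst Bochner_Integration.integral_sum) (auto simp: powint1[OF that] intro!: powint[OF that] sum.cong)
  have Lsum: "L n (\<lambda>x. \<Sum>i\<in>I. c i * x ^ m i) = (\<Sum>i\<in>I. c i * L n (\<lambda>x. x ^ m i))" for n I m and c :: "nat \<Rightarrow> real"
    unfolding L_def powsum[OF \<mu>] powsum[OF \<nu>] by (simp add: sum_subtractf right_diff_distrib)
  have "(\<lambda>n. L n (\<lambda>x. x ^ Suc k)) \<longlonglongrightarrow> 0" for k
  proof (rule triangular_tendsto_zero[where s = s and B = 2 and
        e = "\<lambda>j n. L n (\<lambda>x. x / (1 + s j * x))" and d = "\<lambda>k n. L n (\<lambda>x. x ^ Suc k)"])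
    fix j
    have eq: "(\<integral>u. t u / (1 + s j * t u) \<partial>\<kappa>) = (\<integral>u. 1 / (u + (1 + s j)) \<partial>\<kappa>)"
      if \<kappa>: "real_distribution \<kappa>" "AE u in \<kappa>. 0 \<le> u" for \<kappa>
    proof -
      interpret real_distribution \<kappa> by (rule \<kappa>)
      have pt: "t u / (1 + s j * t u) = 1 / (u + (1 + s j))" if "0 \<le> u" for u
        using that s(1)[of j] by (simp add: t_def divide_simps)
      show ?thesis
        by (rule integral_cong_AE) (use \<kappa>(2) pt in \<open>auto elim!: eventually_mono\<close>)
    qed
    show "(\<lambda>n. L n (\<lambda>x. x / (1 + s j * x))) \<longlonglongrightarrow> 0"
      unfolding L_def eq[OF \<mu> \<mu>0] eq[OF \<nu> \<nu>0] using tendsto_diff[OF conv[of j] tendsto_const[of "\<integral>u. 1 / (u + (1 + s j)) \<partial>\<nu>"]]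
      by simp
    fix k n
    define R where "R x = x / (1 + s j * x) - (\<Sum>i\<le>k. (- s j) ^ i * x ^ Suc i)" for x
    have [measurable]: "R \<in> borel_measurable borel" unfolding R_def by measurable
    have R: "\<bar>R (t u)\<bar> \<le> s j ^ Suc k" for u
    proof -
      let ?x = "t u" and ?z = "- s j * t u"
      have pos: "0 < 1 + s j * ?x" using t01[of u] s(1)[of j] by (intro add_pos_pos) auto
      have "(\<Sum>i\<le>k. (- s j) ^ i * ?x ^ Suc i) = ?x * (\<Sum>i\<le>k. ?z ^ i)"
        unfolding power_mult_distrib sum_distrib_left by (simp add: mult_ac)
      also have "(\<Sum>i\<le>k. ?z ^ i) = (1 - ?z ^ Suc k) / (1 - ?z)"
        using pos sum_gp0[of ?z k] by (simp add: algebra_simps)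
      finally have "R ?x = ?x * ?z ^ Suc k / (1 + s j * ?x)"
        unfolding R_def using pos by (simp add: field_simps)
      then have "\<bar>R ?x\<bar> = ?x * (s j * ?x) ^ Suc k / (1 + s j * ?x)"
        using pos t01[of u] s(1)[of j] by (simp add: abs_mult power_abs)
      also have "\<dots> \<le> ?x * (s j * ?x) ^ Suc k / 1"
        using pos t01[of u] s(1)[of j] by (intro divide_left_mono) auto
      also have "\<dots> \<le> 1 * (s j * 1) ^ Suc k / 1"
        using t01[of u] s(1)[of j] by (intro divide_right_mono mult_mono power_mono) auto
      finally show ?thesis by simp
    qed
    have split: "(\<integral>u. t u / (1 + s j * t u) \<partial>\<kappa>) = (\<integral>u. R (t u) \<partial>\<kappa>) + (\<integral>u. (\<Sum>i\<le>k. (- s j) ^ i * t u ^ Suc i) \<partial>\<kappa>)"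
      if \<kappa>: "real_distribution \<kappa>" for \<kappa>
    proof -
      have "integrable \<kappa> (\<lambda>u. R (t u))" by (rule bint[OF \<kappa> _ R]) measurable
      moreover have "integrable \<kappa> (\<lambda>u. \<Sum>i\<le>k. (- s j) ^ i * t u ^ Suc i)"
        by (intro Bochner_Integration.integrable_sum powint \<kappa>)
      ultimately show ?thesis
        by (subst Bochner_Integration.integral_add[symmetric]) (auto simp: R_def)
    qed
    have "L n (\<lambda>x. x / (1 + s j * x)) - (\<Sum>i\<le>k. (- s j) ^ i * L n (\<lambda>x. x ^ Suc i))
        = (\<integral>u. R (t u) \<partial>\<mu> n) - (\<integral>u. R (t u) \<partial>\<nu>)"
      unfolding Lsum[symmetric] unfolding L_def split[OF \<mu>] split[OF \<nu>] by simp
    also have "\<bar>\<dots>\<bar> \<le> s j ^ Suc k + s j ^ Suc k"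
      using bval[OF \<mu>[of n] _ R] bval[OF \<nu> _ R] by (intro order_trans[OF abs_triangle_ineq4] add_mono) auto
    finally show "\<bar>L n (\<lambda>x. x / (1 + s j * x)) - (\<Sum>i\<le>k. (- s j) ^ i * L n (\<lambda>x. x ^ Suc i))\<bar>
      \<le> 2 * s j ^ Suc k" by simp
  qed (use s in auto)
  moreover have "L n (\<lambda>x. x ^ 0) = 0" for n
  proof -
    interpret m: real_distribution "\<mu> n" by (rule \<mu>)
    interpret n: real_distribution \<nu> by (rule \<nu>)
    show ?thesis using m.prob_space n.prob_space by (simp add: L_def)
  qed
  ultimately have mom: "(\<lambda>n. L n (\<lambda>x. x ^ k)) \<longlonglongrightarrow> 0" for k by (cases k) auto
  define h where "h x = (if x \<le> 0 then 0 else cts_step a b (1 / x - 1))" for x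
  have hc: "continuous_on {0..1} h" unfolding h_def by (rule cts_step_compactified_continuous[OF ab])
  have [measurable]: "cts_step a b \<in> borel_measurable borel"
    by (intro borel_measurable_continuous_onI uniformly_continuous_imp_continuous cts_step_uniformly_continuous ab)
  have [measurable]: "h \<in> borel_measurable borel" unfolding h_def by measurable
  have hval: "(\<integral>u. h (t u) \<partial>\<kappa>) = (\<integral>u. cts_step a b u \<partial>\<kappa>)"
    if \<kappa>: "real_distribution \<kappa>" "AE u in \<kappa>. 0 \<le> u" for \<kappa>
  proof -
    interpret real_distribution \<kappa> by (rule \<kappa>)
    have "h (t u) = cts_step a b u" if "0 \<le> u" for u using that t01(1)[of u] by (simp add: h_def t_def)
    then show ?thesis by (intro integral_cong_AE) (use \<kappa>(2) in \<open>auto elim!: eventually_mono\<close>)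
  qed
  have "(\<lambda>n. L n h) \<longlonglongrightarrow> 0"
  proof (rule tendstoI)
    fix \<epsilon> :: real assume \<epsilon>: "0 < \<epsilon>"
    obtain g where g: "real_polynomial_function g" and gh: "\<And>x. x \<in> {0..1} \<Longrightarrow> \<bar>h x - g x\<bar> < \<epsilon> / 4"
      using Stone_Weierstrass_real_polynomial_function[OF compact_Icc hc, of "\<epsilon> / 4"] \<epsilon> by auto
    obtain c N where gp: "g = (\<lambda>x. \<Sum>i\<le>N. c i * x ^ i)"
      using g unfolding real_polynomial_function_iff_sum by blast
    have [measurable]: "g \<in> borel_measurable borel" unfolding gp by measurable
    have "(\<lambda>n. \<Sum>i\<le>N. c i * L n (\<lambda>x. x ^ i)) \<longlonglongrightarrow> (\<Sum>i\<le>N. c i * 0)"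
      by (intro tendsto_intros mom)
    then have "(\<lambda>n. L n g) \<longlonglongrightarrow> 0" unfolding gp Lsum by simp
    then have "eventually (\<lambda>n. \<bar>L n g\<bar> < \<epsilon> / 2) sequentially"
      using tendstoD[of "\<lambda>n. L n g" 0 sequentially "\<epsilon> / 2"] \<epsilon> by (simp add: dist_real_def)
    then show "eventually (\<lambda>n. dist (L n h) 0 < \<epsilon>) sequentially"
    proof eventually_elim
      case (elim n)
      have dh: "\<bar>h (t u) - g (t u)\<bar> \<le> \<epsilon> / 4" for u using gh[of "t u"] t01[of u] by auto
      have "(\<integral>u. h (t u) \<partial>\<kappa>) = (\<integral>u. h (t u) - g (t u) \<partial>\<kappa>) + (\<integral>u. g (t u) \<partial>\<kappa>)"
        if \<kappa>: "real_distribution \<kappa>" for \<kappa>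
      proof -
        have "integrable \<kappa> (\<lambda>u. h (t u) - g (t u))" by (rule bint[OF \<kappa> _ dh]) measurable
        moreover have "integrable \<kappa> (\<lambda>u. g (t u))" unfolding gp
          by (intro Bochner_Integration.integrable_sum powint \<kappa>)
        ultimately show ?thesis by (subst Bochner_Integration.integral_add[symmetric]) auto
      qed
      then have "L n h = L n g + ((\<integral>u. h (t u) - g (t u) \<partial>\<mu> n) - (\<integral>u. h (t u) - g (t u) \<partial>\<nu>))"
        unfolding L_def using \<mu> \<nu> by simp
      moreover have "\<bar>\<integral>u. h (t u) - g (t u) \<partial>\<mu> n\<bar> \<le> \<epsilon> / 4" by (rule bval[OF \<mu> _ dh]) measurable
      moreover have "\<bar>\<integral>u. h (t u) - g (t u) \<partial>\<nu>\<bar> \<le> \<epsilon> / 4" by (rule bval[OF \<nu> _ dh]) measurable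
      ultimately show ?case using elim by (simp add: dist_real_def abs_less_iff) linarith
    qed
  qed
  then have "(\<lambda>n. (\<integral>u. cts_step a b u \<partial>\<mu> n) - (\<integral>u. cts_step a b u \<partial>\<nu>)) \<longlonglongrightarrow> 0"
    unfolding L_def hval[OF \<mu> \<mu>0] hval[OF \<nu> \<nu>0] .
  then show "(\<lambda>n. integral\<^sup>L (\<mu> n) (cts_step a b)) \<longlonglongrightarrow> integral\<^sup>L \<nu> (cts_step a b)"
    by (simp add: LIM_zero_iff)
qed

text \<open>The distribution function \<open>esd A\<close> is that of a uniformly chosen eigenvalue, whose law has the trace of the
  resolvent, divided by \<open>p\<close>, as its integral of \<open>1 / (u + x)\<close>.\<close>
lemma esd_weak_conv:
  fixes A :: "nat \<Rightarrow> real mat" and p :: "nat \<Rightarrow> nat"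
  assumes A: "\<And>n. n0 \<le> n \<Longrightarrow> sym_psd (p n) (A n)" and p: "\<And>n. n0 \<le> n \<Longrightarrow> 0 < p n"
    and \<nu>: "real_distribution \<nu>" "AE u in \<nu>. 0 \<le> u"
    and s: "\<And>j. 0 < s j" "s \<longlonglongrightarrow> (0 :: real)"
    and conv: "\<And>j. (\<lambda>n. mtrace (resolvent (1 + s j) (A n)) / real (p n)) \<longlonglongrightarrow> (\<integral>u. 1 / (u + (1 + s j)) \<partial>\<nu>)"
  shows "weak_conv (\<lambda>n. esd (A n)) (cdf \<nu>)"
proof -
  have "\<exists>\<kappa>. real_distribution \<kappa> \<and> (AE u in \<kappa>. 0 \<le> u) \<and> (n0 \<le> n \<longrightarrow> cdf \<kappa> = esd (A n) \<and>
    (\<forall>x>0. (\<integral>u. 1 / (u + x) \<partial>\<kappa>) = mtrace (resolvent x (A n)) / real (p n)))" for n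
  proof (cases "n0 \<le> n")
    case True
    obtain es where es: "length es = p n" "proots (char_poly (A n)) = mset es" 
        "\<And>e. e \<in> set es \<Longrightarrow> 0 \<le> e"
        "\<And>x. 0 < x \<Longrightarrow> mtrace (resolvent x (A n)) = (\<Sum>e\<leftarrow>es. 1 / (e + x))"
      using sym_psd_spectrum[OF A[OF True]] by blast
    have p0: "0 < p n" by (rule p[OF True])
    let ?P = "pmf_of_set {..<p n}"
    have ne: "{..<p n} \<noteq> {}" "finite {..<p n}" using p0 by auto
    define \<kappa> where "\<kappa> = distr (measure_pmf ?P) borel (\<lambda>i. es ! i)"
    have rd: "real_distribution \<kappa>"
    proof -
      interpret prob_space \<kappa> unfolding \<kappa>_def by (rule prob_space.prob_space_distr) (auto intro: prob_space_measure_pmf)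
      show ?thesis by unfold_locales (auto simp: \<kappa>_def)
    qed
    moreover have "AE u in \<kappa>. 0 \<le> u" unfolding \<kappa>_def
      using es(1,3) ne p0 by (subst AE_distr_iff) (auto simp: AE_measure_pmf_iff)
    moreover have "cdf \<kappa> = esd (A n)"
    proof
      fix x
      have "cdf \<kappa> x = measure (measure_pmf ?P) {i. es ! i \<le> x}"
        unfolding cdf_def \<kappa>_def by (subst measure_distr) (auto intro!: arg_cong[where f = "measure _"])
      also have "\<dots> = real (card {i. i < p n \<and> es ! i \<le> x}) / real (p n)"
        using ne by (subst measure_pmf_of_set) (auto intro!: arg_cong[where f = card])
      also have "card {i. i < p n \<and> es ! i \<le> x} = size {#l \<in># mset es. l \<le> x#}"
        using es(1) by (simp add: length_filter_conv_card mset_filter[symmetric] del: mset_filter)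
      finally show "cdf \<kappa> x = esd (A n) x"
        using sym_psd_carrier[OF A[OF True], of 1] es(2) by (auto simp: esd_def)
    qed
    moreover have "(\<integral>u. 1 / (u + x) \<partial>\<kappa>) = mtrace (resolvent x (A n)) / real (p n)" if "0 < x" for x
    proof -
      have "(\<integral>u. 1 / (u + x) \<partial>\<kappa>) = (\<integral>i. 1 / (es ! i + x) \<partial>measure_pmf ?P)"
        unfolding \<kappa>_def by (rule integral_distr) auto
      also have "\<dots> = (\<Sum>i<p n. 1 / (es ! i + x)) / real (p n)"
        using ne by (subst integral_pmf_of_set) auto
      also have "(\<Sum>i<p n. 1 / (es ! i + x)) = (\<Sum>e\<leftarrow>es. 1 / (e + x))"
        using es(1) by (simp add: sum_list_sum_nth atLeast0LessThan)
      finally show ?thesis using es(4)[OF that] by simp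
    qed
    ultimately show ?thesis by blast
  next
    case False
    then show ?thesis using \<nu> by (intro exI[of _ \<nu>]) auto
  qed
  then obtain \<kappa> where \<kappa>: "\<And>n. real_distribution (\<kappa> n)" "\<And>n. AE u in \<kappa> n. 0 \<le> u"
      "\<And>n. n0 \<le> n \<Longrightarrow> cdf (\<kappa> n) = esd (A n)"
      "\<And>n x. n0 \<le> n \<Longrightarrow> 0 < x \<Longrightarrow> (\<integral>u. 1 / (u + x) \<partial>\<kappa> n) = mtrace (resolvent x (A n)) / real (p n)"
    by metis
  have "weak_conv_m \<kappa> \<nu>"
  proof (rule weak_conv_of_resolvents[OF \<kappa>(1) \<nu>(1) \<kappa>(2) \<nu>(2) s])
    fix j
    have "0 < 1 + s j" using s(1)[of j] by simp
    then have "eventually (\<lambda>n. mtrace (resolvent (1 + s j) (A n)) / real (p n) = (\<integral>u. 1 / (u + (1 + s j)) \<partial>\<kappa> n)) sequentially"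
      using \<kappa>(4) by (auto simp: eventually_sequentially intro!: exI[of _ n0])
    then show "(\<lambda>n. \<integral>u. 1 / (u + (1 + s j)) \<partial>\<kappa> n) \<longlonglongrightarrow> (\<integral>u. 1 / (u + (1 + s j)) \<partial>\<nu>)"
      using conv[of j] by (rule Lim_transform_eventually[rotated])
  qed
  then have W: "weak_conv (\<lambda>n. cdf (\<kappa> n)) (cdf \<nu>)" by (simp add: weak_conv_m_def)
  show ?thesis unfolding weak_conv_def
  proof (intro allI impI)
    fix x assume "isCont (cdf \<nu>) x"
    then have "(\<lambda>n. cdf (\<kappa> n) x) \<longlonglongrightarrow> cdf \<nu> x" using W by (auto simp: weak_conv_def)
    moreover have "eventually (\<lambda>n. cdf (\<kappa> n) x = esd (A n) x) sequentially"
      using \<kappa>(3) by (auto simp: eventually_sequentially intro!: exI[of _ n0])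
    ultimately show "(\<lambda>n. esd (A n) x) \<longlonglongrightarrow> cdf \<nu> x" by (rule Lim_transform_eventually)
  qed
qed

section \<open>Concentration under bounded differences\<close>

text \<open>McDiarmid's inequality in exponential form, by integrating out one coordinate at a time: given the others, the
  function ranges over an interval of length \<open>2 c\<close>, so Hoeffding's lemma bounds its exponential
  moment, and the partial mean \<open>g\<close> inherits the bounded differences.\<close>
lemma bounded_differences_mgf:
  fixes N :: "'i \<Rightarrow> 'b measure" and f :: "('i \<Rightarrow> 'b) \<Rightarrow> real"
  assumes N: "\<And>i. prob_space (N i)" and I: "finite I" and l: "0 < l" and c: "0 \<le> c"
    and f: "f \<in> borel_measurable (PiM I N)"
    and bnd: "\<And>\<xi>. \<xi> \<in> space (PiM I N) \<Longrightarrow> \<bar>f \<xi>\<bar> \<le> K"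
    and diff: "\<And>\<xi> i z. \<xi> \<in> space (PiM I N) \<Longrightarrow> i \<in> I \<Longrightarrow> z \<in> space (N i) \<Longrightarrow>
      \<bar>f (\<xi>(i := z)) - f \<xi>\<bar> \<le> c"
  shows "(\<integral>\<^sup>+\<xi>. exp (l * (f \<xi> - (\<integral>\<xi>. f \<xi> \<partial>(PiM I N)))) \<partial>(PiM I N))
    \<le> ennreal (exp (l\<^sup>2 * c\<^sup>2 * real (card I) / 2))"
  using I f bnd diff
proof (induction I arbitrary: f rule: finite_induct)
  case empty
  show ?case
    by (simp add: PiM_empty nn_integral_count_space_finite lebesgue_integral_count_space_finite)
next
  case (insert i I)
  interpret Ni: prob_space "N i" by (rule N)
  interpret N: product_prob_space N by (rule product_prob_spaceI[OF N])
  interpret PI: prob_space "PiM I N" by (intro prob_space_PiM N)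
  interpret PII: prob_space "PiM (insert i I) N" by (intro prob_space_PiM N)
  note [measurable] = insert.prems(1)
  have upd: "\<xi>(i := z) \<in> space (PiM (insert i I) N)" if "\<xi> \<in> space (PiM I N)" "z \<in> space (N i)" for \<xi> z
    using that by (auto simp: space_PiM PiE_iff extensional_def)
  have [measurable]: "(\<lambda>(\<xi>, z). f (\<xi>(i := z))) \<in> borel_measurable (PiM I N \<Otimes>\<^sub>M N i)"
    using measurable_comp[OF measurable_add_dim insert.prems(1)] by (simp add: comp_def case_prod_unfold)
  have [measurable]: "(\<lambda>z. f (\<xi>(i := z))) \<in> borel_measurable (N i)" if "\<xi> \<in> space (PiM I N)" for \<xi>
    using measurable_compose[OF measurable_Pair1'[OF that]
      \<open>(\<lambda>(\<xi>, z). f (\<xi>(i := z))) \<in> borel_measurable (PiM I N \<Otimes>\<^sub>M N i)\<close>] by simp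
  define g where "g \<xi> = (\<integral>z. f (\<xi>(i := z)) \<partial>N i)" for \<xi>
  have g: "g \<in> borel_measurable (PiM I N)" unfolding g_def by measurable
  have int: "integrable (N i) (\<lambda>z. f (\<xi>(i := z)))" if "\<xi> \<in> space (PiM I N)" for \<xi>
    using that insert.prems(2) upd by (intro Ni.integrable_const_bound[of _ K]) auto
  have gb: "\<bar>g \<xi>\<bar> \<le> K" if "\<xi> \<in> space (PiM I N)" for \<xi>
  proof -
    have "\<bar>g \<xi>\<bar> \<le> (\<integral>z. \<bar>f (\<xi>(i := z))\<bar> \<partial>N i)" unfolding g_def by (rule integral_abs_bound)
    also have "\<dots> \<le> (\<integral>z. K \<partial>N i)"
      using that insert.prems(2) upd by (intro integral_mono integrable_abs int) auto
    finally show ?thesis by (simp add: Ni.prob_space)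
  qed
  have gd: "\<bar>g (\<xi>(j := z)) - g \<xi>\<bar> \<le> c" if "\<xi> \<in> space (PiM I N)" "j \<in> I" "z \<in> space (N j)" for \<xi> j z
  proof -
    have ij: "i \<noteq> j" using that insert.hyps by auto
    have w: "\<xi>(j := z) \<in> space (PiM I N)" using that by (auto simp: space_PiM PiE_iff extensional_def)
    have "g (\<xi>(j := z)) - g \<xi> = (\<integral>u. f ((\<xi>(j := z))(i := u)) - f (\<xi>(i := u)) \<partial>N i)"
      unfolding g_def by (rule Bochner_Integration.integral_diff[OF int[OF w] int[OF that(1)], symmetric])
    also have "\<bar>\<dots>\<bar> \<le> (\<integral>u. \<bar>f ((\<xi>(j := z))(i := u)) - f (\<xi>(i := u))\<bar> \<partial>N i)"
      by (rule integral_abs_bound)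
    also have "\<dots> \<le> (\<integral>u. c \<partial>N i)"
    proof (intro integral_mono integrable_abs Bochner_Integration.integrable_diff int w that)
      fix u assume u: "u \<in> space (N i)"
      show "\<bar>f ((\<xi>(j := z))(i := u)) - f (\<xi>(i := u))\<bar> \<le> c"
        unfolding fun_upd_twist[OF ij[symmetric]]
        by (rule insert.prems(3)[OF upd[OF that(1) u]]) (use that in auto)
    qed auto
    finally show ?thesis by (simp add: Ni.prob_space)
  qed
  define \<mu> where "\<mu> = (\<integral>\<xi>. f \<xi> \<partial>(PiM (insert i I) N))"
  have fint: "integrable (PiM (insert i I) N) f"
    using insert.prems(2) by (intro PII.integrable_const_bound[of _ K]) auto
  have \<mu>: "\<mu> = (\<integral>\<xi>. g \<xi> \<partial>(PiM I N))"
    unfolding \<mu>_def g_def using insert.hyps fint by (intro N.product_integral_insert) auto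
  have inner: "(\<integral>\<^sup>+z. exp (l * (f (\<xi>(i := z)) - \<mu>)) \<partial>N i)
      \<le> ennreal (exp (l\<^sup>2 * c\<^sup>2 / 2)) * ennreal (exp (l * (g \<xi> - \<mu>)))" if w: "\<xi> \<in> space (PiM I N)" for \<xi>
  proof -
    obtain z0 where z0: "z0 \<in> space (N i)" using Ni.not_empty by auto
    let ?a = "f (\<xi>(i := z0)) - c" and ?b = "f (\<xi>(i := z0)) + c"
    have in_ab: "f (\<xi>(i := z)) \<in> {?a..?b}" if z: "z \<in> space (N i)" for z
    proof -
      have "\<bar>f ((\<xi>(i := z0))(i := z)) - f (\<xi>(i := z0))\<bar> \<le> c"
        by (rule insert.prems(3)[OF upd[OF w z0] insertI1 z])
      then have "\<bar>f (\<xi>(i := z)) - f (\<xi>(i := z0))\<bar> \<le> c" unfolding fun_upd_upd .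
      then show ?thesis unfolding atLeastAtMost_iff by linarith
    qed
    interpret B: interval_bounded_random_variable "N i" "\<lambda>z. f (\<xi>(i := z))" ?a ?b
      using w in_ab by unfold_locales auto
    have "(\<integral>\<^sup>+z. exp (l * (f (\<xi>(i := z)) - \<mu>)) \<partial>N i)
      = (\<integral>\<^sup>+z. ennreal (exp (l * (g \<xi> - \<mu>))) * ennreal (exp (l * (f (\<xi>(i := z)) - g \<xi>))) \<partial>N i)"
      by (intro nn_integral_cong) (simp add: ennreal_mult[symmetric] mult_exp_exp algebra_simps)
    also have "\<dots> = ennreal (exp (l * (g \<xi> - \<mu>))) * (\<integral>\<^sup>+z. exp (l * (f (\<xi>(i := z)) - g \<xi>)) \<partial>N i)"
      using w by (intro nn_integral_cmult) auto
    also have "\<dots> \<le> ennreal (exp (l * (g \<xi> - \<mu>))) * ennreal (exp (l\<^sup>2 * (?b - ?a)\<^sup>2 / 8))"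
      using B.Hoeffdings_lemma_nn_integral[OF l] unfolding g_def by (intro mult_left_mono) auto
    also have "l\<^sup>2 * (?b - ?a)\<^sup>2 / 8 = l\<^sup>2 * c\<^sup>2 / 2" by (simp add: power2_eq_square field_simps)
    finally show ?thesis by (subst mult.commute)
  qed
  have "(\<integral>\<^sup>+\<xi>. exp (l * (f \<xi> - \<mu>)) \<partial>(PiM (insert i I) N))
    = (\<integral>\<^sup>+\<xi>. \<integral>\<^sup>+z. exp (l * (f (\<xi>(i := z)) - \<mu>)) \<partial>N i \<partial>(PiM I N))"
    using insert.hyps by (intro N.product_nn_integral_insert) auto
  also have "\<dots> \<le> (\<integral>\<^sup>+\<xi>. ennreal (exp (l\<^sup>2 * c\<^sup>2 / 2)) * ennreal (exp (l * (g \<xi> - \<mu>))) \<partial>(PiM I N))"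
    by (intro nn_integral_mono inner)
  also have "\<dots> = ennreal (exp (l\<^sup>2 * c\<^sup>2 / 2)) * (\<integral>\<^sup>+\<xi>. exp (l * (g \<xi> - \<mu>)) \<partial>(PiM I N))"
    using g by (intro nn_integral_cmult) auto
  also have "\<dots> \<le> ennreal (exp (l\<^sup>2 * c\<^sup>2 / 2)) * ennreal (exp (l\<^sup>2 * c\<^sup>2 * real (card I) / 2))"
    unfolding \<mu> by (intro mult_left_mono insert.IH g gb gd) auto
  also have "\<dots> = ennreal (exp (l\<^sup>2 * c\<^sup>2 * real (card (insert i I)) / 2))"
    using insert.hyps by (simp add: ennreal_mult[symmetric] mult_exp_exp algebra_simps add_divide_distrib)
  finally show ?case unfolding \<mu>_def .
qed

lemma power4_le_exp:
  fixes u :: real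
  assumes "0 \<le> u"
  shows "u ^ 4 \<le> 24 * exp u"
proof -
  have "(\<Sum>k<5. u ^ k /\<^sub>R fact k) \<le> (\<Sum>k. u ^ k /\<^sub>R fact k)"
    using assms by (intro sum_le_suminf summable_exp_generic) auto
  then have "(\<Sum>k<5. u ^ k / fact k) \<le> exp u"
    by (simp add: exp_def divide_inverse mult.commute)
  moreover have "u ^ 4 / 24 \<le> (\<Sum>k<5. u ^ k / fact k)"
    using assms by (simp add: eval_nat_numeral)
  ultimately show ?thesis by simp
qed

text \<open>The exponential bound at \<open>l = sqrt n\<close>, where \<open>n\<close> is the number of coordinates: then the exponent does not depend on
  \<open>n\<close>, and \<open>(l u) ^ 4 \<le> 24 exp (l u)\<close> contributes the factor \<open>1/n\<^sup>2\<close>.\<close>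
lemma bounded_differences_fourth_moment:
  fixes N :: "'i \<Rightarrow> 'b measure" and f :: "('i \<Rightarrow> 'b) \<Rightarrow> real"
  assumes N: "\<And>i. prob_space (N i)" and I: "finite I" and c: "0 \<le> c" and card: "0 < card I"
    and f: "f \<in> borel_measurable (PiM I N)"
    and bnd: "\<And>\<xi>. \<xi> \<in> space (PiM I N) \<Longrightarrow> \<bar>f \<xi>\<bar> \<le> K"
    and diff: "\<And>\<xi> i z. \<xi> \<in> space (PiM I N) \<Longrightarrow> i \<in> I \<Longrightarrow> z \<in> space (N i) \<Longrightarrow>
      \<bar>f (\<xi>(i := z)) - f \<xi>\<bar> \<le> c / real (card I)"
  shows "(\<integral>\<^sup>+\<xi>. ennreal ((f \<xi> - (\<integral>\<xi>. f \<xi> \<partial>(PiM I N))) ^ 4) \<partial>(PiM I N))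
    \<le> ennreal (48 * exp (c\<^sup>2 / 2) / (real (card I))\<^sup>2)"
proof -
  let ?n = "real (card I)" and ?P = "PiM I N"
  define \<mu> where "\<mu> = (\<integral>\<xi>. f \<xi> \<partial>?P)"
  define l where "l = sqrt ?n"
  have n: "0 < ?n" and l: "0 < l" and l2: "l\<^sup>2 = ?n" using card by (auto simp: l_def)
  have e: "l\<^sup>2 * (c / ?n)\<^sup>2 * ?n / 2 = c\<^sup>2 / 2" using n unfolding l2 by (simp add: power2_eq_square)
  have cn: "0 \<le> c / ?n" using c n by simp
  have up: "(\<integral>\<^sup>+\<xi>. exp (l * (f \<xi> - \<mu>)) \<partial>?P) \<le> ennreal (exp (c\<^sup>2 / 2))"
    using bounded_differences_mgf[OF N I l cn f bnd diff] unfolding e \<mu>_def by simp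
  have mf: "(\<lambda>\<xi>. - f \<xi>) \<in> borel_measurable ?P" using f by simp
  have m\<mu>: "(\<integral>\<xi>. - f \<xi> \<partial>?P) = - \<mu>" by (simp add: \<mu>_def)
  have "(\<integral>\<^sup>+\<xi>. exp (l * (- f \<xi> - (\<integral>\<xi>. - f \<xi> \<partial>?P))) \<partial>?P) \<le> ennreal (exp (l\<^sup>2 * (c / ?n)\<^sup>2 * ?n / 2))"
    using bnd diff by (intro bounded_differences_mgf[OF N I l cn mf, of K]) (auto simp: abs_minus_commute)
  then have down: "(\<integral>\<^sup>+\<xi>. exp (l * (\<mu> - f \<xi>)) \<partial>?P) \<le> ennreal (exp (c\<^sup>2 / 2))"
    unfolding e m\<mu> by simp
  have pt: "(f \<xi> - \<mu>) ^ 4 \<le> 24 / ?n\<^sup>2 * (exp (l * (f \<xi> - \<mu>)) + exp (l * (\<mu> - f \<xi>)))" for \<xi>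
  proof -
    have l4: "l ^ 4 = ?n\<^sup>2" using l2 by (metis power2_eq_square power4_eq_xxxx mult.assoc)
    have "(l * \<bar>f \<xi> - \<mu>\<bar>) ^ 4 \<le> 24 * exp (l * \<bar>f \<xi> - \<mu>\<bar>)"
      using l by (intro power4_le_exp) auto
    also have "exp (l * \<bar>f \<xi> - \<mu>\<bar>) \<le> exp (l * (f \<xi> - \<mu>)) + exp (l * (\<mu> - f \<xi>))"
      by (cases "f \<xi> \<ge> \<mu>") (auto simp: abs_if)
    finally have "?n\<^sup>2 * (f \<xi> - \<mu>) ^ 4 \<le> 24 * (exp (l * (f \<xi> - \<mu>)) + exp (l * (\<mu> - f \<xi>)))"
      by (simp add: power_mult_distrib l4)
    then show ?thesis using n by (simp add: field_simps)
  qed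
  have "(\<integral>\<^sup>+\<xi>. ennreal ((f \<xi> - \<mu>) ^ 4) \<partial>?P)
    \<le> (\<integral>\<^sup>+\<xi>. ennreal (24 / ?n\<^sup>2) * (ennreal (exp (l * (f \<xi> - \<mu>))) + ennreal (exp (l * (\<mu> - f \<xi>)))) \<partial>?P)"
  proof (intro nn_integral_mono)
    fix \<xi>
    have comb: "ennreal k * (ennreal a + ennreal b) = ennreal (k * (a + b))"
      if "0 \<le> k" "0 \<le> a" "0 \<le> b" for k a b
      using that by (simp only: ennreal_plus ennreal_mult add_nonneg_nonneg)
    show "ennreal ((f \<xi> - \<mu>) ^ 4)
      \<le> ennreal (24 / ?n\<^sup>2) * (ennreal (exp (l * (f \<xi> - \<mu>))) + ennreal (exp (l * (\<mu> - f \<xi>))))"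
      by (subst comb) (auto intro!: ennreal_leI pt simp del: times_divide_eq_left)
  qed
  also have "\<dots> = ennreal (24 / ?n\<^sup>2) * ((\<integral>\<^sup>+\<xi>. exp (l * (f \<xi> - \<mu>)) \<partial>?P) + (\<integral>\<^sup>+\<xi>. exp (l * (\<mu> - f \<xi>)) \<partial>?P))"
    using f by (subst nn_integral_cmult) (auto simp: nn_integral_add)
  also have "\<dots> \<le> ennreal (24 / ?n\<^sup>2) * (ennreal (exp (c\<^sup>2 / 2)) + ennreal (exp (c\<^sup>2 / 2)))"
    by (intro mult_left_mono add_mono up down) auto
  also have "\<dots> = ennreal (48 * exp (c\<^sup>2 / 2) / ?n\<^sup>2)"
    by (simp add: ennreal_mult[symmetric] ennreal_plus[symmetric] del: ennreal_plus)
  finally show ?thesis unfolding \<mu>_def .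
qed

text \<open>Summable fourth moments make the sum of the fourth powers integrable, hence finite almost everywhere.\<close>
lemma AE_tendsto_zero_fourth_moment:
  fixes g :: "nat \<Rightarrow> 'a \<Rightarrow> real"
  assumes g[measurable]: "\<And>n. n \<ge> n0 \<Longrightarrow> g n \<in> borel_measurable M"
    and le: "\<And>n. n \<ge> n0 \<Longrightarrow> (\<integral>\<^sup>+\<xi>. ennreal (g n \<xi> ^ 4) \<partial>M) \<le> ennreal (B / (real n)\<^sup>2)"
    and B: "0 \<le> B"
  shows "AE \<xi> in M. (\<lambda>n. g n \<xi>) \<longlonglongrightarrow> 0"
proof -
  define h where "h n \<xi> = (if n \<ge> n0 then g n \<xi> else 0)" for n \<xi>
  have [measurable]: "h n \<in> borel_measurable M" for n
    unfolding h_def using g by (cases "n \<ge> n0") auto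
  have hle: "(\<integral>\<^sup>+\<xi>. ennreal (h n \<xi> ^ 4) \<partial>M) \<le> ennreal (B / (real n)\<^sup>2)" for n
    using le[of n] B by (cases "n \<ge> n0") (auto simp: h_def)
  have summ: "summable (\<lambda>n. B / (real n)\<^sup>2)"
    using summable_mult[OF inverse_power_summable[of 2, where 'a = real], of B] by (simp add: divide_inverse)
  have "(\<integral>\<^sup>+\<xi>. (\<Sum>n. ennreal (h n \<xi> ^ 4)) \<partial>M) = (\<Sum>n. \<integral>\<^sup>+\<xi>. ennreal (h n \<xi> ^ 4) \<partial>M)"
    by (intro nn_integral_suminf) measurable
  also have "\<dots> \<le> (\<Sum>n. ennreal (B / (real n)\<^sup>2))" by (intro suminf_le hle) auto
  also have "\<dots> < \<infinity>" using summ B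
    by (subst suminf_ennreal2) (auto simp: less_top)
  finally have "AE \<xi> in M. (\<Sum>n. ennreal (h n \<xi> ^ 4)) \<noteq> \<infinity>"
    by (intro nn_integral_PInf_AE) auto
  then show ?thesis
  proof eventually_elim
    fix \<xi> assume fin: "(\<Sum>n. ennreal (h n \<xi> ^ 4)) \<noteq> \<infinity>"
    then have "summable (\<lambda>n. h n \<xi> ^ 4)" by (intro summable_suminf_not_top) (auto simp: top_unique)
    then have "(\<lambda>n. h n \<xi> ^ 4) \<longlonglongrightarrow> 0" by (rule summable_LIMSEQ_zero)
    then have "(\<lambda>n. h n \<xi>) \<longlonglongrightarrow> 0" by simp
    moreover have "eventually (\<lambda>n. h n \<xi> = g n \<xi>) sequentially"
      using eventually_ge_at_top[of n0] by eventually_elim (simp add: h_def)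
    ultimately show "(\<lambda>n. g n \<xi>) \<longlonglongrightarrow> 0" by (rule Lim_transform_eventually)
  qed
qed

section \<open>Functions of the data matrix\<close>

text \<open>A data matrix is a function of the index pair (coordinate, observation), both counted from \<open>1\<close>, while
  vectors are indexed from \<open>0\<close>.\<close>
definition colvec :: "nat \<Rightarrow> (nat \<times> nat \<Rightarrow> real) \<Rightarrow> nat \<Rightarrow> real Matrix.vec" where
  "colvec p d i = Matrix.vec p (\<lambda>k. d (Suc k, i))"

lemma colvec_carrier [simp]: "colvec p d i \<in> carrier_vec p"
  by (simp add: colvec_def)

lemma colvec_index [simp]: "k < p \<Longrightarrow> colvec p d i $ k = d (Suc k, i)"
  by (simp add: colvec_def)

lemma colvec_dim [simp]: "dim_vec (colvec p d i) = p"
  by (simp add: colvec_def)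

lemma det_measurable:
  assumes "\<And>i j. i < n \<Longrightarrow> j < n \<Longrightarrow> (\<lambda>\<omega>. A \<omega> $$ (i, j)) \<in> borel_measurable N"
    and "\<And>\<omega>. A \<omega> \<in> carrier_mat n n"
  shows "(\<lambda>\<omega>. det (A \<omega> :: real mat)) \<in> borel_measurable N"
proof -
  have "det (A \<omega>) = (\<Sum>\<pi>\<in>{\<pi>. \<pi> permutes {0..<n}}. signof \<pi> * (\<Prod>i = 0..<n. A \<omega> $$ (i, \<pi> i)))" for \<omega>
    by (rule det_def'[OF assms(2)])
  moreover have "(\<lambda>\<omega>. signof \<pi> * (\<Prod>i = 0..<n. A \<omega> $$ (i, \<pi> i))) \<in> borel_measurable N"
    if "\<pi> permutes {0..<n}" for \<pi>
    using permutes_in_image[OF that]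
    by (intro borel_measurable_times borel_measurable_prod assms(1)) auto
  ultimately show ?thesis by (simp add: borel_measurable_sum)
qed

lemma resolvent_entry_measurable:
  assumes A: "\<And>i j. i < n \<Longrightarrow> j < n \<Longrightarrow> (\<lambda>\<omega>. A \<omega> $$ (i, j)) \<in> borel_measurable N"
    and cA: "\<And>\<omega>. A \<omega> \<in> carrier_mat n n" and ij: "i < n" "j < n"
  shows "(\<lambda>\<omega>. resolvent x (A \<omega>) $$ (i, j)) \<in> borel_measurable N"
proof -
  let ?B = "\<lambda>\<omega>. A \<omega> + x \<cdot>\<^sub>m 1\<^sub>m n"
  have B: "(\<lambda>\<omega>. ?B \<omega> $$ (i, j)) \<in> borel_measurable N" if "i < n" "j < n" for i j
  proof -
    have "?B \<omega> $$ (i, j) = A \<omega> $$ (i, j) + (if i = j then x else 0)" for \<omega> using cA[of \<omega>] that by auto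
    then show ?thesis using A[OF that] by simp
  qed
  have cB: "?B \<omega> \<in> carrier_mat n n" for \<omega> using cA[of \<omega>] by auto
  have d: "(\<lambda>\<omega>. det (?B \<omega>)) \<in> borel_measurable N" by (rule det_measurable[OF B cB])
  have del: "(\<lambda>\<omega>. det (mat_delete (?B \<omega>) j i)) \<in> borel_measurable N"
  proof (rule det_measurable[of "n - 1"])
    fix a b assume ab: "a < n - 1" "b < n - 1"
    define u where "u = (if a < j then a else Suc a)"
    define v where "v = (if b < i then b else Suc b)"
    have uv: "u < n" "v < n" using ab by (auto simp: u_def v_def)
    have "mat_delete (?B \<omega>) j i $$ (a, b) = ?B \<omega> $$ (u, v)" for \<omega>
      using ab cA[of \<omega>] unfolding mat_delete_def u_def v_def by (subst index_mat) auto
    then show "(\<lambda>\<omega>. mat_delete (?B \<omega>) j i $$ (a, b)) \<in> borel_measurable N"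
      by (simp only: B[OF uv])
  qed (use cA in \<open>auto simp: mat_delete_def\<close>)
  have "resolvent x (A \<omega>) $$ (i, j) = 1 / det (?B \<omega>) * ((-1) ^ (j + i) * det (mat_delete (?B \<omega>) j i))" for \<omega>
  proof -
    have dim: "dim_row (A \<omega>) = n" "dim_col (A \<omega>) = n" using cA[of \<omega>] by auto
    show ?thesis using ij by (simp add: resolvent_def adj_mat_def cofactor_def dim)
  qed
  then show ?thesis using d del by simp
qed

lemma (in prob_space) second_moment_orthogonal_sum:
  assumes "finite A"
    and int: "\<And>a b. a \<in> A \<Longrightarrow> b \<in> A \<Longrightarrow> integrable M (\<lambda>\<omega>. W a \<omega> * W b \<omega> :: real)"
    and orth: "\<And>a b. a \<in> A \<Longrightarrow> b \<in> A \<Longrightarrow> a \<noteq> b \<Longrightarrow> expectation (\<lambda>\<omega>. W a \<omega> * W b \<omega>) = 0"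
  shows "integrable M (\<lambda>\<omega>. (\<Sum>a\<in>A. W a \<omega>)\<^sup>2)"
    and "expectation (\<lambda>\<omega>. (\<Sum>a\<in>A. W a \<omega>)\<^sup>2) = (\<Sum>a\<in>A. expectation (\<lambda>\<omega>. (W a \<omega>)\<^sup>2))"
proof -
  have sq: "(\<Sum>a\<in>A. W a \<omega>)\<^sup>2 = (\<Sum>a\<in>A. \<Sum>b\<in>A. W a \<omega> * W b \<omega>)" for \<omega>
    by (simp add: power2_eq_square sum_product)
  show "integrable M (\<lambda>\<omega>. (\<Sum>a\<in>A. W a \<omega>)\<^sup>2)" unfolding sq
    by (intro Bochner_Integration.integrable_sum int)
  have "expectation (\<lambda>\<omega>. (\<Sum>a\<in>A. W a \<omega>)\<^sup>2) = (\<Sum>a\<in>A. \<Sum>b\<in>A. expectation (\<lambda>\<omega>. W a \<omega> * W b \<omega>))"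
    unfolding sq
    by (subst Bochner_Integration.integral_sum)
      (auto intro!: Bochner_Integration.integrable_sum sum.cong Bochner_Integration.integral_sum int)
  also have "\<dots> = (\<Sum>a\<in>A. \<Sum>b\<in>A. if b = a then expectation (\<lambda>\<omega>. (W a \<omega>)\<^sup>2) else 0)"
    by (intro sum.cong) (auto simp: orth power2_eq_square)
  also have "\<dots> = (\<Sum>a\<in>A. expectation (\<lambda>\<omega>. (W a \<omega>)\<^sup>2))" using assms(1) by simp
  finally show "expectation (\<lambda>\<omega>. (\<Sum>a\<in>A. W a \<omega>)\<^sup>2) = (\<Sum>a\<in>A. expectation (\<lambda>\<omega>. (W a \<omega>)\<^sup>2))" .
qed

lemma (in prob_space) expectation_abs_le_sqrt:
  assumes f: "f \<in> borel_measurable M" and int: "integrable M (\<lambda>\<omega>. (f \<omega>)\<^sup>2)"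
    and le: "expectation (\<lambda>\<omega>. (f \<omega>)\<^sup>2) \<le> C"
  shows "integrable M f" and "expectation (\<lambda>\<omega>. \<bar>f \<omega>\<bar>) \<le> sqrt C"
proof -
  show i: "integrable M f"
    using int f by (rule square_integrable_imp_integrable[rotated])
  have "(expectation (\<lambda>\<omega>. \<bar>f \<omega>\<bar>))\<^sup>2 \<le> expectation (\<lambda>\<omega>. \<bar>f \<omega>\<bar>\<^sup>2)"
    using variance_positive[of "\<lambda>\<omega>. \<bar>f \<omega>\<bar>"] variance_eq[of "\<lambda>\<omega>. \<bar>f \<omega>\<bar>"] i int by simp
  also have "\<dots> \<le> C" using le by simp
  finally show "expectation (\<lambda>\<omega>. \<bar>f \<omega>\<bar>) \<le> sqrt C" by (rule real_le_rsqrt)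
qed

text \<open>Functions of the data that depend, measurably, only on the entries in \<open>B\<close>. Independence of the entries then
  becomes a product rule for functions that are local on disjoint sets of indices.\<close>
definition local_on :: "(nat \<times> nat) set \<Rightarrow> ((nat \<times> nat \<Rightarrow> real) \<Rightarrow> real) \<Rightarrow> bool" where
  "local_on B f \<longleftrightarrow> f \<in> borel_measurable (PiM B (\<lambda>_. borel)) \<and> (\<forall>d. f (restrict d B) = f d)"

named_theorems local_intros

lemma local_on_mono: assumes "local_on B f" "B \<subseteq> B'" shows "local_on B' f"
proof -
  have eq: "f = (\<lambda>d. f (restrict d B))" using assms(1) by (auto simp: local_on_def)
  have "(\<lambda>d. f (restrict d B)) \<in> borel_measurable (PiM B' (\<lambda>_. borel))"
    using assms by (intro measurable_compose[OF measurable_restrict_subset]) (auto simp: local_on_def)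
  moreover have "f (restrict d B') = f d" for d
  proof -
    have loc: "f (restrict e B) = f e" for e using assms(1) unfolding local_on_def by blast
    have "f (restrict d B') = f (restrict (restrict d B') B)" by (rule loc[symmetric])
    also have "restrict (restrict d B') B = restrict d B" using assms(2) by (auto simp: restrict_def fun_eq_iff)
    also have "f \<dots> = f d" by (rule loc)
    finally show ?thesis .
  qed
  ultimately show ?thesis unfolding local_on_def using eq by simp
qed

lemma local_on_coord [local_intros]: "a \<in> B \<Longrightarrow> local_on B (\<lambda>d. d a)"
  by (auto simp: local_on_def)

lemma local_on_const [local_intros]: "local_on B (\<lambda>d. c)"
  by (auto simp: local_on_def)

lemma local_on_add [local_intros]: "local_on B f \<Longrightarrow> local_on B g \<Longrightarrow> local_on B (\<lambda>d. f d + g d)"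
  by (auto simp: local_on_def)

lemma local_on_diff [local_intros]: "local_on B f \<Longrightarrow> local_on B g \<Longrightarrow> local_on B (\<lambda>d. f d - g d)"
  by (auto simp: local_on_def)

lemma local_on_mult [local_intros]: "local_on B f \<Longrightarrow> local_on B g \<Longrightarrow> local_on B (\<lambda>d. f d * g d)"
  by (auto simp: local_on_def)

lemma local_on_divide [local_intros]: "local_on B f \<Longrightarrow> local_on B g \<Longrightarrow> local_on B (\<lambda>d. f d / g d)"
  by (auto simp: local_on_def)

lemma local_on_power [local_intros]: "local_on B f \<Longrightarrow> local_on B (\<lambda>d. f d ^ k)"
  by (auto simp: local_on_def)

lemma local_on_sum [local_intros]: "(\<And>a. a \<in> A \<Longrightarrow> local_on B (f a)) \<Longrightarrow> local_on B (\<lambda>d. \<Sum>a\<in>A. f a d)"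
  by (auto simp: local_on_def intro!: borel_measurable_sum sum.cong)

lemma local_on_resolvent_entry:
  assumes A: "\<And>a b. a < p \<Longrightarrow> b < p \<Longrightarrow> local_on B (\<lambda>d. A d $$ (a, b))"
    and cA: "\<And>d. A d \<in> carrier_mat p p" and kl: "k < p" "l < p"
  shows "local_on B (\<lambda>d. resolvent x (A d) $$ (k, l))"
proof -
  have "A (restrict d B) = A d" for d
    using A cA[of d] cA[of "restrict d B"] by (intro eq_matI) (auto simp: local_on_def)
  then show ?thesis unfolding local_on_def
    using A by (auto intro!: resolvent_entry_measurable[OF _ cA kl] simp: local_on_def)
qed

lemma local_on_mtrace_resolvent:
  assumes A: "\<And>a b. a < p \<Longrightarrow> b < p \<Longrightarrow> local_on B (\<lambda>d. A d $$ (a, b))"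
    and psd: "\<And>d. sym_psd p (A d)" and x: "0 < x"
  shows "local_on B (\<lambda>d. mtrace (resolvent x (A d)))"
proof -
  have "(\<lambda>d. mtrace (resolvent x (A d))) = (\<lambda>d. \<Sum>i<p. resolvent x (A d) $$ (i, i))"
    using carrier_matD(1)[OF resolvent_carrier[OF psd x]] by (simp add: mtrace_def)
  then show ?thesis
    by (simp only:) (intro local_intros local_on_resolvent_entry[OF A sym_psd_carrier[OF psd x]], auto)
qed

text \<open>Half of the uncentred sample covariance matrix formed from the columns in \<open>I\<close>. The normalisation stays \<open>n\<close>
  when columns are left out.\<close>
definition half_cov :: "nat \<Rightarrow> nat \<Rightarrow> nat set \<Rightarrow> (nat \<times> nat \<Rightarrow> real) \<Rightarrow> real mat" where
  "half_cov p n I d = rank_one_sum p I (\<lambda>_. 1 / (2 * real n)) (colvec p d)"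

lemma half_cov_psd: "sym_psd p (half_cov p n I d)"
  unfolding half_cov_def by (intro rank_one_sum_psd) auto

lemma local_on_half_cov:
  assumes "\<And>k i. k < p \<Longrightarrow> i \<in> I \<Longrightarrow> (Suc k, i) \<in> B" and "a < p" "b < p"
  shows "local_on B (\<lambda>d. half_cov p n I d $$ (a, b))"
  using assms unfolding half_cov_def rank_one_sum_def
  by (auto intro!: local_intros)

section \<open>Arrays of independent centred entries\<close>

abbreviation (input) array_index :: "(nat \<times> nat) set" where "array_index \<equiv> {1..} \<times> {1..}"

text \<open>The common law of the entries is represented by its moments, so that every bound below is explicit in
  \<open>\<kappa>\<close>.\<close>
locale iid_array = prob_space M for M :: "'a measure" +
  fixes X :: "nat \<Rightarrow> nat \<Rightarrow> 'a \<Rightarrow> real" and \<kappa> :: real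
  assumes indep: "indep_vars (\<lambda>_. borel) (\<lambda>(k, i). X k i) array_index"
    and int4: "\<And>k i. k \<ge> 1 \<Longrightarrow> i \<ge> 1 \<Longrightarrow> integrable M (\<lambda>\<omega>. X k i \<omega> ^ 4)"
    and mom4: "\<And>k i. k \<ge> 1 \<Longrightarrow> i \<ge> 1 \<Longrightarrow> expectation (\<lambda>\<omega>. X k i \<omega> ^ 4) \<le> \<kappa>"
    and mean: "\<And>k i. k \<ge> 1 \<Longrightarrow> i \<ge> 1 \<Longrightarrow> expectation (X k i) = 0"
    and second: "\<And>k i. k \<ge> 1 \<Longrightarrow> i \<ge> 1 \<Longrightarrow> expectation (\<lambda>\<omega>. (X k i \<omega>)\<^sup>2) = 1"
begin

definition data :: "'a \<Rightarrow> nat \<times> nat \<Rightarrow> real" where "data \<omega> = (\<lambda>(k, i). X k i \<omega>)"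

lemma X_measurable: "k \<ge> 1 \<Longrightarrow> i \<ge> 1 \<Longrightarrow> X k i \<in> borel_measurable M"
  using indep by (auto simp: indep_vars_def)

lemma data_measurable: "B \<subseteq> array_index \<Longrightarrow> (\<lambda>\<omega>. restrict (data \<omega>) B) \<in> measurable M (PiM B (\<lambda>_. borel))"
proof (intro measurable_restrict)
  fix a assume "B \<subseteq> array_index" "a \<in> B"
  then obtain k i where "a = (k, i)" "k \<ge> 1" "i \<ge> 1" by auto
  then show "(\<lambda>\<omega>. data \<omega> a) \<in> borel_measurable M" using X_measurable by (simp add: data_def)
qed

lemma data_apply: "data \<omega> (k, i) = X k i \<omega>" by (simp add: data_def)

lemma local_measurable:
  assumes f: "local_on B f" and B: "B \<subseteq> array_index"
  shows "(\<lambda>\<omega>. f (data \<omega>)) \<in> borel_measurable M"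
proof -
  have fm: "f \<in> borel_measurable (PiM B (\<lambda>_. borel))" and fr: "f (restrict d B) = f d" for d
    using f unfolding local_on_def by blast+
  show ?thesis using measurable_compose[OF data_measurable[OF B] fm] unfolding fr .
qed

lemma local_factor:
  assumes f: "local_on A f" and g: "local_on B g"
    and AB: "A \<inter> B = {}" "A \<subseteq> array_index" "B \<subseteq> array_index"
    and int: "integrable M (\<lambda>\<omega>. f (data \<omega>))" "integrable M (\<lambda>\<omega>. g (data \<omega>))"
  shows "integrable M (\<lambda>\<omega>. f (data \<omega>) * g (data \<omega>))"
    and "expectation (\<lambda>\<omega>. f (data \<omega>) * g (data \<omega>)) = expectation (\<lambda>\<omega>. f (data \<omega>)) * expectation (\<lambda>\<omega>. g (data \<omega>))"
proof -
  have fm: "f \<in> borel_measurable (PiM A (\<lambda>_. borel))" and fr: "f (restrict d A) = f d" for d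
    using f unfolding local_on_def by blast+
  have gm: "g \<in> borel_measurable (PiM B (\<lambda>_. borel))" and gr: "g (restrict d B) = g d" for d
    using g unfolding local_on_def by blast+
  have eqD: "(\<lambda>i. (case i of (k, i) \<Rightarrow> X k i) \<omega>) = data \<omega>" for \<omega> by (auto simp: data_def)
  have "indep_var (PiM A (\<lambda>_. borel)) (\<lambda>\<omega>. restrict (data \<omega>) A) (PiM B (\<lambda>_. borel)) (\<lambda>\<omega>. restrict (data \<omega>) B)"
    using indep_var_restrict[OF indep AB] unfolding eqD .
  from indep_var_compose[OF this fm gm]
  have iv: "indep_var borel (\<lambda>\<omega>. f (data \<omega>)) borel (\<lambda>\<omega>. g (data \<omega>))"
    by (simp add: comp_def fr gr)
  show "integrable M (\<lambda>\<omega>. f (data \<omega>) * g (data \<omega>))" by (rule indep_var_integrable[OF iv int])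
  show "expectation (\<lambda>\<omega>. f (data \<omega>) * g (data \<omega>)) = expectation (\<lambda>\<omega>. f (data \<omega>)) * expectation (\<lambda>\<omega>. g (data \<omega>))"
    by (rule indep_var_lebesgue_integral[OF iv int])
qed

lemma integrable_entry: assumes "k \<ge> 1" "i \<ge> 1" 
  shows "integrable M (\<lambda>\<omega>. (X k i \<omega>)\<^sup>2)" "integrable M (X k i)"
proof -
  note m = X_measurable[OF assms]
  have "((X k i \<omega>)\<^sup>2)\<^sup>2 = X k i \<omega> ^ 4" for \<omega> by (simp add: power_mult[symmetric])
  then have "integrable M (\<lambda>\<omega>. ((X k i \<omega>)\<^sup>2)\<^sup>2)" using int4[OF assms] by (simp only:)
  then show i2: "integrable M (\<lambda>\<omega>. (X k i \<omega>)\<^sup>2)"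
    by (rule square_integrable_imp_integrable[rotated]) (use m in measurable)
  show "integrable M (X k i)" using m i2 by (rule square_integrable_imp_integrable)
qed

text \<open>A random variable that dominates \<open>1\<close> and finitely many entries and has a finite fourth moment: every polynomial of
  degree at most four in these entries is dominated by a multiple of its fourth power.\<close>
definition envelope :: "(nat \<times> nat) set \<Rightarrow> 'a \<Rightarrow> real" where
  "envelope F \<omega> = sqrt (sqrt (1 + (\<Sum>a\<in>F. data \<omega> a ^ 4)))"

lemma envelope_bounds:
  assumes "finite F"
  shows "1 \<le> envelope F \<omega>" and "a \<in> F \<Longrightarrow> \<bar>data \<omega> a\<bar> \<le> envelope F \<omega>"
    and "F \<subseteq> array_index \<Longrightarrow> integrable M (\<lambda>\<omega>. envelope F \<omega> ^ 4)"
proof -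
  have S: "0 \<le> (\<Sum>a\<in>F. data \<omega> a ^ 4)" for \<omega> by (intro sum_nonneg) simp
  have S1: "1 \<le> sqrt (1 + (\<Sum>a\<in>F. data \<omega> a ^ 4))" for \<omega>
    using S[of \<omega>] by (intro real_le_rsqrt) simp
  show ge1: "1 \<le> envelope F \<omega>"
    unfolding envelope_def using S1[of \<omega>] by (intro real_le_rsqrt) simp
  have fourth: "envelope F \<omega> ^ 4 = 1 + (\<Sum>a\<in>F. data \<omega> a ^ 4)" for \<omega>
  proof -
    have "(envelope F \<omega>)\<^sup>2 = sqrt (1 + (\<Sum>a\<in>F. data \<omega> a ^ 4))"
      unfolding envelope_def by (rule real_sqrt_pow2, rule order_trans[OF zero_le_one S1])
    then have "((envelope F \<omega>)\<^sup>2)\<^sup>2 = (sqrt (1 + (\<Sum>a\<in>F. data \<omega> a ^ 4)))\<^sup>2" by (simp only:)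
    also have "\<dots> = 1 + (\<Sum>a\<in>F. data \<omega> a ^ 4)"
      using S[of \<omega>] by (intro real_sqrt_pow2) linarith
    finally show ?thesis by (simp only: power_mult[symmetric] mult_2_right numeral_Bit0[symmetric])
  qed
  show "\<bar>data \<omega> a\<bar> \<le> envelope F \<omega>" if "a \<in> F"
  proof -
    have "data \<omega> a ^ 4 \<le> (\<Sum>a\<in>F. data \<omega> a ^ 4)" using assms that by (intro member_le_sum) auto
    then have "\<bar>data \<omega> a\<bar> ^ 4 \<le> envelope F \<omega> ^ 4" unfolding fourth power_even_abs_numeral[OF even_numeral] by linarith
    moreover have "0 \<le> envelope F \<omega>" using ge1 by linarith
    ultimately show ?thesis using power_mono_iff[of "\<bar>data \<omega> a\<bar>" "envelope F \<omega>" 4] by simp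
  qed
  show "integrable M (\<lambda>\<omega>. envelope F \<omega> ^ 4)" if "F \<subseteq> array_index"
    unfolding fourth using that int4
    by (intro Bochner_Integration.integrable_add Bochner_Integration.integrable_sum) (auto simp: data_def)
qed

lemma integrable_envelope_bound:
  assumes F: "finite F" "F \<subseteq> array_index" and f: "f \<in> borel_measurable M"
    and le: "\<And>\<omega>. \<bar>f \<omega>\<bar> \<le> C * envelope F \<omega> ^ 4"
  shows "integrable M (f :: 'a \<Rightarrow> real)"
proof (rule Bochner_Integration.integrable_bound[OF _ f])
  show "integrable M (\<lambda>\<omega>. C * envelope F \<omega> ^ 4)" using envelope_bounds(3)[OF F] by simp
  show "AE \<omega> in M. norm (f \<omega>) \<le> norm (C * envelope F \<omega> ^ 4)"
  proof (intro AE_I2)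
    fix \<omega> show "norm (f \<omega>) \<le> norm (C * envelope F \<omega> ^ 4)"
      unfolding real_norm_def by (rule order_trans[OF le abs_ge_self])
  qed
qed

lemma kappa_nonneg: "0 \<le> \<kappa>"
proof -
  have "0 \<le> expectation (\<lambda>\<omega>. X 1 1 \<omega> ^ 4)" by (intro integral_nonneg_AE AE_I2) simp
  then show ?thesis by (rule order_trans[OF _ mom4]) simp_all
qed

lemma sq_sq: "((u::real)\<^sup>2)\<^sup>2 = u ^ 4"
  by (simp add: power_mult[symmetric])

lemma expectation_sq_minus_one:
  assumes "k \<ge> 1" "i \<ge> 1"
  shows "integrable M (\<lambda>\<omega>. (X k i \<omega>)\<^sup>2 - 1)" "expectation (\<lambda>\<omega>. (X k i \<omega>)\<^sup>2 - 1) = 0"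
    "integrable M (\<lambda>\<omega>. ((X k i \<omega>)\<^sup>2 - 1)\<^sup>2)" "expectation (\<lambda>\<omega>. ((X k i \<omega>)\<^sup>2 - 1)\<^sup>2) \<le> \<kappa> + 1"
proof -
  note i2 = integrable_entry(1)[OF assms] and i4 = int4[OF assms]
  show "integrable M (\<lambda>\<omega>. (X k i \<omega>)\<^sup>2 - 1)" using i2 by simp
  show "expectation (\<lambda>\<omega>. (X k i \<omega>)\<^sup>2 - 1) = 0" using i2 second[OF assms] by (simp add: prob_space)
  have sq: "((X k i \<omega>)\<^sup>2 - 1)\<^sup>2 = X k i \<omega> ^ 4 - 2 * (X k i \<omega>)\<^sup>2 + 1" for \<omega>
    unfolding sq_sq[symmetric] by (simp add: power2_diff)
  show i: "integrable M (\<lambda>\<omega>. ((X k i \<omega>)\<^sup>2 - 1)\<^sup>2)" unfolding sq using i2 i4 by simp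
  have "expectation (\<lambda>\<omega>. ((X k i \<omega>)\<^sup>2 - 1)\<^sup>2) \<le> expectation (\<lambda>\<omega>. X k i \<omega> ^ 4 + 1)"
    using i i4 by (intro integral_mono) (auto simp: sq)
  also have "\<dots> \<le> \<kappa> + 1" using i4 mom4[OF assms] by (simp add: prob_space)
  finally show "expectation (\<lambda>\<omega>. ((X k i \<omega>)\<^sup>2 - 1)\<^sup>2) \<le> \<kappa> + 1" .
qed

lemma expectation_product_sq:
  assumes "k \<ge> 1" "i \<ge> 1" "l \<ge> 1" "j \<ge> 1"
  shows "integrable M (\<lambda>\<omega>. (X k i \<omega> * X l j \<omega>)\<^sup>2)" "expectation (\<lambda>\<omega>. (X k i \<omega> * X l j \<omega>)\<^sup>2) \<le> \<kappa> + 1"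
proof -
  note m = X_measurable[OF assms(1,2)] X_measurable[OF assms(3,4)]
  note i4 = int4[OF assms(1,2)] int4[OF assms(3,4)]
  have le: "(X k i \<omega> * X l j \<omega>)\<^sup>2 \<le> (X k i \<omega> ^ 4 + X l j \<omega> ^ 4) / 2" for \<omega>
    using zero_le_power2[of "(X k i \<omega>)\<^sup>2 - (X l j \<omega>)\<^sup>2"]
    unfolding sq_sq[symmetric] by (simp add: power2_diff power_mult_distrib)
  have b: "integrable M (\<lambda>\<omega>. (X k i \<omega> ^ 4 + X l j \<omega> ^ 4) / 2)" using i4 by simp
  have p4: "0 \<le> u ^ 4" for u :: real by simp
  show i: "integrable M (\<lambda>\<omega>. (X k i \<omega> * X l j \<omega>)\<^sup>2)"
  proof (rule Bochner_Integration.integrable_bound[OF b])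
    show "AE \<omega> in M. norm ((X k i \<omega> * X l j \<omega>)\<^sup>2) \<le> norm ((X k i \<omega> ^ 4 + X l j \<omega> ^ 4) / 2)"
      unfolding real_norm_def abs_power2
      by (intro AE_I2 order_trans[OF le abs_ge_self])
  qed (use m in measurable)
  have "expectation (\<lambda>\<omega>. (X k i \<omega> * X l j \<omega>)\<^sup>2) \<le> expectation (\<lambda>\<omega>. (X k i \<omega> ^ 4 + X l j \<omega> ^ 4) / 2)"
    by (intro integral_mono i b le)
  also have "\<dots> = (expectation (\<lambda>\<omega>. X k i \<omega> ^ 4) + expectation (\<lambda>\<omega>. X l j \<omega> ^ 4)) / 2"
    using i4 by simp
  also have "\<dots> \<le> \<kappa> + 1" using mom4[OF assms(1,2)] mom4[OF assms(3,4)] by simp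
  finally show "expectation (\<lambda>\<omega>. (X k i \<omega> * X l j \<omega>)\<^sup>2) \<le> \<kappa> + 1" .
qed

text \<open>The only source of cancellation: if a centred function of one entry is multiplied by something that does not
  involve this entry, the expectation of the product is zero.\<close>
lemma centred_factor_vanishes:
  assumes a: "(k, i) \<in> array_index"
    and u: "u = (\<lambda>t. t) \<or> u = (\<lambda>t. t\<^sup>2 - 1)"
    and g: "local_on (array_index - {(k, i)}) g" "integrable M (\<lambda>\<omega>. g (data \<omega>))"
  shows "expectation (\<lambda>\<omega>. u (X k i \<omega>) * g (data \<omega>)) = 0"
proof -
  have ki: "k \<ge> 1" "i \<ge> 1" using a by auto
  have "local_on {(k, i)} (\<lambda>d. u (d (k, i)))" using u by (auto intro!: local_intros)
  moreover have "integrable M (\<lambda>\<omega>. u (data \<omega> (k, i)))" "expectation (\<lambda>\<omega>. u (data \<omega> (k, i))) = 0"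
    using u integrable_entry(2)[OF ki] mean[OF ki] expectation_sq_minus_one(1,2)[OF ki] unfolding data_apply by auto
  ultimately show ?thesis
    using local_factor(2)[of "{(k, i)}" "\<lambda>d. u (d (k, i))" "array_index - {(k, i)}" g] g a
    unfolding data_apply by auto
qed

end

text \<open>The coefficient of the \<open>(k, l)\<close> entry of the matrix in \<open>x \<bullet> (R x) - tr R\<close>, where \<open>x\<close> is column \<open>i\<close>.\<close>
definition centred_product :: "nat \<Rightarrow> (nat \<times> nat \<Rightarrow> real) \<Rightarrow> nat \<times> nat \<Rightarrow> real" where
  "centred_product i d a = (if fst a = snd a then (d (Suc (fst a), i))\<^sup>2 - 1
    else d (Suc (fst a), i) * d (Suc (snd a), i))"

definition other_columns :: "nat \<Rightarrow> (nat \<times> nat) set" where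
  "other_columns i = {1..} \<times> ({1..} - {i})"

context iid_array
begin

lemma local_on_centred_product:
  assumes "(Suc (fst a), i) \<in> B" "(Suc (snd a), i) \<in> B"
  shows "local_on B (\<lambda>d. centred_product i d a)"
  using assms by (cases "fst a = snd a") (auto simp: centred_product_def intro!: local_intros)

lemma centred_product_bound:
  assumes "finite F" "(Suc (fst a), i) \<in> F" "(Suc (snd a), i) \<in> F"
  shows "\<bar>centred_product i (data \<omega>) a\<bar> \<le> 2 * (envelope F \<omega>)\<^sup>2"
proof -
  let ?r = "envelope F \<omega>"
  have r1: "1 \<le> ?r" and b: "\<bar>data \<omega> (Suc (fst a), i)\<bar> \<le> ?r" "\<bar>data \<omega> (Suc (snd a), i)\<bar> \<le> ?r"
    using envelope_bounds(1,2)[OF assms(1)] assms(2,3) by auto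
  have r2: "1 \<le> ?r\<^sup>2" using r1 by (rule one_le_power)
  have "\<bar>data \<omega> (Suc (fst a), i) * data \<omega> (Suc (snd a), i)\<bar> \<le> ?r * ?r"
    unfolding abs_mult using b r1 by (intro mult_mono) auto
  moreover have "(data \<omega> (Suc (fst a), i))\<^sup>2 \<le> ?r\<^sup>2"
    using b(1) r1 power_mono[OF b(1) abs_ge_zero, of 2] by simp
  moreover have "\<bar>(data \<omega> (Suc (fst a), i))\<^sup>2 - 1\<bar> \<le> 2 * ?r\<^sup>2"
    if "(data \<omega> (Suc (fst a), i))\<^sup>2 \<le> ?r\<^sup>2"
    using that r2 zero_le_power2[of "data \<omega> (Suc (fst a), i)"] by linarith
  ultimately show ?thesis using r2
    by (cases "fst a = snd a") (auto simp: centred_product_def power2_eq_square[of ?r])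
qed

lemma centred_product_sq:
  assumes "i \<ge> 1"
  shows "integrable M (\<lambda>\<omega>. (centred_product i (data \<omega>) a)\<^sup>2)"
    "expectation (\<lambda>\<omega>. (centred_product i (data \<omega>) a)\<^sup>2) \<le> \<kappa> + 1"
  using expectation_sq_minus_one(3,4)[of "Suc (fst a)" i] assms
    expectation_product_sq[of "Suc (fst a)" i "Suc (snd a)" i]
  unfolding centred_product_def data_apply by (cases "fst a = snd a"; simp)+

lemma weighted_product_integrable:
  assumes i: "i \<ge> 1" and b: "local_on array_index b1" "\<And>d. \<bar>b1 d\<bar> \<le> C" 
  shows "integrable M (\<lambda>\<omega>. b1 (data \<omega>) * centred_product i (data \<omega>) a * centred_product i (data \<omega>) a')"
proof (rule integrable_envelope_bound[of "{(Suc (fst a), i), (Suc (snd a), i), (Suc (fst a'), i), (Suc (snd a'), i)}"])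
  let ?F = "{(Suc (fst a), i), (Suc (snd a), i), (Suc (fst a'), i), (Suc (snd a'), i)}"
  show "?F \<subseteq> array_index" using i by auto
  show "(\<lambda>\<omega>. b1 (data \<omega>) * centred_product i (data \<omega>) a * centred_product i (data \<omega>) a') \<in> borel_measurable M"
    using i b by (intro local_measurable[of array_index] local_intros local_on_centred_product) auto
  fix \<omega>
  have "0 \<le> C" using b(2)[of "data \<omega>"] by linarith
  have "\<bar>b1 (data \<omega>) * centred_product i (data \<omega>) a * centred_product i (data \<omega>) a'\<bar>
    \<le> C * (2 * (envelope ?F \<omega>)\<^sup>2) * (2 * (envelope ?F \<omega>)\<^sup>2)"
    unfolding abs_mult using \<open>0 \<le> C\<close> by (intro mult_mono b centred_product_bound) auto
  also have "\<dots> = 4 * C * envelope ?F \<omega> ^ 4" by (simp add: sq_sq[symmetric] power2_eq_square)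
  finally show "\<bar>b1 (data \<omega>) * centred_product i (data \<omega>) a * centred_product i (data \<omega>) a'\<bar> \<le> 4 * C * envelope ?F \<omega> ^ 4" .
qed auto

lemma other_columns_subset: "other_columns i \<subseteq> array_index" "(Suc k, i) \<notin> other_columns i"
  by (auto simp: other_columns_def)

text \<open>The entry with index \<open>k\<close> occurs exactly once in the product.\<close>
lemma off_diagonal_product_orthogonal:
  assumes i: "i \<ge> 1" and b: "local_on (other_columns i) b" "\<And>d. \<bar>b d\<bar> \<le> C"
    and kl: "k \<noteq> l" "k \<noteq> fst a'" "k \<noteq> snd a'"
  shows "expectation (\<lambda>\<omega>. b (data \<omega>) * (data \<omega> (Suc k, i) * data \<omega> (Suc l, i)) * centred_product i (data \<omega>) a') = 0"
proof -
  let ?g = "\<lambda>d. b d * d (Suc l, i) * centred_product i d a'"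
  let ?B = "array_index - {(Suc k, i)}"
  have loc: "local_on ?B ?g" using kl i
    by (intro local_intros local_on_centred_product local_on_mono[OF b(1)])
      (use other_columns_subset in auto)
  have "integrable M (\<lambda>\<omega>. ?g (data \<omega>))"
  proof (rule integrable_envelope_bound[of "{(Suc l, i), (Suc (fst a'), i), (Suc (snd a'), i)}"])
    let ?F = "{(Suc l, i), (Suc (fst a'), i), (Suc (snd a'), i)}"
    show "?F \<subseteq> array_index" using i by auto
    show "(\<lambda>\<omega>. ?g (data \<omega>)) \<in> borel_measurable M" by (rule local_measurable[OF loc]) auto
    fix \<omega>
    let ?r = "envelope ?F \<omega>"
    have r1: "1 \<le> ?r" using envelope_bounds(1)[of ?F \<omega>] by simp
    have "0 \<le> C" using b(2)[of "data \<omega>"] by linarith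
    have "\<bar>?g (data \<omega>)\<bar> \<le> C * ?r * (2 * ?r\<^sup>2)"
      unfolding abs_mult using \<open>0 \<le> C\<close> r1
      by (intro mult_mono b centred_product_bound envelope_bounds(2)) auto
    also have "\<dots> = 2 * C * ?r ^ 3" by (simp add: power2_eq_square power3_eq_cube)
    also have "\<dots> \<le> 2 * C * ?r ^ 4" using \<open>0 \<le> C\<close> r1 by (intro mult_left_mono power_increasing) auto
    finally show "\<bar>?g (data \<omega>)\<bar> \<le> 2 * C * ?r ^ 4" .
  qed auto
  from centred_factor_vanishes[of "Suc k" i "\<lambda>t. t" ?g, OF _ _ loc this] i
  show ?thesis by (simp add: data_apply mult_ac)
qed

text \<open>Two different unordered pairs of indices: either an off-diagonal pair contains an index that is missing from the
  other pair, so that one entry occurs only once, or both pairs are diagonal and \<open>x\<^sub>k\<^sup>2 - 1\<close> is a centred factor.\<close>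
lemma centred_products_orthogonal:
  assumes i: "i \<ge> 1" and b: "local_on (other_columns i) b" "\<And>d. \<bar>b d\<bar> \<le> C"
    and a: "fst a \<le> snd a" "fst a' \<le> snd a'" "a \<noteq> a'"
  shows "expectation (\<lambda>\<omega>. b (data \<omega>) * centred_product i (data \<omega>) a * centred_product i (data \<omega>) a') = 0"
proof -
  obtain k l k' l' where [simp]: "a = (k, l)" "a' = (k', l')" by (cases a, cases a')
  consider (off) "k < l" "k \<noteq> k'" "k \<noteq> l'" | (off') "k < l" "l \<noteq> k'" "l \<noteq> l'"
    | (off2) "k' < l'" "k' \<noteq> k" "k' \<noteq> l" | (off2') "k' < l'" "l' \<noteq> k" "l' \<noteq> l" | (diag) "k = l" "k' = l'" "k \<noteq> k'"
    using a by fastforce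
  then show ?thesis
  proof cases
    case off
    then show ?thesis using off_diagonal_product_orthogonal[OF i b, of k l a'] by (simp add: centred_product_def)
  next
    case off'
    then show ?thesis using off_diagonal_product_orthogonal[OF i b, of l k a']
      by (simp add: centred_product_def mult_ac)
  next
    case off2
    then show ?thesis using off_diagonal_product_orthogonal[OF i b, of k' l' a]
      by (simp add: centred_product_def mult_ac)
  next
    case off2'
    then show ?thesis using off_diagonal_product_orthogonal[OF i b, of l' k' a]
      by (simp add: centred_product_def mult_ac)
  next
    case diag
    let ?g = "\<lambda>d. b d * ((d (Suc k', i))\<^sup>2 - 1)"
    have loc: "local_on (array_index - {(Suc k, i)}) ?g" using diag i
      by (intro local_intros local_on_mono[OF b(1)]) (use other_columns_subset in auto)
    have "integrable M (\<lambda>\<omega>. b (data \<omega>) * (data \<omega> (Suc k', i))\<^sup>2 - b (data \<omega>))"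
    proof (intro Bochner_Integration.integrable_diff)
      have bm: "(\<lambda>\<omega>. b (data \<omega>)) \<in> borel_measurable M"
        by (rule local_measurable[OF b(1) other_columns_subset(1)])
      show "integrable M (\<lambda>\<omega>. b (data \<omega>))" using b(2) bm by (intro integrable_const_bound[of _ C]) auto
      show "integrable M (\<lambda>\<omega>. b (data \<omega>) * (data \<omega> (Suc k', i))\<^sup>2)"
      proof (rule Bochner_Integration.integrable_bound)
        show "integrable M (\<lambda>\<omega>. C * (X (Suc k') i \<omega>)\<^sup>2)" using integrable_entry(1)[of "Suc k'" i] i by simp
        show "(\<lambda>\<omega>. b (data \<omega>) * (data \<omega> (Suc k', i))\<^sup>2) \<in> borel_measurable M"
          unfolding data_apply using bm X_measurable[of "Suc k'" i] i by auto
        show "AE \<omega> in M. norm (b (data \<omega>) * (data \<omega> (Suc k', i))\<^sup>2) \<le> norm (C * (X (Suc k') i \<omega>)\<^sup>2)"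
        proof (intro AE_I2)
          fix \<omega>
          have "\<bar>b (data \<omega>)\<bar> \<le> \<bar>C\<bar>" using b(2)[of "data \<omega>"] by linarith
          then show "norm (b (data \<omega>) * (data \<omega> (Suc k', i))\<^sup>2) \<le> norm (C * (X (Suc k') i \<omega>)\<^sup>2)"
            unfolding real_norm_def abs_mult data_apply by (intro mult_right_mono) auto
        qed
      qed
    qed
    then have "integrable M (\<lambda>\<omega>. ?g (data \<omega>))" by (simp add: right_diff_distrib)
    from centred_factor_vanishes[of "Suc k" i "\<lambda>t. t\<^sup>2 - 1" ?g, OF _ _ loc this] i
    show ?thesis using diag by (simp add: data_apply centred_product_def mult_ac)
  qed
qed

end

section \<open>Second moments of quadratic forms and distances\<close>

lemma symmetric_double_sum:
  fixes g :: "nat \<Rightarrow> nat \<Rightarrow> real"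
  assumes "\<And>k l. k < p \<Longrightarrow> l < p \<Longrightarrow> g k l = g l k"
  shows "(\<Sum>k<p. \<Sum>l<p. g k l) = (\<Sum>l<p. \<Sum>k\<le>l. (if k = l then 1 else 2) * g k l)"
  using assms
proof (induction p)
  case (Suc p)
  have "(\<Sum>k<Suc p. \<Sum>l<Suc p. g k l) = (\<Sum>k<p. \<Sum>l<p. g k l) + ((\<Sum>k<p. g k p) + (\<Sum>l<p. g p l) + g p p)"
    by (simp add: sum.distrib)
  also have "(\<Sum>k<p. \<Sum>l<p. g k l) = (\<Sum>l<p. \<Sum>k\<le>l. (if k = l then 1 else 2) * g k l)"
    using Suc by simp
  also have "(\<Sum>l<p. g p l) = (\<Sum>k<p. g k p)" using Suc.prems by (intro sum.cong) auto
  also have "(\<Sum>k<p. g k p) + (\<Sum>k<p. g k p) + g p p = (\<Sum>k\<le>p. (if k = p then 1 else 2) * g k p)"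
    unfolding lessThan_Suc_atMost[symmetric] by (simp add: sum_distrib_left[symmetric])
  finally show ?case by simp
qed simp

context iid_array
begin

text \<open>The centred quadratic form of column \<open>i\<close> in a symmetric matrix that depends on the other columns only. Over
  unordered pairs of indices its terms are orthogonal, so its second moment is the sum of theirs, which is
  bounded by a multiple of the squared Frobenius norm of the matrix.\<close>
lemma quadratic_form_second_moment:
  assumes i: "i \<ge> 1"
    and loc: "\<And>k l. k < p \<Longrightarrow> l < p \<Longrightarrow> local_on (other_columns i) (\<beta> k l)"
    and C: "\<And>k l d. k < p \<Longrightarrow> l < p \<Longrightarrow> \<bar>\<beta> k l d\<bar> \<le> C"
    and sym: "\<And>k l d. k < p \<Longrightarrow> l < p \<Longrightarrow> \<beta> k l d = \<beta> l k d"
    and S: "\<And>d. (\<Sum>k<p. \<Sum>l<p. (\<beta> k l d)\<^sup>2) \<le> S"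
  defines "T \<equiv> \<lambda>d. (\<Sum>k<p. \<Sum>l<p. \<beta> k l d * (d (Suc k, i) * d (Suc l, i))) - (\<Sum>k<p. \<beta> k k d)"
  shows "integrable M (\<lambda>\<omega>. (T (data \<omega>))\<^sup>2)" and "expectation (\<lambda>\<omega>. (T (data \<omega>))\<^sup>2) \<le> 4 * (\<kappa> + 1) * S"
proof -
  define A where "A = (SIGMA l:{..<p}. {..l})"
  define w :: "nat \<times> nat \<Rightarrow> real" where "w a = (if snd a = fst a then 1 else 2)" for a
  define W where "W a \<omega> = w a * \<beta> (snd a) (fst a) (data \<omega>) * centred_product i (data \<omega>) (snd a, fst a)" for a \<omega>
  have A: "finite A" "\<And>a. a \<in> A \<Longrightarrow> snd a \<le> fst a \<and> fst a < p \<and> snd a < p" by (auto simp: A_def)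
  have w: "\<bar>w a\<bar> \<le> 2" "(w a)\<^sup>2 \<le> 4" for a by (auto simp: w_def)
  have T: "T (data \<omega>) = (\<Sum>a\<in>A. W a \<omega>)" for \<omega>
  proof -
    let ?g = "\<lambda>k l. \<beta> k l (data \<omega>) * centred_product i (data \<omega>) (k, l)"
    have "T (data \<omega>) = (\<Sum>k<p. (\<Sum>l<p. \<beta> k l (data \<omega>) * (data \<omega> (Suc k, i) * data \<omega> (Suc l, i))) - \<beta> k k (data \<omega>))"
      unfolding T_def by (simp add: sum_subtractf)
    also have "\<dots> = (\<Sum>k<p. \<Sum>l<p. ?g k l)"
    proof (intro sum.cong refl)
      fix k assume "k \<in> {..<p}"
      have "(\<Sum>l<p. ?g k l) = (\<Sum>l<p. \<beta> k l (data \<omega>) * (data \<omega> (Suc k, i) * data \<omega> (Suc l, i)) - (if l = k then \<beta> k k (data \<omega>) else 0))"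
        by (intro sum.cong) (auto simp: centred_product_def power2_eq_square algebra_simps)
      then show "(\<Sum>l<p. \<beta> k l (data \<omega>) * (data \<omega> (Suc k, i) * data \<omega> (Suc l, i))) - \<beta> k k (data \<omega>) = (\<Sum>l<p. ?g k l)"
        using \<open>k \<in> {..<p}\<close> by (simp add: sum_subtractf)
    qed
    also have "\<dots> = (\<Sum>l<p. \<Sum>k\<le>l. (if k = l then 1 else 2) * ?g k l)"
      by (intro symmetric_double_sum) (auto simp: centred_product_def sym)
    also have "\<dots> = (\<Sum>a\<in>A. W a \<omega>)"
      unfolding A_def W_def w_def by (subst sum.Sigma) (auto simp: case_prod_beta mult.assoc)
    finally show ?thesis .
  qed
  have prod: "W a \<omega> * W b \<omega> = (w a * w b * (\<beta> (snd a) (fst a) (data \<omega>) * \<beta> (snd b) (fst b) (data \<omega>)))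
      * centred_product i (data \<omega>) (snd a, fst a) * centred_product i (data \<omega>) (snd b, fst b)" for a b \<omega>
    unfolding W_def by (simp add: mult_ac)
  have locprod: "local_on (other_columns i) (\<lambda>d. w a * w b * (\<beta> (snd a) (fst a) d * \<beta> (snd b) (fst b) d))"
    if "a \<in> A" "b \<in> A" for a b
    using A(2)[OF that(1)] A(2)[OF that(2)] by (intro local_intros loc) auto
  have bndprod: "\<bar>w a * w b * (\<beta> (snd a) (fst a) d * \<beta> (snd b) (fst b) d)\<bar> \<le> 4 * (\<bar>C\<bar> * \<bar>C\<bar>)"
    if "a \<in> A" "b \<in> A" for a b d
  proof -
    have c: "\<bar>\<beta> (snd a) (fst a) d\<bar> \<le> \<bar>C\<bar>" "\<bar>\<beta> (snd b) (fst b) d\<bar> \<le> \<bar>C\<bar>"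
      using C A(2)[OF that(1)] A(2)[OF that(2)] by (meson order_trans abs_ge_self)+
    have "\<bar>w a * w b * (\<beta> (snd a) (fst a) d * \<beta> (snd b) (fst b) d)\<bar> \<le> (2 * 2) * (\<bar>C\<bar> * \<bar>C\<bar>)"
      unfolding abs_mult by (intro mult_mono w c) auto
    then show ?thesis by simp
  qed
  have int: "integrable M (\<lambda>\<omega>. W a \<omega> * W b \<omega>)" if "a \<in> A" "b \<in> A" for a b
    unfolding prod
    using weighted_product_integrable[OF i local_on_mono[OF locprod[OF that] other_columns_subset(1)] bndprod[OF that]] .
  have orth: "expectation (\<lambda>\<omega>. W a \<omega> * W b \<omega>) = 0" if "a \<in> A" "b \<in> A" "a \<noteq> b" for a b
    unfolding prod using A(2)[OF that(1)] A(2)[OF that(2)] that(3)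
    by (intro centred_products_orthogonal[OF i locprod[OF that(1,2)] bndprod[OF that(1,2)]]) (auto simp: prod_eq_iff)
  note sm = second_moment_orthogonal_sum[where W = W, OF A(1) int orth]
  show "integrable M (\<lambda>\<omega>. (T (data \<omega>))\<^sup>2)" unfolding T using sm(1) by simp
  have \<beta>int: "integrable M (\<lambda>\<omega>. (\<beta> k l (data \<omega>))\<^sup>2)" if "k < p" "l < p" for k l
  proof (rule integrable_const_bound)
    show "(\<lambda>\<omega>. (\<beta> k l (data \<omega>))\<^sup>2) \<in> borel_measurable M"
      using local_measurable[OF loc[OF that] other_columns_subset(1)] by simp
    show "AE \<omega> in M. norm ((\<beta> k l (data \<omega>))\<^sup>2) \<le> C\<^sup>2"
      using C[OF that] by (auto intro!: AE_I2 abs_le_square_iff[THEN iffD1] intro: order_trans[OF _ abs_ge_self])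
  qed
  have term_le: "expectation (\<lambda>\<omega>. (W a \<omega>)\<^sup>2) \<le> 4 * (\<kappa> + 1) * expectation (\<lambda>\<omega>. (\<beta> (snd a) (fst a) (data \<omega>))\<^sup>2)"
    if a: "a \<in> A" for a
  proof -
    have kl: "snd a < p" "fst a < p" using A(2)[OF a] by auto
    have vloc: "local_on ({1..} \<times> {i}) (\<lambda>d. (centred_product i d (snd a, fst a))\<^sup>2)"
      by (intro local_intros local_on_centred_product) auto
    have "expectation (\<lambda>\<omega>. (centred_product i (data \<omega>) (snd a, fst a))\<^sup>2 * (\<beta> (snd a) (fst a) (data \<omega>))\<^sup>2)
      = expectation (\<lambda>\<omega>. (centred_product i (data \<omega>) (snd a, fst a))\<^sup>2) * expectation (\<lambda>\<omega>. (\<beta> (snd a) (fst a) (data \<omega>))\<^sup>2)"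
      using i by (intro local_factor(2)[OF vloc local_on_power[OF loc[OF kl]]] centred_product_sq \<beta>int kl)
        (auto simp: other_columns_def)
    also have "\<dots> \<le> (\<kappa> + 1) * expectation (\<lambda>\<omega>. (\<beta> (snd a) (fst a) (data \<omega>))\<^sup>2)"
      by (intro mult_right_mono centred_product_sq i) simp
    finally have le: "expectation (\<lambda>\<omega>. (centred_product i (data \<omega>) (snd a, fst a))\<^sup>2 * (\<beta> (snd a) (fst a) (data \<omega>))\<^sup>2)
      \<le> (\<kappa> + 1) * expectation (\<lambda>\<omega>. (\<beta> (snd a) (fst a) (data \<omega>))\<^sup>2)" .
    have "(W a \<omega>)\<^sup>2 = (w a)\<^sup>2 * ((centred_product i (data \<omega>) (snd a, fst a))\<^sup>2 * (\<beta> (snd a) (fst a) (data \<omega>))\<^sup>2)" for \<omega>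
      by (simp add: W_def power_mult_distrib mult_ac)
    then have "expectation (\<lambda>\<omega>. (W a \<omega>)\<^sup>2) = (w a)\<^sup>2 * expectation (\<lambda>\<omega>. (centred_product i (data \<omega>) (snd a, fst a))\<^sup>2 * (\<beta> (snd a) (fst a) (data \<omega>))\<^sup>2)"
      by simp
    also have "\<dots> \<le> 4 * ((\<kappa> + 1) * expectation (\<lambda>\<omega>. (\<beta> (snd a) (fst a) (data \<omega>))\<^sup>2))"
      using w(2)[of a] le by (intro mult_mono) auto
    finally show ?thesis by (simp only: mult.assoc)
  qed
  have "expectation (\<lambda>\<omega>. (T (data \<omega>))\<^sup>2) = (\<Sum>a\<in>A. expectation (\<lambda>\<omega>. (W a \<omega>)\<^sup>2))"
    unfolding T using sm(2) by simp
  also have "\<dots> \<le> (\<Sum>a\<in>A. 4 * (\<kappa> + 1) * expectation (\<lambda>\<omega>. (\<beta> (snd a) (fst a) (data \<omega>))\<^sup>2))"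
    by (intro sum_mono term_le)
  also have "\<dots> \<le> (\<Sum>a\<in>{..<p} \<times> {..<p}. 4 * (\<kappa> + 1) * expectation (\<lambda>\<omega>. (\<beta> (snd a) (fst a) (data \<omega>))\<^sup>2))"
    using kappa_nonneg by (intro sum_mono2) (auto simp: A_def)
  also have "\<dots> = 4 * (\<kappa> + 1) * (\<Sum>a\<in>{..<p} \<times> {..<p}. expectation (\<lambda>\<omega>. (\<beta> (snd a) (fst a) (data \<omega>))\<^sup>2))"
    by (simp add: sum_distrib_left)
  also have "(\<Sum>a\<in>{..<p} \<times> {..<p}. expectation (\<lambda>\<omega>. (\<beta> (snd a) (fst a) (data \<omega>))\<^sup>2))
      = expectation (\<lambda>\<omega>. \<Sum>a\<in>{..<p} \<times> {..<p}. (\<beta> (snd a) (fst a) (data \<omega>))\<^sup>2)"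
    by (subst Bochner_Integration.integral_sum) (auto intro!: \<beta>int)
  also have "\<dots> \<le> expectation (\<lambda>\<omega>. S)"
  proof (intro integral_mono Bochner_Integration.integrable_sum)
    fix \<omega>
    have "(\<Sum>a\<in>{..<p} \<times> {..<p}. (\<beta> (snd a) (fst a) (data \<omega>))\<^sup>2) = (\<Sum>l<p. \<Sum>k<p. (\<beta> k l (data \<omega>))\<^sup>2)"
      by (simp add: sum.cartesian_product case_prod_beta)
    also have "\<dots> = (\<Sum>k<p. \<Sum>l<p. (\<beta> k l (data \<omega>))\<^sup>2)" by (rule sum.swap)
    finally show "(\<Sum>a\<in>{..<p} \<times> {..<p}. (\<beta> (snd a) (fst a) (data \<omega>))\<^sup>2) \<le> S" using S by simp
  qed (auto intro!: \<beta>int)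
  finally show "expectation (\<lambda>\<omega>. (T (data \<omega>))\<^sup>2) \<le> 4 * (\<kappa> + 1) * S"
    using kappa_nonneg by (simp add: prob_space mult_left_mono)
qed

lemma expectation_distinct_product:
  assumes "k \<ge> 1" "i \<ge> 1" "l \<ge> 1" "j \<ge> 1" "(k, i) \<noteq> (l, j)"
  shows "integrable M (\<lambda>\<omega>. X k i \<omega> * X l j \<omega>)" "expectation (\<lambda>\<omega>. X k i \<omega> * X l j \<omega>) = 0"
proof -
  have "local_on {(k, i)} (\<lambda>d. d (k, i))" "local_on {(l, j)} (\<lambda>d. d (l, j))" by (auto intro!: local_intros)
  from local_factor[OF this] assms integrable_entry(2)[OF assms(1,2)] integrable_entry(2)[OF assms(3,4)] mean[OF assms(1,2)]
  show "integrable M (\<lambda>\<omega>. X k i \<omega> * X l j \<omega>)" "expectation (\<lambda>\<omega>. X k i \<omega> * X l j \<omega>) = 0"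
    unfolding data_apply by auto
qed

text \<open>The centred squared distance is a sum over the coordinates of independent centred terms, so its second
  moment grows only linearly in \<open>p\<close>.\<close>
lemma squared_distance_second_moment:
  fixes p :: nat
  assumes ij: "i \<ge> 1" "j \<ge> 1" "i \<noteq> j"
  defines "Q \<equiv> \<lambda>d. (\<Sum>k<p. (d (Suc k, i) - d (Suc k, j))\<^sup>2) - 2 * real p"
  shows "integrable M (\<lambda>\<omega>. (Q (data \<omega>))\<^sup>2)"
    and "expectation (\<lambda>\<omega>. (Q (data \<omega>))\<^sup>2) \<le> real p * (32 * \<kappa> + 8)"
proof -
  define U where "U k d = (d (Suc k, i) - d (Suc k, j))\<^sup>2 - 2" for k and d :: "nat \<times> nat \<Rightarrow> real"
  have Q: "Q d = (\<Sum>k<p. U k d)" for d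
    unfolding Q_def U_def by (simp add: sum_subtractf)
  have locU: "local_on {(Suc k, i), (Suc k, j)} (U k)" for k
    unfolding U_def[abs_def] by (intro local_intros) auto
  have sub: "{(Suc k, i), (Suc k, j)} \<subseteq> array_index" for k using ij by auto
  have Ueq: "U k (data \<omega>) = (X (Suc k) i \<omega>)\<^sup>2 + (X (Suc k) j \<omega>)\<^sup>2 - 2 * (X (Suc k) i \<omega> * X (Suc k) j \<omega>) - 2" for k \<omega>
    unfolding U_def data_apply by (simp add: power2_diff)
  have iX: "integrable M (\<lambda>\<omega>. (X (Suc k) i \<omega>)\<^sup>2)" "integrable M (\<lambda>\<omega>. (X (Suc k) j \<omega>)\<^sup>2)" for k
    using ij by (auto intro!: integrable_entry(1))
  have pr: "integrable M (\<lambda>\<omega>. X (Suc k) i \<omega> * X (Suc k) j \<omega>)" "expectation (\<lambda>\<omega>. X (Suc k) i \<omega> * X (Suc k) j \<omega>) = 0" for k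
    using ij by (auto intro!: expectation_distinct_product)
  have sc: "expectation (\<lambda>\<omega>. (X (Suc k) i \<omega>)\<^sup>2) = 1" "expectation (\<lambda>\<omega>. (X (Suc k) j \<omega>)\<^sup>2) = 1" for k
    using ij by (auto intro!: second)
  have iU: "integrable M (\<lambda>\<omega>. U k (data \<omega>))" for k unfolding Ueq using iX pr(1) by simp
  have eU: "expectation (\<lambda>\<omega>. U k (data \<omega>)) = 0" for k
    unfolding Ueq using iX pr sc by (simp add: prob_space)
  have four: "(a - b) ^ 4 \<le> 8 * (a ^ 4 + b ^ 4)" for a b :: real
  proof -
    have "(a - b)\<^sup>2 \<le> 2 * (a\<^sup>2 + b\<^sup>2)" using zero_le_power2[of "a + b"] by (simp add: power2_diff power2_sum)
    then have "((a - b)\<^sup>2)\<^sup>2 \<le> (2 * (a\<^sup>2 + b\<^sup>2))\<^sup>2" by (intro power_mono) auto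
    also have "\<dots> \<le> 8 * ((a\<^sup>2)\<^sup>2 + (b\<^sup>2)\<^sup>2)"
      using zero_le_power2[of "a\<^sup>2 - b\<^sup>2"] by (simp add: power2_diff power2_sum power_mult_distrib)
    finally show ?thesis by (simp only: sq_sq)
  qed
  have Usq: "(U k (data \<omega>))\<^sup>2 \<le> 16 * X (Suc k) i \<omega> ^ 4 + 16 * X (Suc k) j \<omega> ^ 4 + 8" for k \<omega>
  proof -
    let ?z = "X (Suc k) i \<omega> - X (Suc k) j \<omega>"
    have sq2: "(t - 2)\<^sup>2 \<le> 2 * t\<^sup>2 + 8" for t :: real
      using zero_le_power2[of "t + 2"] by (simp add: power2_diff power2_sum)
    have comb: "u \<le> 2 * v + 8 \<Longrightarrow> v \<le> 8 * (s + t) \<Longrightarrow> u \<le> 16 * s + 16 * t + 8" for u v s t :: real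
      by argo
    show ?thesis unfolding U_def data_apply
      by (rule comb[OF sq2[of "?z\<^sup>2", unfolded sq_sq] four])
  qed
  have ib: "integrable M (\<lambda>\<omega>. 16 * X (Suc k) i \<omega> ^ 4 + 16 * X (Suc k) j \<omega> ^ 4 + 8)" for k
    using int4[of "Suc k" i] int4[of "Suc k" j] ij by simp
  have iU2: "integrable M (\<lambda>\<omega>. (U k (data \<omega>))\<^sup>2)" for k
  proof (rule Bochner_Integration.integrable_bound[OF ib[of k]])
    show "(\<lambda>\<omega>. (U k (data \<omega>))\<^sup>2) \<in> borel_measurable M"
      using local_measurable[OF locU sub] by simp
    show "AE \<omega> in M. norm ((U k (data \<omega>))\<^sup>2) \<le> norm (16 * X (Suc k) i \<omega> ^ 4 + 16 * X (Suc k) j \<omega> ^ 4 + 8)"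
      unfolding real_norm_def abs_power2 by (intro AE_I2 order_trans[OF Usq abs_ge_self])
  qed
  have E2: "expectation (\<lambda>\<omega>. (U k (data \<omega>))\<^sup>2) \<le> 32 * \<kappa> + 8" for k
  proof -
    have "expectation (\<lambda>\<omega>. (U k (data \<omega>))\<^sup>2) \<le> expectation (\<lambda>\<omega>. 16 * X (Suc k) i \<omega> ^ 4 + 16 * X (Suc k) j \<omega> ^ 4 + 8)"
      by (intro integral_mono iU2 ib Usq)
    also have "\<dots> = 16 * expectation (\<lambda>\<omega>. X (Suc k) i \<omega> ^ 4) + 16 * expectation (\<lambda>\<omega>. X (Suc k) j \<omega> ^ 4) + 8"
      using int4[of "Suc k" i] int4[of "Suc k" j] ij by (simp add: prob_space)
    also have "\<dots> \<le> 32 * \<kappa> + 8" using mom4[of "Suc k" i] mom4[of "Suc k" j] ij by simp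
    finally show ?thesis .
  qed
  have fac: "integrable M (\<lambda>\<omega>. U k (data \<omega>) * U l (data \<omega>))" "expectation (\<lambda>\<omega>. U k (data \<omega>) * U l (data \<omega>)) = 0"
    if "k \<noteq> l" for k l
    using local_factor[OF locU locU _ sub sub iU iU, of k l] that eU by auto
  note sm = second_moment_orthogonal_sum[of "{..<p}" "\<lambda>k \<omega>. U k (data \<omega>)"]
  have int: "integrable M (\<lambda>\<omega>. U k (data \<omega>) * U l (data \<omega>))" for k l
    using fac(1)[of k l] iU2[of k] by (cases "k = l") (auto simp: power2_eq_square)
  show "integrable M (\<lambda>\<omega>. (Q (data \<omega>))\<^sup>2)" unfolding Q by (rule sm(1)) (use int fac in auto)
  have "expectation (\<lambda>\<omega>. (Q (data \<omega>))\<^sup>2) = (\<Sum>k<p. expectation (\<lambda>\<omega>. (U k (data \<omega>))\<^sup>2))"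
    unfolding Q by (rule sm(2)) (use int fac in auto)
  also have "\<dots> \<le> (\<Sum>k<p. 32 * \<kappa> + 8)" by (intro sum_mono E2)
  finally show "expectation (\<lambda>\<omega>. (Q (data \<omega>))\<^sup>2) \<le> real p * (32 * \<kappa> + 8)" by simp
qed

lemma column_sum_second_moment:
  assumes k: "k \<ge> 1"
  shows "integrable M (\<lambda>\<omega>. (\<Sum>i=1..n. X k i \<omega>)\<^sup>2)" "expectation (\<lambda>\<omega>. (\<Sum>i=1..n. X k i \<omega>)\<^sup>2) = real n"
proof -
  have int: "integrable M (\<lambda>\<omega>. X k i \<omega> * X k j \<omega>)" if "i \<in> {1..n}" "j \<in> {1..n}" for i j
    using expectation_distinct_product(1)[of k i k j] integrable_entry(1)[of k i] that k
    by (cases "i = j") (auto simp: power2_eq_square)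
  have orth: "expectation (\<lambda>\<omega>. X k i \<omega> * X k j \<omega>) = 0" if "i \<in> {1..n}" "j \<in> {1..n}" "i \<noteq> j" for i j
    using expectation_distinct_product(2)[of k i k j] that k by auto
  note sm = second_moment_orthogonal_sum[of "{1..n}" "\<lambda>i. X k i"]
  show "integrable M (\<lambda>\<omega>. (\<Sum>i=1..n. X k i \<omega>)\<^sup>2)" by (rule sm(1)) (use int orth in auto)
  have "expectation (\<lambda>\<omega>. (\<Sum>i=1..n. X k i \<omega>)\<^sup>2) = (\<Sum>i=1..n. expectation (\<lambda>\<omega>. (X k i \<omega>)\<^sup>2))"
    by (rule sm(2)) (use int orth in auto)
  also have "\<dots> = (\<Sum>i=1..n. 1)" using k by (intro sum.cong second) auto
  finally show "expectation (\<lambda>\<omega>. (\<Sum>i=1..n. X k i \<omega>)\<^sup>2) = real n" by simp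
qed

end

section \<open>Kendall matrix and sample covariance matrix\<close>

definition pairs :: "nat \<Rightarrow> (nat \<times> nat) set" where
  "pairs n = {(i, j). 1 \<le> i \<and> i < j \<and> j \<le> n}"

definition diffvec :: "nat \<Rightarrow> (nat \<times> nat \<Rightarrow> real) \<Rightarrow> nat \<times> nat \<Rightarrow> real Matrix.vec" where
  "diffvec p d a = colvec p d (fst a) - colvec p d (snd a)"

definition kendall_weight :: "nat \<Rightarrow> nat \<Rightarrow> (nat \<times> nat \<Rightarrow> real) \<Rightarrow> nat \<times> nat \<Rightarrow> real" where
  "kendall_weight p n d a = real p / (real n * (real n - 1)) / (diffvec p d a \<bullet> diffvec p d a)"

definition kendall_mat :: "nat \<Rightarrow> nat \<Rightarrow> (nat \<times> nat \<Rightarrow> real) \<Rightarrow> real mat" where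
  "kendall_mat p n d = (real p / 2) \<cdot>\<^sub>m kendall_tau p n (colvec p d)"

lemma pairs_subset: "pairs n \<subseteq> {1..n} \<times> {1..n}"
  by (auto simp: pairs_def)

lemma finite_pairs [simp]: "finite (pairs n)"
  by (rule finite_subset[OF pairs_subset]) simp

lemma card_pairs_le: "card (pairs n) \<le> n * n"
  using card_mono[OF _ pairs_subset, of n] by simp

lemma diffvec_carrier [simp]: "diffvec p d a \<in> carrier_vec p"
  by (simp add: diffvec_def)

lemma diffvec_index: "k < p \<Longrightarrow> diffvec p d a $ k = d (Suc k, fst a) - d (Suc k, snd a)"
  by (simp add: diffvec_def)

lemma diffvec_norm: "diffvec p d a \<bullet> diffvec p d a = (\<Sum>k<p. (d (Suc k, fst a) - d (Suc k, snd a))\<^sup>2)"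
  by (simp add: scalar_prod_sum[OF diffvec_carrier] diffvec_index power2_eq_square)

lemma sign_outer_index:
  assumes "dim_vec v = p" "a < p" "b < p"
  shows "sign_outer v $$ (a, b) = v $ a * v $ b / (v \<bullet> v)"
proof -
  have "outer_square v $$ (a, b) = v $ a * v $ b"
    using assms unfolding outer_square_def
    by (simp add: scalar_prod_def mat_of_cols_def mat_of_rows_def)
  moreover have "dim_row (outer_square v) = p" "dim_col (outer_square v) = p"
    using assms by (auto simp: outer_square_def)
  ultimately show ?thesis using assms scalar_prod_self_nonneg[of v]
    by (simp add: sign_outer_def eucl_norm_def)
qed

lemma kendall_mat_rank_one_sum:
  "kendall_mat p n d = rank_one_sum p (pairs n) (kendall_weight p n d) (diffvec p d)"
proof (rule eq_matI)
  fix a b assume "a < dim_row (rank_one_sum p (pairs n) (kendall_weight p n d) (diffvec p d))"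
    and "b < dim_col (rank_one_sum p (pairs n) (kendall_weight p n d) (diffvec p d))"
  then have ab: "a < p" "b < p" by (auto simp: rank_one_sum_def)
  have "kendall_mat p n d $$ (a, b) = real p / 2 * (2 / (real n * (real n - 1)) *
      (\<Sum>e\<in>pairs n. sign_outer (diffvec p d e) $$ (a, b)))"
    using ab unfolding kendall_mat_def kendall_tau_def pairs_def diffvec_def by (simp add: case_prod_beta)
  also have "\<dots> = (\<Sum>e\<in>pairs n. kendall_weight p n d e * diffvec p d e $ a * diffvec p d e $ b)"
    using ab by (simp add: sum_distrib_left kendall_weight_def sign_outer_index[OF carrier_vecD[OF diffvec_carrier]] mult_ac)
  finally show "kendall_mat p n d $$ (a, b) =
      rank_one_sum p (pairs n) (kendall_weight p n d) (diffvec p d) $$ (a, b)"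
    using ab by (simp add: rank_one_sum_def)
qed (auto simp: kendall_mat_def kendall_tau_def rank_one_sum_def)

lemma kendall_weight_nonneg: "0 \<le> kendall_weight p n d a"
proof -
  have "0 \<le> real n * (real n - 1)" by (cases n) auto
  then show ?thesis unfolding kendall_weight_def
    by (intro divide_nonneg_nonneg scalar_prod_self_nonneg) auto
qed

text \<open>An inequality and not an equation because a vanishing difference gives a vanishing summand.\<close>
lemma kendall_weight_trace:
  "kendall_weight p n d a * (diffvec p d a \<bullet> diffvec p d a) \<le> real p / (real n * (real n - 1))"
proof -
  have "0 \<le> real n * (real n - 1)" by (cases n) auto
  then show ?thesis by (cases "diffvec p d a \<bullet> diffvec p d a = 0") (auto simp: kendall_weight_def)
qed

lemma kendall_psd: "sym_psd p (kendall_mat p n d)"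
  unfolding kendall_mat_rank_one_sum by (intro rank_one_sum_psd kendall_weight_nonneg diffvec_carrier)

text \<open>Only the pairs that contain \<open>i0\<close> change; there are at most \<open>n - 1\<close> of them, and each contributes trace norm at most
  \<open>p / (n (n - 1))\<close> before and after the change.\<close>
lemma kendall_bounded_difference:
  assumes n: "n \<ge> 2" and x: "0 < x" and i0: "i0 \<in> {1..n}"
    and same: "\<And>k i. i \<noteq> i0 \<Longrightarrow> d' (k, i) = d (k, i)"
  shows "\<bar>mtrace (resolvent x (kendall_mat p n d')) - mtrace (resolvent x (kendall_mat p n d))\<bar>
    \<le> 2 * real p / (real n * x\<^sup>2)"
proof -
  define P0 where "P0 = {a \<in> pairs n. fst a = i0 \<or> snd a = i0}"
  \<comment> \<open>The change is a signed sum: the boolean tells new summands from old ones.\<close>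
  define c where "c t = (if fst t then kendall_weight p n d (snd t) else - kendall_weight p n d' (snd t))" for t :: "bool \<times> nat \<times> nat"
  define z where "z t = (if fst t then diffvec p d (snd t) else diffvec p d' (snd t))" for t :: "bool \<times> nat \<times> nat"
  have fP0: "finite P0" "P0 \<subseteq> pairs n" by (auto simp: P0_def)
  have unch: "diffvec p d' a = diffvec p d a" if "a \<in> pairs n - P0" for a
    using that same[of "fst a"] same[of "snd a"] by (intro eq_vecI) (auto simp: P0_def diffvec_def)
  have "kendall_mat p n d = kendall_mat p n d' + rank_one_sum p (UNIV \<times> P0) c z"
  proof (rule eq_matI)
    fix a b assume "a < dim_row (kendall_mat p n d' + rank_one_sum p (UNIV \<times> P0) c z)"
      and "b < dim_col (kendall_mat p n d' + rank_one_sum p (UNIV \<times> P0) c z)"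
    then have ab: "a < p" "b < p" by (auto simp: rank_one_sum_def)
    let ?f = "\<lambda>d e. kendall_weight p n d e * diffvec p d e $ a * diffvec p d e $ b"
    have split: "kendall_mat p n d $$ (a, b) = (\<Sum>e\<in>P0. ?f d e) + (\<Sum>e\<in>pairs n - P0. ?f d e)" for d
      using ab fP0 sum.subset_diff[OF fP0(2) finite_pairs, of "?f d"]
      by (simp add: kendall_mat_rank_one_sum rank_one_sum_def)
    have rest: "(\<Sum>e\<in>pairs n - P0. ?f d e) = (\<Sum>e\<in>pairs n - P0. ?f d' e)"
      using unch by (intro sum.cong) (auto simp: kendall_weight_def)
    have "rank_one_sum p (UNIV \<times> P0) c z $$ (a, b) = (\<Sum>e\<in>P0. ?f d e) - (\<Sum>e\<in>P0. ?f d' e)"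
    proof -
      have "(\<Sum>t\<in>UNIV \<times> P0. h t) = (\<Sum>e\<in>P0. h (True, e)) + (\<Sum>e\<in>P0. h (False, e))"
        for h :: "bool \<times> nat \<times> nat \<Rightarrow> real"
      proof -
        have "(\<Sum>t\<in>UNIV \<times> P0. h t) = (\<Sum>s\<in>UNIV. \<Sum>e\<in>P0. h (s, e))"
          by (subst sum.cartesian_product) simp
        then show ?thesis by (simp add: UNIV_bool)
      qed
      then show ?thesis using ab by (simp add: rank_one_sum_def c_def z_def sum_negf)
    qed
    then show "kendall_mat p n d $$ (a, b) = (kendall_mat p n d' + rank_one_sum p (UNIV \<times> P0) c z) $$ (a, b)"
      using ab rest split[of d] split[of d'] by (simp add: rank_one_sum_def)
  qed (auto simp: kendall_mat_def kendall_tau_def rank_one_sum_def)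
  from trace_resolvent_perturbation[OF kendall_psd kendall_psd x _ this]
  have le: "\<bar>mtrace (resolvent x (kendall_mat p n d')) - mtrace (resolvent x (kendall_mat p n d))\<bar>
    \<le> (\<Sum>t\<in>UNIV \<times> P0. \<bar>c t\<bar> * (z t \<bullet> z t)) / x\<^sup>2"
    by (simp add: z_def)
  have nn: "0 < real n * (real n - 1)" using n by simp
  have "(\<Sum>t\<in>UNIV \<times> P0. \<bar>c t\<bar> * (z t \<bullet> z t)) \<le> (\<Sum>t\<in>(UNIV :: bool set) \<times> P0. real p / (real n * (real n - 1)))"
    using kendall_weight_trace[of p n] kendall_weight_nonneg[of p n]
    by (intro sum_mono) (auto simp: c_def z_def)
  also have "\<dots> = 2 * real (card P0) * (real p / (real n * (real n - 1)))"
    by (simp add: card_cartesian_product)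
  also have "\<dots> \<le> 2 * (real n - 1) * (real p / (real n * (real n - 1)))"
  proof -
    have "inj_on (\<lambda>a. if fst a = i0 then snd a else fst a) P0"
      by (auto simp: inj_on_def P0_def pairs_def split: if_splits)
    then have "card P0 \<le> card ({1..n} - {i0})"
      by (rule card_inj_on_le) (auto simp: P0_def pairs_def)
    also have "\<dots> = n - 1" using i0 by simp
    finally have "real (card P0) \<le> real n - 1" using n by linarith
    then show ?thesis using nn by (intro mult_right_mono mult_left_mono divide_nonneg_nonneg) auto
  qed
  also have "\<dots> = 2 * real p / real n" using n by (simp add: field_simps)
  finally have "(\<Sum>t\<in>UNIV \<times> P0. \<bar>c t\<bar> * (z t \<bullet> z t)) / x\<^sup>2 \<le> 2 * real p / real n / x\<^sup>2"
    by (intro divide_right_mono) auto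
  with le show ?thesis by simp
qed

lemma pairs_Suc: "pairs (Suc n) = pairs n \<union> (\<lambda>i. (i, Suc n)) ` {1..n}"
  by (auto simp: pairs_def)

text \<open>Lagrange's identity, which relates the sum over pairs to the sample covariance matrix.\<close>
lemma lagrange_pairs:
  fixes u v :: "nat \<Rightarrow> real"
  shows "real n * (\<Sum>i=1..n. u i * v i) = (\<Sum>a\<in>pairs n. (u (fst a) - u (snd a)) * (v (fst a) - v (snd a)))
    + (\<Sum>i=1..n. u i) * (\<Sum>i=1..n. v i)"
proof (induction n)
  case 0
  have "pairs 0 = {}" by (auto simp: pairs_def)
  then show ?case by simp
next
  case (Suc n)
  have "(\<Sum>a\<in>pairs (Suc n). (u (fst a) - u (snd a)) * (v (fst a) - v (snd a)))
    = (\<Sum>a\<in>pairs n. (u (fst a) - u (snd a)) * (v (fst a) - v (snd a)))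
      + (\<Sum>i=1..n. (u i - u (Suc n)) * (v i - v (Suc n)))"
  proof -
    have disj: "pairs n \<inter> (\<lambda>i. (i, Suc n)) ` {1..n} = {}" by (auto simp: pairs_def)
    show ?thesis unfolding pairs_Suc
      by (subst sum.union_disjoint[OF finite_pairs _ disj]) (auto simp: sum.reindex inj_on_def o_def)
  qed
  also have "(\<Sum>i=1..n. (u i - u (Suc n)) * (v i - v (Suc n))) = (\<Sum>i=1..n. u i * v i)
      - u (Suc n) * (\<Sum>i=1..n. v i) - (\<Sum>i=1..n. u i) * v (Suc n) + real n * (u (Suc n) * v (Suc n))"
    by (simp add: algebra_simps sum.distrib sum_subtractf sum_distrib_left sum_distrib_right)
  finally show ?case using Suc by (simp add: algebra_simps)
qed

definition colsum :: "nat \<Rightarrow> nat \<Rightarrow> (nat \<times> nat \<Rightarrow> real) \<Rightarrow> real Matrix.vec" where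
  "colsum p n d = Matrix.vec p (\<lambda>k. \<Sum>i=1..n. d (Suc k, i))"

lemma colsum_carrier [simp]: "colsum p n d \<in> carrier_vec p" by (simp add: colsum_def)

lemma colsum_norm: "colsum p n d \<bullet> colsum p n d = (\<Sum>k<p. (\<Sum>i=1..n. d (Suc k, i))\<^sup>2)"
  unfolding scalar_prod_sum[OF colsum_carrier] by (intro sum.cong) (auto simp: colsum_def power2_eq_square)

text \<open>By Lagrange's identity, half the sample covariance matrix is the sum over pairs of
  \<open>(X\<^sub>i - X\<^sub>j) (X\<^sub>i - X\<^sub>j)\<^sup>T / (2 n\<^sup>2)\<close> plus a matrix of rank one coming from the sample mean. So the difference to
  the Kendall matrix is that rank-one matrix plus a combination of the same summands, with coefficients that are
  small when \<open>\<parallel>X\<^sub>i - X\<^sub>j\<parallel>\<^sup>2\<close> is close to \<open>2 p\<close>.\<close>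
lemma kendall_cov_comparison:
  assumes n: "n \<ge> 2" and x: "0 < x"
  shows "\<bar>mtrace (resolvent x (kendall_mat p n d)) - mtrace (resolvent x (half_cov p n {1..n} d))\<bar>
    \<le> ((\<Sum>a\<in>pairs n. real p / ((real n)\<^sup>2 * (real n - 1)) + \<bar>diffvec p d a \<bullet> diffvec p d a - 2 * real p\<bar> / (2 * (real n)\<^sup>2))
        + colsum p n d \<bullet> colsum p n d / (2 * (real n)\<^sup>2)) / x\<^sup>2"
proof -
  let ?N = "(real n)\<^sup>2"
  \<comment> \<open>The pair \<open>(0, 0)\<close>, which is not in \<open>pairs n\<close>, indexes the term of the sample mean.\<close>
  define c where "c a = (if a = (0, 0) then 1 / (2 * ?N) else 1 / (2 * ?N) - kendall_weight p n d a)" for a :: "nat \<times> nat"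
  define z where "z a = (if a = (0, 0) then colsum p n d else diffvec p d a)" for a :: "nat \<times> nat"
  have n0: "0 < real n" "0 < ?N" "0 < real n - 1" using n by auto
  have notin: "(0, 0) \<notin> pairs n" by (simp add: pairs_def)
  have eqcz: "c a = 1 / (2 * ?N) - kendall_weight p n d a" "z a = diffvec p d a" if "a \<in> pairs n" for a
    using that notin by (auto simp: c_def z_def)
  have "half_cov p n {1..n} d = kendall_mat p n d + rank_one_sum p (insert (0, 0) (pairs n)) c z"
  proof (rule eq_matI)
    fix a b assume "a < dim_row (kendall_mat p n d + rank_one_sum p (insert (0, 0) (pairs n)) c z)"
      and "b < dim_col (kendall_mat p n d + rank_one_sum p (insert (0, 0) (pairs n)) c z)"
    then have ab: "a < p" "b < p" by (auto simp: rank_one_sum_def)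
    let ?u = "\<lambda>i. d (Suc a, i)" and ?v = "\<lambda>i. d (Suc b, i)"
    let ?P = "\<Sum>e\<in>pairs n. (?u (fst e) - ?u (snd e)) * (?v (fst e) - ?v (snd e))"
    let ?Y = "(\<Sum>i=1..n. ?u i) * (\<Sum>i=1..n. ?v i)"
    have K: "kendall_mat p n d $$ (a, b) = (\<Sum>e\<in>pairs n. kendall_weight p n d e * diffvec p d e $ a * diffvec p d e $ b)"
      using ab by (simp add: kendall_mat_rank_one_sum rank_one_sum_def)
    have "rank_one_sum p (insert (0, 0) (pairs n)) c z $$ (a, b)
      = ?Y / (2 * ?N) + (\<Sum>e\<in>pairs n. (1 / (2 * ?N) - kendall_weight p n d e) * diffvec p d e $ a * diffvec p d e $ b)"
    proof -
      have "(\<Sum>e\<in>pairs n. c e * z e $ a * z e $ b)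
        = (\<Sum>e\<in>pairs n. (1 / (2 * ?N) - kendall_weight p n d e) * diffvec p d e $ a * diffvec p d e $ b)"
        using eqcz by (intro sum.cong) auto
      moreover have "c (0, 0) * z (0, 0) $ a * z (0, 0) $ b = ?Y / (2 * ?N)"
        using ab by (simp add: c_def z_def colsum_def)
      ultimately show ?thesis using ab notin by (simp add: rank_one_sum_def)
    qed
    also have "(\<Sum>e\<in>pairs n. (1 / (2 * ?N) - kendall_weight p n d e) * diffvec p d e $ a * diffvec p d e $ b)
      = ?P / (2 * ?N) - kendall_mat p n d $$ (a, b)"
    proof -
      have "(1 / (2 * ?N) - kendall_weight p n d e) * diffvec p d e $ a * diffvec p d e $ b
        = (?u (fst e) - ?u (snd e)) * (?v (fst e) - ?v (snd e)) / (2 * ?N)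
          - kendall_weight p n d e * diffvec p d e $ a * diffvec p d e $ b" for e
        unfolding diffvec_index[OF ab(1)] diffvec_index[OF ab(2)]
        by (simp only: left_diff_distrib times_divide_eq_left mult_1_left mult.assoc)
      then show ?thesis unfolding K by (simp only: sum_subtractf sum_divide_distrib)
    qed
    finally have R: "kendall_mat p n d $$ (a, b) + rank_one_sum p (insert (0, 0) (pairs n)) c z $$ (a, b) = (?P + ?Y) / (2 * ?N)"
      by (simp add: add_divide_distrib)
    have "half_cov p n {1..n} d $$ (a, b) = (\<Sum>i=1..n. ?u i * ?v i) / (2 * real n)"
      using ab by (simp add: half_cov_def rank_one_sum_def sum_divide_distrib)
    also have "\<dots> = (real n * (\<Sum>i=1..n. ?u i * ?v i)) / (2 * ?N)"
      using n0 by (simp add: power2_eq_square)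
    also have "\<dots> = (?P + ?Y) / (2 * ?N)" by (simp only: lagrange_pairs)
    finally show "half_cov p n {1..n} d $$ (a, b) = (kendall_mat p n d + rank_one_sum p (insert (0, 0) (pairs n)) c z) $$ (a, b)"
      using R ab by (simp add: rank_one_sum_def)
  qed (auto simp: half_cov_def rank_one_sum_def)
  from trace_resolvent_perturbation[OF kendall_psd half_cov_psd x _ this]
  have le: "\<bar>mtrace (resolvent x (kendall_mat p n d)) - mtrace (resolvent x (half_cov p n {1..n} d))\<bar>
    \<le> (\<Sum>a\<in>insert (0, 0) (pairs n). \<bar>c a\<bar> * (z a \<bullet> z a)) / x\<^sup>2" by (simp add: z_def)
  have term_le: "\<bar>c a\<bar> * (z a \<bullet> z a) \<le> real p / (?N * (real n - 1)) + \<bar>diffvec p d a \<bullet> diffvec p d a - 2 * real p\<bar> / (2 * ?N)"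
    if a: "a \<in> pairs n" for a
  proof (cases "diffvec p d a \<bullet> diffvec p d a = 0")
    case True
    then show ?thesis using eqcz[OF a] n0 by simp
  next
    case False
    let ?q = "diffvec p d a \<bullet> diffvec p d a"
    have q: "0 \<le> ?q" by (rule scalar_prod_self_nonneg)
    have "\<bar>c a\<bar> * (z a \<bullet> z a) = \<bar>c a * ?q\<bar>" using eqcz(2)[OF a] q by (simp add: abs_mult)
    also have "c a * ?q = ?q / (2 * ?N) - real p / (real n * (real n - 1))"
      unfolding eqcz(1)[OF a] kendall_weight_def using False by (simp add: left_diff_distrib)
    also have "\<dots> = (?q - 2 * real p) / (2 * ?N) - real p / (?N * (real n - 1))"
      using n0 by (simp add: field_simps power2_eq_square)
    also have "\<bar>\<dots>\<bar> \<le> \<bar>(?q - 2 * real p) / (2 * ?N)\<bar> + \<bar>real p / (?N * (real n - 1))\<bar>"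
      by (rule abs_triangle_ineq4)
    also have "\<dots> = real p / (?N * (real n - 1)) + \<bar>?q - 2 * real p\<bar> / (2 * ?N)"
      using n0 by (simp add: abs_divide abs_mult)
    finally show ?thesis .
  qed
  have "(\<Sum>a\<in>insert (0, 0) (pairs n). \<bar>c a\<bar> * (z a \<bullet> z a)) = colsum p n d \<bullet> colsum p n d / (2 * ?N) + (\<Sum>a\<in>pairs n. \<bar>c a\<bar> * (z a \<bullet> z a))"
    using notin by (simp add: c_def[of "(0, 0)"] z_def[of "(0, 0)"])
  also have "\<dots> \<le> colsum p n d \<bullet> colsum p n d / (2 * ?N) + (\<Sum>a\<in>pairs n. real p / (?N * (real n - 1)) + \<bar>diffvec p d a \<bullet> diffvec p d a - 2 * real p\<bar> / (2 * ?N))"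
    by (intro add_left_mono sum_mono term_le)
  finally show ?thesis using x by (intro order_trans[OF le] divide_right_mono) auto
qed

definition mp_quadratic :: "real \<Rightarrow> real \<Rightarrow> real \<Rightarrow> real" where
  "mp_quadratic x c m = x * c * m\<^sup>2 + (2 * x + 1 - c) * m - 2"

text \<open>The fluctuation \<open>x\<^sub>i \<bullet> (R x\<^sub>i) - tr R\<close>, where \<open>R\<close> is the resolvent after removal of column \<open>i\<close>.\<close>
definition quad_fluctuation :: "nat \<Rightarrow> nat \<Rightarrow> real \<Rightarrow> nat \<Rightarrow> (nat \<times> nat \<Rightarrow> real) \<Rightarrow> real" where
  "quad_fluctuation p n x i d = (let R = resolvent x (half_cov p n ({1..n} - {i}) d) in
     (\<Sum>k<p. \<Sum>l<p. R $$ (k, l) * (d (Suc k, i) * d (Suc l, i))) - (\<Sum>k<p. R $$ (k, k)))"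

text \<open>The leave-one-out argument. By the rank-one update, the trace identity reads
  \<open>p - x p m = \<Sum>\<^sub>i q\<^sub>i / (1 + q\<^sub>i)\<close> with \<open>q\<^sub>i\<close> the quadratic form of column \<open>i\<close> in the resolvent without it. If every
  \<open>q\<^sub>i\<close> were equal to \<open>\<tau> = tr R / (2 n) = c m / 2\<close>, this would be the equation for \<open>m\<close>. The map
  \<open>q \<mapsto> q / (1 + q)\<close> does not increase distances on the half line, so the error is at most the sum of the distances \<open>\<bar>q\<^sub>i - \<tau>\<bar>\<close>,
  which come from the fluctuation and from the removal of one column.\<close>
lemma cov_self_consistent:
  fixes d :: "nat \<times> nat \<Rightarrow> real" and n p :: nat
  assumes n: "n \<ge> 1" and p: "p > 0" and x: "0 < x"
  defines "m \<equiv> mtrace (resolvent x (half_cov p n {1..n} d)) / real p" and "c \<equiv> real p / real n"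
  shows "\<bar>mp_quadratic x c m\<bar> \<le> 2 / real p * (1 + c / (2 * x)) *
    (\<Sum>i=1..n. \<bar>quad_fluctuation p n x i d\<bar> / (2 * real n) + (colvec p d i \<bullet> colvec p d i) / (4 * (real n)\<^sup>2 * x\<^sup>2))"
proof -
  let ?S = "half_cov p n {1..n} d" and ?k = "1 / (2 * real n)"
  let ?A = "\<lambda>i. half_cov p n ({1..n} - {i}) d"
  note psd = half_cov_psd
  define q where "q i = ?k * (colvec p d i \<bullet> (resolvent x (?A i) *\<^sub>v colvec p d i))" for i
  define \<tau> where "\<tau> = mtrace (resolvent x ?S) / (2 * real n)"
  have n0: "0 < real n" and p0: "0 < real p" using n p by auto
  have split: "?S = ?A i + rank_one_sum p {i} (\<lambda>_. ?k) (\<lambda>_. colvec p d i)" if "i \<in> {1..n}" for i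
  proof -
    have rm: "(\<Sum>j\<in>{1..n}. g j) = g i + (\<Sum>j\<in>{1..n} - {i}. g j)" for g :: "nat \<Rightarrow> real"
      using that by (intro sum.remove) auto
    show ?thesis unfolding half_cov_def rank_one_sum_def
      by (intro eq_matI) (auto simp: rm[unfolded One_nat_def])
  qed
  have q0: "0 \<le> q i" for i unfolding q_def
    using resolvent_norm(1)[OF psd x colvec_carrier] by (intro mult_nonneg_nonneg) auto
  have \<tau>0: "0 \<le> \<tau>" unfolding \<tau>_def using mtrace_resolvent_bounds(1)[OF psd x] by simp
  have \<tau>c: "\<tau> \<le> c / (2 * x)" 
  proof -
    have "\<tau> \<le> (real p / x) / (2 * real n)"
      unfolding \<tau>_def using mtrace_resolvent_bounds(2)[OF psd x] n0 by (intro divide_right_mono) auto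
    then show ?thesis by (simp add: c_def mult_ac)
  qed
  have \<tau>m: "\<tau> = c * m / 2" using p0 by (simp add: \<tau>_def m_def c_def)
  have "x * mtrace (resolvent x ?S) + (\<Sum>i\<in>{1..n}. ?k * (colvec p d i \<bullet> (resolvent x ?S *\<^sub>v colvec p d i))) = real p"
    by (intro resolvent_trace_identity x psd) (auto simp: half_cov_def)
  moreover have "?k * (colvec p d i \<bullet> (resolvent x ?S *\<^sub>v colvec p d i)) = q i / (1 + q i)" if "i \<in> {1..n}" for i
    unfolding q_def by (rule resolvent_rank_one_update[OF psd psd x colvec_carrier split[OF that]]) simp
  ultimately have tr: "x * (real p * m) + (\<Sum>i\<in>{1..n}. q i / (1 + q i)) = real p" using p0 by (simp add: m_def)
  have lip: "\<bar>s / (1 + s) - t / (1 + t)\<bar> \<le> \<bar>s - t\<bar>" if "0 \<le> s" "0 \<le> t" for s t :: real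
  proof -
    have "s / (1 + s) - t / (1 + t) = (s - t) / ((1 + s) * (1 + t))" using that by (simp add: field_simps)
    moreover have "1 \<le> (1 + s) * (1 + t)" using that by (simp add: algebra_simps)
    ultimately show ?thesis using that by (simp add: abs_mult divide_le_eq mult_le_cancel_left1 abs_ge_zero)
  qed
  define \<Delta> where "\<Delta> = (\<Sum>i=1..n. \<bar>q i - \<tau>\<bar>)"
  have "\<bar>real p - x * (real p * m) - real n * (\<tau> / (1 + \<tau>))\<bar> = \<bar>\<Sum>i=1..n. q i / (1 + q i) - \<tau> / (1 + \<tau>)\<bar>"
    using tr by (simp add: sum_subtractf)
  also have "\<dots> \<le> \<Delta>" unfolding \<Delta>_def
    by (intro order_trans[OF sum_abs] sum_mono lip q0 \<tau>0)
  finally have D: "\<bar>real p - x * (real p * m) - real n * (\<tau> / (1 + \<tau>))\<bar> \<le> \<Delta>" .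
  have "- mp_quadratic x c m = 2 / real p * ((real p - x * (real p * m)) * (1 + \<tau>) - real n * \<tau>)"
    using p0 n0 unfolding \<tau>m mp_quadratic_def c_def by (simp add: field_simps power2_eq_square)
  also have "(real p - x * (real p * m)) * (1 + \<tau>) - real n * \<tau> = (1 + \<tau>) * (real p - x * (real p * m) - real n * (\<tau> / (1 + \<tau>)))"
    using \<tau>0 by (simp add: field_simps)
  finally have "\<bar>- mp_quadratic x c m\<bar> = \<bar>2 / real p * ((1 + \<tau>) * (real p - x * (real p * m) - real n * (\<tau> / (1 + \<tau>))))\<bar>"
    by (simp only:)
  then have "\<bar>mp_quadratic x c m\<bar> = 2 / real p * ((1 + \<tau>) * \<bar>real p - x * (real p * m) - real n * (\<tau> / (1 + \<tau>))\<bar>)"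
    using p0 \<tau>0 unfolding abs_mult abs_minus_cancel by simp
  also have "\<dots> \<le> 2 / real p * ((1 + c / (2 * x)) * \<Delta>)"
    using p0 \<tau>0 \<tau>c D by (intro mult_left_mono mult_mono) auto
  also have "\<dots> \<le> 2 / real p * ((1 + c / (2 * x)) *
    (\<Sum>i=1..n. \<bar>quad_fluctuation p n x i d\<bar> / (2 * real n) + (colvec p d i \<bullet> colvec p d i) / (4 * (real n)\<^sup>2 * x\<^sup>2)))"
  proof (intro mult_left_mono)
    show "\<Delta> \<le> (\<Sum>i=1..n. \<bar>quad_fluctuation p n x i d\<bar> / (2 * real n) + (colvec p d i \<bullet> colvec p d i) / (4 * (real n)\<^sup>2 * x\<^sup>2))"
      unfolding \<Delta>_def
    proof (intro sum_mono)
      fix i assume i: "i \<in> {1..n}"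
      let ?R = "resolvent x (?A i)" and ?v = "colvec p d i"
      have R: "?R \<in> carrier_mat p p" by (rule resolvent_carrier[OF psd x])
      have Rv: "?R *\<^sub>v ?v \<in> carrier_vec p" using R by (rule mult_mat_vec_carrier) simp
      have "?v \<bullet> (?R *\<^sub>v ?v) = (\<Sum>k<p. \<Sum>l<p. ?R $$ (k, l) * (d (Suc k, i) * d (Suc l, i)))"
        unfolding scalar_prod_sum[OF Rv]
      proof (intro sum.cong refl)
        fix k assume "k \<in> {..<p}"
        then have k: "k < p" by simp
        show "?v $ k * (?R *\<^sub>v ?v) $ k = (\<Sum>l<p. ?R $$ (k, l) * (d (Suc k, i) * d (Suc l, i)))"
          unfolding mult_mat_vec_sum[OF R colvec_carrier k] sum_distrib_left
          using k by (intro sum.cong) (auto simp: mult_ac)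
      qed
      then have qf: "quad_fluctuation p n x i d = ?v \<bullet> (?R *\<^sub>v ?v) - mtrace ?R"
        using R by (simp add: quad_fluctuation_def mtrace_def Let_def)
      have pert: "\<bar>mtrace ?R - mtrace (resolvent x ?S)\<bar> \<le> (\<Sum>j\<in>{i}. \<bar>?k\<bar> * (?v \<bullet> ?v)) / x\<^sup>2"
        by (rule trace_resolvent_perturbation[OF psd psd x _ split[OF i]]) simp
      have "q i - \<tau> = ?k * (quad_fluctuation p n x i d + (mtrace ?R - mtrace (resolvent x ?S)))"
        unfolding qf q_def \<tau>_def by (simp add: algebra_simps diff_divide_distrib)
      then have "\<bar>q i - \<tau>\<bar> = ?k * \<bar>quad_fluctuation p n x i d + (mtrace ?R - mtrace (resolvent x ?S))\<bar>"
        using n0 by (simp add: abs_mult)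
      also have "\<dots> \<le> ?k * (\<bar>quad_fluctuation p n x i d\<bar> + (\<bar>?k\<bar> * (?v \<bullet> ?v)) / x\<^sup>2)"
        using n0 pert by (intro mult_left_mono order_trans[OF abs_triangle_ineq] add_left_mono) auto
      also have "\<dots> = \<bar>quad_fluctuation p n x i d\<bar> / (2 * real n) + (?v \<bullet> ?v) / (4 * (real n)\<^sup>2 * x\<^sup>2)"
        using n0 by (simp add: field_simps power2_eq_square)
      finally show "\<bar>q i - \<tau>\<bar> \<le> \<bar>quad_fluctuation p n x i d\<bar> / (2 * real n) + (?v \<bullet> ?v) / (4 * (real n)\<^sup>2 * x\<^sup>2)" .
    qed
  qed (use p0 x n0 in \<open>auto simp: c_def\<close>)
  finally show ?thesis by (simp only: mult.assoc)
qed

section \<open>The Marchenko-Pastur equation\<close>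

definition stieltjes :: "nat \<Rightarrow> real \<Rightarrow> real mat \<Rightarrow> real" where
  "stieltjes p x A = mtrace (resolvent x A) / real p"

lemma stieltjes_bounds:
  assumes "sym_psd p A" "0 < x" "0 < p"
  shows "0 \<le> stieltjes p x A" "stieltjes p x A \<le> 1 / x"
  using mtrace_resolvent_bounds[OF assms(1,2)] assms(2,3)
  by (auto simp: stieltjes_def field_simps)

lemma mp_quadratic_lipschitz:
  assumes "0 < x" "0 \<le> c" "c \<le> 1" "0 \<le> m" "m \<le> 1 / x" "0 \<le> m'" "m' \<le> 1 / x"
  shows "\<bar>mp_quadratic x c m - mp_quadratic x c m'\<bar> \<le> (2 * x + 4) * \<bar>m - m'\<bar>"
proof -
  have "mp_quadratic x c m - mp_quadratic x c m' = (c * (x * (m + m')) + (2 * x + 1 - c)) * (m - m')"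
    by (simp add: mp_quadratic_def algebra_simps power2_eq_square)
  moreover have "\<bar>c * (x * (m + m')) + (2 * x + 1 - c)\<bar> \<le> 2 * x + 4"
  proof -
    have "x * m \<le> 1" "x * m' \<le> 1" using assms by (auto simp: field_simps)
    then have "x * (m + m') \<le> 2" by (simp add: distrib_left)
    moreover have xm: "0 \<le> x * (m + m')" using assms by (intro mult_nonneg_nonneg) auto
    ultimately have "c * (x * (m + m')) \<le> 1 * 2" using assms by (intro mult_mono) auto
    moreover have "0 \<le> c * (x * (m + m'))" using assms xm by (intro mult_nonneg_nonneg) auto
    ultimately show ?thesis using assms by (simp add: abs_le_iff)
  qed
  ultimately show ?thesis by (simp add: abs_mult mult_right_mono)
qed

lemma mp_quadratic_bound:
  assumes "0 < x" "0 \<le> c" "c \<le> 1" "0 \<le> m" "m \<le> 1 / x"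
  shows "\<bar>mp_quadratic x c m\<bar> \<le> (2 * x + 4) / x + 2"
proof -
  have "\<bar>mp_quadratic x c m - mp_quadratic x c 0\<bar> \<le> (2 * x + 4) * \<bar>m - 0\<bar>"
    using assms by (intro mp_quadratic_lipschitz) auto
  also have "\<dots> \<le> (2 * x + 4) * (1 / x)" using assms by (intro mult_left_mono) auto
  finally show ?thesis by (simp add: mp_quadratic_def abs_le_iff)
qed

text \<open>For \<open>y < 1\<close> the quadratic has slope at least \<open>2 x\<close> on the half line, so there is exactly one nonnegative root, and
  approximate roots are close to it.\<close>
lemma mp_quadratic_root_stable:
  assumes x: "0 < x" and y: "0 < y" "y < 1"
    and m: "\<And>n. n \<ge> n0 \<Longrightarrow> 0 \<le> m n \<and> m n \<le> 1 / x"
    and c: "c \<longlonglongrightarrow> y" and conv: "(\<lambda>n. mp_quadratic x (c n) (m n)) \<longlonglongrightarrow> 0"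
    and root: "mp_quadratic x y \<mu> = 0" "0 \<le> \<mu>"
  shows "m \<longlonglongrightarrow> \<mu>"
proof -
  have "(\<lambda>n. (\<bar>mp_quadratic x (c n) (m n)\<bar> + \<bar>y - c n\<bar> * (2 / x)) / (2 * x)) \<longlonglongrightarrow> (\<bar>0\<bar> + \<bar>y - y\<bar> * (2 / x)) / (2 * x)"
    using x by (intro tendsto_intros conv c) auto
  then have lim: "(\<lambda>n. (\<bar>mp_quadratic x (c n) (m n)\<bar> + \<bar>y - c n\<bar> * (2 / x)) / (2 * x)) \<longlonglongrightarrow> 0" by simp
  have "eventually (\<lambda>n. norm (m n - \<mu>) \<le> (\<bar>mp_quadratic x (c n) (m n)\<bar> + \<bar>y - c n\<bar> * (2 / x)) / (2 * x)) sequentially"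
    using eventually_ge_at_top[of n0]
  proof eventually_elim
    case (elim n)
    let ?m = "m n"
    have m0: "0 \<le> ?m" and mx: "x * ?m \<le> 1" "?m \<le> 1 / x" using m[OF elim] x by (auto simp: field_simps)
    have "mp_quadratic x y ?m - mp_quadratic x y \<mu> = (?m - \<mu>) * (x * y * (?m + \<mu>) + (2 * x + 1 - y))"
      by (simp add: mp_quadratic_def algebra_simps power2_eq_square)
    then have "\<bar>mp_quadratic x y ?m\<bar> = \<bar>?m - \<mu>\<bar> * \<bar>x * y * (?m + \<mu>) + (2 * x + 1 - y)\<bar>"
      using root(1) by (simp add: abs_mult)
    moreover have "2 * x \<le> \<bar>x * y * (?m + \<mu>) + (2 * x + 1 - y)\<bar>"
    proof -
      have "0 \<le> x * y * (?m + \<mu>)" using x y m0 root(2) by (intro mult_nonneg_nonneg) auto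
      then show ?thesis using y by linarith
    qed
    ultimately have "\<bar>?m - \<mu>\<bar> * (2 * x) \<le> \<bar>mp_quadratic x y ?m\<bar>" by (simp add: mult_left_mono)
    also have "mp_quadratic x y ?m = mp_quadratic x (c n) ?m + (y - c n) * (x * ?m * ?m - ?m)"
      by (simp add: mp_quadratic_def algebra_simps power2_eq_square)
    also have "\<bar>\<dots>\<bar> \<le> \<bar>mp_quadratic x (c n) ?m\<bar> + \<bar>y - c n\<bar> * \<bar>x * ?m * ?m - ?m\<bar>"
      unfolding abs_mult[symmetric] by (rule abs_triangle_ineq)
    also have "\<dots> \<le> \<bar>mp_quadratic x (c n) ?m\<bar> + \<bar>y - c n\<bar> * (2 / x)"
    proof (intro add_left_mono mult_left_mono)
      have "\<bar>x * ?m * ?m - ?m\<bar> \<le> \<bar>x * ?m\<bar> * \<bar>?m\<bar> + \<bar>?m\<bar>"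
        unfolding abs_mult[symmetric] by (rule abs_triangle_ineq4)
      also have "\<dots> \<le> 1 * (1 / x) + 1 / x" using x m0 mx by (intro add_mono mult_mono) auto
      finally show "\<bar>x * ?m * ?m - ?m\<bar> \<le> 2 / x" by simp
    qed auto
    finally show ?case using x by (simp add: pos_le_divide_eq)
  qed
  then have "(\<lambda>n. m n - \<mu>) \<longlonglongrightarrow> 0" by (rule Lim_null_comparison[OF _ lim])
  then show ?thesis by (simp add: LIM_zero_iff)
qed

lemma local_on_kendall_mat:
  assumes "\<And>k i. k < p \<Longrightarrow> i \<in> {1..n} \<Longrightarrow> (Suc k, i) \<in> B" and ab: "a < p" "b < p"
  shows "local_on B (\<lambda>d. kendall_mat p n d $$ (a, b))"
proof -
  have mem: "(Suc k, fst e) \<in> B" "(Suc k, snd e) \<in> B" if "k < p" "e \<in> pairs n" for k e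
    using assms(1)[OF that(1), of "fst e"] assms(1)[OF that(1), of "snd e"] that(2) by (auto simp: pairs_def)
  have "(\<lambda>d. kendall_mat p n d $$ (a, b)) = (\<lambda>d. \<Sum>e\<in>pairs n.
      real p / (real n * (real n - 1)) / (\<Sum>k<p. (d (Suc k, fst e) - d (Suc k, snd e))\<^sup>2)
      * (d (Suc a, fst e) - d (Suc a, snd e)) * (d (Suc b, fst e) - d (Suc b, snd e)))"
    using ab by (simp add: kendall_mat_rank_one_sum rank_one_sum_def kendall_weight_def diffvec_norm diffvec_index)
  then show ?thesis using mem ab
    by (simp only:) (intro local_intros, auto)
qed

lemma local_on_kendall_stieltjes:
  assumes "\<And>k i. k < p \<Longrightarrow> i \<in> {1..n} \<Longrightarrow> (Suc k, i) \<in> B" and "0 < x"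
  shows "local_on B (\<lambda>d. stieltjes p x (kendall_mat p n d))"
  unfolding stieltjes_def
  by (intro local_intros local_on_mtrace_resolvent local_on_kendall_mat)
    (use assms kendall_psd in auto)

lemma local_on_mp_quadratic: "local_on B f \<Longrightarrow> local_on B (\<lambda>d. mp_quadratic x c (f d))"
  unfolding mp_quadratic_def by (intro local_intros)

section \<open>Expected errors\<close>

context iid_array
begin

lemma expected_kendall_cov_comparison:
  assumes n: "n \<ge> 2" and p: "p > 0" and x: "0 < x"
  shows "expectation (\<lambda>\<omega>. \<bar>stieltjes p x (kendall_mat p n (data \<omega>)) - stieltjes p x (half_cov p n {1..n} (data \<omega>))\<bar>)
    \<le> (1 / (real n - 1) + sqrt ((32 * \<kappa> + 8) / real p) / 2 + 1 / (2 * real n)) / x\<^sup>2"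
proof -
  let ?N = "(real n)\<^sup>2" and ?C = "32 * \<kappa> + 8"
  let ?Q = "\<lambda>a d. diffvec p d a \<bullet> diffvec p d a - 2 * real p"
  let ?diff = "\<lambda>d. stieltjes p x (kendall_mat p n d) - stieltjes p x (half_cov p n {1..n} d)"
  let ?rhs = "\<lambda>d. ((\<Sum>a\<in>pairs n. real p / (?N * (real n - 1)) + \<bar>?Q a d\<bar> / (2 * ?N))
        + colsum p n d \<bullet> colsum p n d / (2 * ?N)) / (x\<^sup>2 * real p)"
  have n0: "0 < real n" "0 < ?N" "0 < real n - 1" and p0: "0 < real p" using n p by auto
  have C0: "0 \<le> ?C" using kappa_nonneg by simp
  have pa: "fst a \<ge> 1 \<and> snd a \<ge> 1 \<and> fst a \<noteq> snd a" if "a \<in> pairs n" for a using that by (auto simp: pairs_def)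
  have Qint: "integrable M (\<lambda>\<omega>. ?Q a (data \<omega>))" and QE: "expectation (\<lambda>\<omega>. \<bar>?Q a (data \<omega>)\<bar>) \<le> sqrt (real p * ?C)"
    if a: "a \<in> pairs n" for a
  proof -
    have loc: "local_on array_index (?Q a)" unfolding diffvec_norm
      using pa[OF a] by (intro local_intros) auto
    note m = local_measurable[OF loc order_refl]
    note sq = squared_distance_second_moment[of "fst a" "snd a" p, folded diffvec_norm]
    show "integrable M (\<lambda>\<omega>. ?Q a (data \<omega>))" "expectation (\<lambda>\<omega>. \<bar>?Q a (data \<omega>)\<bar>) \<le> sqrt (real p * ?C)"
      using expectation_abs_le_sqrt[OF m sq(1) sq(2)] pa[OF a] by auto
  qed
  have cs: "integrable M (\<lambda>\<omega>. (\<Sum>i=1..n. X (Suc k) i \<omega>)\<^sup>2)"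
    "expectation (\<lambda>\<omega>. (\<Sum>i=1..n. X (Suc k) i \<omega>)\<^sup>2) = real n" for k
    by (rule column_sum_second_moment, simp)+
  have Yint: "integrable M (\<lambda>\<omega>. colsum p n (data \<omega>) \<bullet> colsum p n (data \<omega>))"
    unfolding colsum_norm data_apply by (intro Bochner_Integration.integrable_sum cs)
  have YE: "expectation (\<lambda>\<omega>. colsum p n (data \<omega>) \<bullet> colsum p n (data \<omega>)) = real p * real n"
    unfolding colsum_norm data_apply
    by (subst Bochner_Integration.integral_sum[OF cs(1)]) (simp only: cs(2) sum_constant card_lessThan)
  have rint: "integrable M (\<lambda>\<omega>. ?rhs (data \<omega>))"
    using Qint Yint by (intro integrable_divide_zero Bochner_Integration.integrable_add Bochner_Integration.integrable_sum integrable_abs integrable_divide) auto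
  have ptw: "\<bar>?diff d\<bar> \<le> ?rhs d" for d
  proof -
    have "\<bar>?diff d\<bar> = \<bar>mtrace (resolvent x (kendall_mat p n d)) - mtrace (resolvent x (half_cov p n {1..n} d))\<bar> / real p"
      using p0 by (simp add: stieltjes_def diff_divide_distrib[symmetric] abs_divide)
    also have "\<dots> \<le> (((\<Sum>a\<in>pairs n. real p / (?N * (real n - 1)) + \<bar>?Q a d\<bar> / (2 * ?N))
        + colsum p n d \<bullet> colsum p n d / (2 * ?N)) / x\<^sup>2) / real p"
      by (intro divide_right_mono kendall_cov_comparison n x) auto
    finally show ?thesis by simp
  qed
  have "expectation (\<lambda>\<omega>. \<bar>?diff (data \<omega>)\<bar>) \<le> expectation (\<lambda>\<omega>. ?rhs (data \<omega>))"
    by (rule integral_mono_AE'[OF rint]) (intro AE_I2 ptw order_trans[OF abs_ge_zero ptw])+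
  also have "\<dots> = ((\<Sum>a\<in>pairs n. real p / (?N * (real n - 1)) + expectation (\<lambda>\<omega>. \<bar>?Q a (data \<omega>)\<bar>) / (2 * ?N))
        + real p * real n / (2 * ?N)) / (x\<^sup>2 * real p)"
    using Qint Yint YE by (simp add: Bochner_Integration.integral_sum Bochner_Integration.integral_add prob_space)
  also have "\<dots> \<le> ((\<Sum>a\<in>pairs n. real p / (?N * (real n - 1)) + sqrt (real p * ?C) / (2 * ?N))
        + real p * real n / (2 * ?N)) / (x\<^sup>2 * real p)"
    using QE p0 by (intro divide_right_mono add_right_mono sum_mono add_left_mono) auto
  also have "\<dots> \<le> (?N * (real p / (?N * (real n - 1)) + sqrt (real p * ?C) / (2 * ?N))
        + real p * real n / (2 * ?N)) / (x\<^sup>2 * real p)"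
  proof (intro divide_right_mono add_right_mono)
    have "real (card (pairs n)) \<le> ?N" using card_pairs_le[of n] by (simp add: power2_eq_square flip: of_nat_mult)
    then show "(\<Sum>a\<in>pairs n. real p / (?N * (real n - 1)) + sqrt (real p * ?C) / (2 * ?N))
      \<le> ?N * (real p / (?N * (real n - 1)) + sqrt (real p * ?C) / (2 * ?N))"
      using n0 p0 C0 by (simp add: mult_right_mono)
  qed (use p0 in auto)
  also have "\<dots> = (1 / (real n - 1) + (sqrt (real p * ?C) / real p) / 2 + 1 / (2 * real n)) / x\<^sup>2"
    using n0 p0 x by (simp add: field_simps power2_eq_square)
  also have "sqrt (real p * ?C) / real p = sqrt (?C / real p)"
  proof -
    have "sqrt (real p * ?C) / sqrt ((real p)\<^sup>2) = sqrt (real p * ?C / (real p)\<^sup>2)"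
      by (rule real_sqrt_divide[symmetric])
    also have "real p * ?C / (real p)\<^sup>2 = ?C / real p" using p0 by (simp add: power2_eq_square)
    finally show ?thesis using p0 by simp
  qed
  finally show ?thesis .
qed

lemma quad_fluctuation_bound:
  assumes i: "i \<in> {1..n}" and x: "0 < x"
  shows "integrable M (\<lambda>\<omega>. quad_fluctuation p n x i (data \<omega>))"
    and "expectation (\<lambda>\<omega>. \<bar>quad_fluctuation p n x i (data \<omega>)\<bar>) \<le> sqrt (4 * (\<kappa> + 1) * (real p / x\<^sup>2))"
proof -
  let ?A = "half_cov p n ({1..n} - {i})"
  let ?R = "\<lambda>d. resolvent x (?A d)"
  have loc: "local_on (other_columns i) (\<lambda>d. ?R d $$ (k, l))" if "k < p" "l < p" for k l
    using that i by (intro local_on_resolvent_entry[of p] local_on_half_cov sym_psd_carrier[OF half_cov_psd x])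
      (auto simp: other_columns_def)
  have bnd: "\<bar>?R d $$ (k, l)\<bar> \<le> 1 / x" if "k < p" "l < p" for k l d
    by (rule resolvent_entry_bound[OF half_cov_psd x that])
  have sym: "?R d $$ (k, l) = ?R d $$ (l, k)" if "k < p" "l < p" for k l d
    using arg_cong[OF resolvent_sym[OF half_cov_psd x], of "\<lambda>A. A $$ (k, l)" p n "{1..n} - {i}" d] that
      resolvent_carrier[OF half_cov_psd x, of p n "{1..n} - {i}" d] by auto
  have S: "(\<Sum>k<p. \<Sum>l<p. (?R d $$ (k, l))\<^sup>2) \<le> real p / x\<^sup>2" for d
  proof -
    have "(\<Sum>k<p. \<Sum>l<p. (?R d $$ (k, l))\<^sup>2) \<le> (\<Sum>k<p. 1 / x\<^sup>2)"
      by (intro sum_mono resolvent_entries(1)[OF half_cov_psd x]) auto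
    then show ?thesis by simp
  qed
  have i1: "i \<ge> 1" using i by simp
  note Q = quadratic_form_second_moment[of i p "\<lambda>k l d. ?R d $$ (k, l)", OF i1 loc bnd sym S]
  have eq: "quad_fluctuation p n x i d = (\<Sum>k<p. \<Sum>l<p. ?R d $$ (k, l) * (d (Suc k, i) * d (Suc l, i))) - (\<Sum>k<p. ?R d $$ (k, k))" for d
    by (simp add: quad_fluctuation_def Let_def)
  have "local_on array_index (quad_fluctuation p n x i)"
    unfolding eq[abs_def] using i1
    by (intro local_intros local_on_mono[OF loc other_columns_subset(1)]) auto
  note m = local_measurable[OF this order_refl]
  show "integrable M (\<lambda>\<omega>. quad_fluctuation p n x i (data \<omega>))"
    "expectation (\<lambda>\<omega>. \<bar>quad_fluctuation p n x i (data \<omega>)\<bar>) \<le> sqrt (4 * (\<kappa> + 1) * (real p / x\<^sup>2))"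
    using expectation_abs_le_sqrt[OF m Q[folded eq]] by auto
qed

lemma expected_cov_quadratic:
  assumes n: "n \<ge> 1" and p: "p > 0" and x: "0 < x"
  shows "expectation (\<lambda>\<omega>. \<bar>mp_quadratic x (real p / real n) (stieltjes p x (half_cov p n {1..n} (data \<omega>)))\<bar>)
    \<le> 2 * (1 + real p / real n / (2 * x)) * (sqrt (4 * (\<kappa> + 1) / (x\<^sup>2 * real p)) / 2 + 1 / (4 * real n * x\<^sup>2))"
proof -
  let ?c = "real p / real n"
  let ?K = "2 / real p * (1 + ?c / (2 * x))"
  let ?t = "\<lambda>i d. \<bar>quad_fluctuation p n x i d\<bar> / (2 * real n) + (colvec p d i \<bullet> colvec p d i) / (4 * (real n)\<^sup>2 * x\<^sup>2)"
  let ?q = "\<lambda>d. mp_quadratic x ?c (stieltjes p x (half_cov p n {1..n} d))"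
  have n0: "0 < real n" and p0: "0 < real p" using n p by auto
  have K0: "0 \<le> ?K" using p0 n0 x by auto
  have cn: "colvec p d i \<bullet> colvec p d i = (\<Sum>k<p. (d (Suc k, i))\<^sup>2)" for d i
    by (simp add: scalar_prod_sum[OF colvec_carrier] power2_eq_square)
  have cint: "integrable M (\<lambda>\<omega>. colvec p (data \<omega>) i \<bullet> colvec p (data \<omega>) i)"
    and cE: "expectation (\<lambda>\<omega>. colvec p (data \<omega>) i \<bullet> colvec p (data \<omega>) i) = real p" if "i \<in> {1..n}" for i
    unfolding cn data_apply using that
    by (auto simp: Bochner_Integration.integral_sum integrable_entry second)
  have tint: "integrable M (\<lambda>\<omega>. ?t i (data \<omega>))" if "i \<in> {1..n}" for i
    using quad_fluctuation_bound(1)[OF that x] cint[OF that] by simp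
  have tE: "expectation (\<lambda>\<omega>. ?t i (data \<omega>)) \<le> sqrt (4 * (\<kappa> + 1) * (real p / x\<^sup>2)) / (2 * real n) + real p / (4 * (real n)\<^sup>2 * x\<^sup>2)"
    if i: "i \<in> {1..n}" for i
  proof -
    have "expectation (\<lambda>\<omega>. ?t i (data \<omega>)) = expectation (\<lambda>\<omega>. \<bar>quad_fluctuation p n x i (data \<omega>)\<bar>) / (2 * real n) + real p / (4 * (real n)\<^sup>2 * x\<^sup>2)"
      using quad_fluctuation_bound(1)[OF i x] cint[OF i] cE[OF i] by simp
    also have "\<dots> \<le> sqrt (4 * (\<kappa> + 1) * (real p / x\<^sup>2)) / (2 * real n) + real p / (4 * (real n)\<^sup>2 * x\<^sup>2)"
      using n0 by (intro add_right_mono divide_right_mono quad_fluctuation_bound(2)[OF i x]) auto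
    finally show ?thesis .
  qed
  have Kint: "integrable M (\<lambda>\<omega>. ?K * (\<Sum>i=1..n. ?t i (data \<omega>)))"
    by (intro integrable_mult_right Bochner_Integration.integrable_sum tint)
  have ptw: "\<bar>?q d\<bar> \<le> ?K * (\<Sum>i=1..n. ?t i d)" for d
    unfolding stieltjes_def by (rule cov_self_consistent[OF n p x])
  have "expectation (\<lambda>\<omega>. \<bar>?q (data \<omega>)\<bar>) \<le> expectation (\<lambda>\<omega>. ?K * (\<Sum>i=1..n. ?t i (data \<omega>)))"
    by (rule integral_mono_AE'[OF Kint]) (intro AE_I2 ptw order_trans[OF abs_ge_zero ptw])+
  also have "\<dots> = ?K * (\<Sum>i=1..n. expectation (\<lambda>\<omega>. ?t i (data \<omega>)))"
    by (subst integral_mult_right_zero, subst Bochner_Integration.integral_sum) (auto intro!: tint)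
  also have "\<dots> \<le> ?K * (\<Sum>i=1..n. sqrt (4 * (\<kappa> + 1) * (real p / x\<^sup>2)) / (2 * real n) + real p / (4 * (real n)\<^sup>2 * x\<^sup>2))"
    by (intro mult_left_mono sum_mono tE K0)
  also have "\<dots> = 2 * (1 + ?c / (2 * x)) * ((sqrt (4 * (\<kappa> + 1) * (real p / x\<^sup>2)) / real p) / 2 + 1 / (4 * real n * x\<^sup>2))"
  proof -
    have sum_eq: "(\<Sum>i=1..n. s / (2 * real n) + real p / (4 * (real n)\<^sup>2 * x\<^sup>2))
      = s / 2 + real p * (1 / (4 * real n * x\<^sup>2))" for s
      using n0 by (simp add: distrib_left power2_eq_square)
    have "2 / real p * A * (s / 2 + real p * w) = 2 * A * ((s / real p) / 2 + w)" for A s w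
      using p0 by (simp add: field_simps)
    then show ?thesis unfolding sum_eq by blast
  qed
  also have "sqrt (4 * (\<kappa> + 1) * (real p / x\<^sup>2)) / real p = sqrt (4 * (\<kappa> + 1) / (x\<^sup>2 * real p))"
  proof -
    have "sqrt (4 * (\<kappa> + 1) * (real p / x\<^sup>2)) / sqrt ((real p)\<^sup>2) = sqrt (4 * (\<kappa> + 1) * (real p / x\<^sup>2) / (real p)\<^sup>2)"
      by (rule real_sqrt_divide[symmetric])
    also have "4 * (\<kappa> + 1) * (real p / x\<^sup>2) / (real p)\<^sup>2 = 4 * (\<kappa> + 1) / (x\<^sup>2 * real p)"
      using p0 by (simp add: power2_eq_square)
    finally show ?thesis using p0 by simp
  qed
  finally show ?thesis .
qed

end

section \<open>Almost sure convergence\<close>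

text \<open>Assembles a data matrix from its columns. A column keeps the full index pair of its entries, so that it is the
  restriction of the data matrix to one block of indices.\<close>
definition glue :: "(nat \<Rightarrow> nat \<times> nat \<Rightarrow> real) \<Rightarrow> nat \<times> nat \<Rightarrow> real" where
  "glue \<xi> = (\<lambda>(k, i). \<xi> i (k, i))"

context iid_array
begin

text \<open>The columns are independent, so their joint law is a product measure, on which the bounded difference inequality
  applies.\<close>
lemma column_functional_fourth_moment:
  assumes n: "0 < n" and c: "0 \<le> c"
    and loc: "local_on ({1..} \<times> {1..n}) G" and bnd: "\<And>d. \<bar>G d\<bar> \<le> K"
    and diff: "\<And>d d' i. i \<in> {1..n} \<Longrightarrow> (\<And>k j. j \<noteq> i \<Longrightarrow> d' (k, j) = d (k, j)) \<Longrightarrow>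
      \<bar>G d' - G d\<bar> \<le> c / real n"
  shows "(\<integral>\<^sup>+\<omega>. ennreal ((G (data \<omega>) - expectation (\<lambda>\<omega>. G (data \<omega>))) ^ 4) \<partial>M)
    \<le> ennreal (48 * exp (c\<^sup>2 / 2) / (real n)\<^sup>2)"
proof -
  let ?B = "{1::nat..} \<times> {1..n}"
  \<comment> \<open>Truncation at 1 gives the index 0, which lies outside the array, a block as well: a product measure needs a probability space at every index.\<close>
  define col :: "nat \<Rightarrow> (nat \<times> nat) set" where "col j = {1..} \<times> {max 1 j}" for j
  define C where "C j \<omega> = restrict (data \<omega>) (col j)" for j \<omega>
  define N where "N j = distr M (PiM (col j) (\<lambda>_. borel)) (C j)" for j
  let ?P = "PiM {1..n} N"
  have col: "col j \<subseteq> array_index" for j by (auto simp: col_def)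
  have Cm: "C j \<in> measurable M (PiM (col j) (\<lambda>_. borel))" for j
    unfolding C_def by (rule data_measurable[OF col])
  have N: "prob_space (N j)" for j unfolding N_def by (rule prob_space_distr[OF Cm])
  have setsN: "sets (N j) = sets (PiM (col j) (\<lambda>_. borel))" for j by (simp add: N_def)
  have iv: "indep_vars (\<lambda>j. PiM (col j) (\<lambda>_. borel)) C {1..n}"
  proof -
    have eqD: "(\<lambda>i. (case i of (k, i) \<Rightarrow> X k i) \<omega>) = data \<omega>" for \<omega> by (auto simp: data_def)
    have "disjoint_family_on col {1..n}" by (auto simp: disjoint_family_on_def col_def)
    from indep_vars_restrict[OF indep col this]
    show ?thesis unfolding eqD C_def[abs_def] by simp
  qed
  have joint: "distr M (PiM {1..n} (\<lambda>j. PiM (col j) (\<lambda>_. borel))) (\<lambda>\<omega>. \<lambda>j\<in>{1..n}. C j \<omega>) = ?P"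
    unfolding N_def using iv n Cm
    by (subst (asm) indep_vars_iff_distr_eq_PiM) auto
  have Jm: "(\<lambda>\<omega>. \<lambda>j\<in>{1..n}. C j \<omega>) \<in> measurable M (PiM {1..n} (\<lambda>j. PiM (col j) (\<lambda>_. borel)))"
    by (intro measurable_restrict Cm)
  have setsP: "sets ?P = sets (PiM {1..n} (\<lambda>j. PiM (col j) (\<lambda>_. borel)))"
    by (intro sets_PiM_cong refl setsN)
  have glue_m: "(\<lambda>\<xi>. restrict (glue \<xi>) ?B) \<in> measurable ?P (PiM ?B (\<lambda>_. borel))"
  proof (intro measurable_restrict)
    fix a assume "a \<in> ?B"
    then obtain k i where a: "a = (k, i)" "k \<ge> 1" "i \<in> {1..n}" by auto
    have "(\<lambda>\<xi>. \<xi> i) \<in> measurable ?P (PiM (col i) (\<lambda>_. borel))"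
      using measurable_component_singleton[OF a(3), of N] measurable_cong_sets[OF refl setsN] by auto
    moreover have "(\<lambda>f. f (k, i)) \<in> borel_measurable (PiM (col i) (\<lambda>_. borel :: real measure))"
      using a by (intro measurable_component_singleton) (auto simp: col_def)
    ultimately show "(\<lambda>\<xi>. glue \<xi> a) \<in> borel_measurable ?P"
      unfolding a(1) glue_def by (auto intro: measurable_compose)
  qed
  define f where "f \<xi> = G (glue \<xi>)" for \<xi>
  have locr: "G (restrict d ?B) = G d" for d using loc unfolding local_on_def by blast
  have fm: "f \<in> borel_measurable ?P"
  proof -
    have "(\<lambda>\<xi>. G (restrict (glue \<xi>) ?B)) \<in> borel_measurable ?P"
      using loc unfolding local_on_def by (intro measurable_compose[OF glue_m]) blast
    then show ?thesis unfolding f_def[abs_def] locr .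
  qed
  have fJ: "f (\<lambda>j\<in>{1..n}. C j \<omega>) = G (data \<omega>)" for \<omega>
  proof -
    have "restrict (glue (\<lambda>j\<in>{1..n}. C j \<omega>)) ?B = restrict (data \<omega>) ?B"
      by (auto simp: glue_def C_def col_def restrict_def fun_eq_iff max_def)
    then have "G (restrict (glue (\<lambda>j\<in>{1..n}. C j \<omega>)) ?B) = G (restrict (data \<omega>) ?B)" by (rule arg_cong)
    then show ?thesis unfolding f_def locr .
  qed
  have fm': "f \<in> borel_measurable (PiM {1..n} (\<lambda>j. PiM (col j) (\<lambda>_. borel)))"
    using fm measurable_cong_sets[OF setsP refl] by blast
  have mean: "(\<integral>\<xi>. f \<xi> \<partial>?P) = expectation (\<lambda>\<omega>. G (data \<omega>))"
    unfolding joint[symmetric] by (subst integral_distr[OF Jm fm']) (simp only: fJ)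
  have gm: "(\<lambda>\<xi>. ennreal ((f \<xi> - expectation (\<lambda>\<omega>. G (data \<omega>))) ^ 4))
      \<in> borel_measurable (PiM {1..n} (\<lambda>j. PiM (col j) (\<lambda>_. borel)))"
    using fm' by measurable
  have "(\<integral>\<^sup>+\<xi>. ennreal ((f \<xi> - (\<integral>\<xi>. f \<xi> \<partial>?P)) ^ 4) \<partial>?P) \<le> ennreal (48 * exp (c\<^sup>2 / 2) / (real (card {1..n}))\<^sup>2)"
  proof (rule bounded_differences_fourth_moment[OF N _ c _ fm, of K])
    fix \<xi> i z assume i: "i \<in> {1..n}"
    have "\<bar>G (glue (\<xi>(i := z))) - G (glue \<xi>)\<bar> \<le> c / real n"
      by (rule diff[OF i]) (simp add: glue_def)
    then show "\<bar>f (\<xi>(i := z)) - f \<xi>\<bar> \<le> c / real (card {1..n})" by (simp add: f_def)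
  qed (use n bnd in \<open>auto simp: f_def\<close>)
  also have "(\<integral>\<^sup>+\<xi>. ennreal ((f \<xi> - (\<integral>\<xi>. f \<xi> \<partial>?P)) ^ 4) \<partial>?P)
    = (\<integral>\<^sup>+\<omega>. ennreal ((G (data \<omega>) - expectation (\<lambda>\<omega>. G (data \<omega>))) ^ 4) \<partial>M)"
    unfolding mean unfolding joint[symmetric]
    by (subst nn_integral_distr[OF Jm]) (simp_all only: fJ measurable_distr_eq1 gm)
  finally show ?thesis by simp
qed

text \<open>The error in the equation is a function of the columns with differences of order \<open>1/n\<close>, hence almost surely close to its
  mean; the mean tends to \<open>0\<close> by comparison with half the sample covariance matrix.\<close>
lemma kendall_quadratic_tendsto:
  fixes p :: "nat \<Rightarrow> nat"
  assumes p: "\<And>n. n \<ge> 2 \<Longrightarrow> p n > 0" and pn: "(\<lambda>n. real (p n) / real n) \<longlonglongrightarrow> y" and y: "0 < y" "y < 1"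
    and x: "0 < x"
  shows "AE \<omega> in M. (\<lambda>n. mp_quadratic x (real (p n) / real n) (stieltjes (p n) x (kendall_mat (p n) n (data \<omega>)))) \<longlonglongrightarrow> 0"
proof -
  define c where "c n = real (p n) / real n" for n
  define G where "G n d = mp_quadratic x (c n) (stieltjes (p n) x (kendall_mat (p n) n d))" for n d
  define L where "L = 2 * x + 4"
  have L0: "0 \<le> L" using x by (simp add: L_def)
  \<comment> \<open>From some \<open>n0\<close> on, \<open>p n \<le> n\<close>, which makes the Lipschitz constant of the quadratic uniform.\<close>
  obtain n0 where n0: "n0 \<ge> 2" "\<And>n. n \<ge> n0 \<Longrightarrow> c n \<le> 1"
  proof -
    have "eventually (\<lambda>n. c n < 1) sequentially" using order_tendstoD(2)[OF pn y(2)] by (simp add: c_def)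
    then obtain m where "\<And>n. n \<ge> m \<Longrightarrow> c n < 1" by (auto simp: eventually_sequentially)
    then show thesis by (intro that[of "max m 2"]) (auto intro: less_imp_le)
  qed
  have c0: "0 \<le> c n" for n by (simp add: c_def)
  have st: "0 \<le> stieltjes (p n) x A" "stieltjes (p n) x A \<le> 1 / x" if "n \<ge> n0" "sym_psd (p n) A" for n A
    using stieltjes_bounds[OF that(2) x] p[of n] n0(1) that(1) by auto
  have lip: "\<bar>mp_quadratic x (c n) (stieltjes (p n) x A) - mp_quadratic x (c n) (stieltjes (p n) x A')\<bar>
    \<le> L * \<bar>stieltjes (p n) x A - stieltjes (p n) x A'\<bar>" if "n \<ge> n0" "sym_psd (p n) A" "sym_psd (p n) A'" for n A A'
    unfolding L_def using mp_quadratic_lipschitz[OF x c0 n0(2)[OF that(1)]] st[OF that(1,2)] st[OF that(1,3)] by blast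
  have loc: "local_on ({1..} \<times> {1..n}) (G n)" for n
    unfolding G_def[abs_def] using x by (intro local_on_mp_quadratic local_on_kendall_stieltjes) auto
  have GmM: "(\<lambda>\<omega>. G n (data \<omega>)) \<in> borel_measurable M" for n
    by (rule local_measurable[OF loc]) auto
  have Gb: "\<bar>G n d\<bar> \<le> L / x + 2" if "n \<ge> n0" for n d
    unfolding G_def L_def using st[OF that kendall_psd] x c0 n0(2)[OF that]
    by (intro mp_quadratic_bound) auto
  have Gint: "integrable M (\<lambda>\<omega>. G n (data \<omega>))" if "n \<ge> n0" for n
    using Gb[OF that] GmM by (intro integrable_const_bound[of _ "L / x + 2"]) auto
  let ?c = "2 * L / x\<^sup>2"
  have fourth: "(\<integral>\<^sup>+\<omega>. ennreal ((G n (data \<omega>) - expectation (\<lambda>\<omega>. G n (data \<omega>))) ^ 4) \<partial>M)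
    \<le> ennreal (48 * exp (?c\<^sup>2 / 2) / (real n)\<^sup>2)" if n: "n \<ge> n0" for n
  proof (rule column_functional_fourth_moment[OF _ _ loc Gb[OF n]])
    show "0 < n" "0 \<le> ?c" using n n0(1) L0 by auto
    fix d d' :: "nat \<times> nat \<Rightarrow> real" and i assume i: "i \<in> {1..n}" and same: "\<And>k j. j \<noteq> i \<Longrightarrow> d' (k, j) = d (k, j)"
    have p0: "0 < real (p n)" using p[of n] n n0(1) by simp
    have kb: "\<bar>mtrace (resolvent x (kendall_mat (p n) n d')) - mtrace (resolvent x (kendall_mat (p n) n d))\<bar>
        \<le> 2 * real (p n) / (real n * x\<^sup>2)"
      by (rule kendall_bounded_difference[OF _ x i]) (use n n0(1) same in auto)
    have "\<bar>G n d' - G n d\<bar> \<le> L * \<bar>stieltjes (p n) x (kendall_mat (p n) n d') - stieltjes (p n) x (kendall_mat (p n) n d)\<bar>"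
      unfolding G_def by (rule lip[OF n kendall_psd kendall_psd])
    also have "\<bar>stieltjes (p n) x (kendall_mat (p n) n d') - stieltjes (p n) x (kendall_mat (p n) n d)\<bar>
      = \<bar>mtrace (resolvent x (kendall_mat (p n) n d')) - mtrace (resolvent x (kendall_mat (p n) n d))\<bar> / real (p n)"
      using p0 by (simp add: stieltjes_def diff_divide_distrib[symmetric] abs_divide)
    also have "L * \<dots> \<le> L * (2 * real (p n) / (real n * x\<^sup>2) / real (p n))"
      by (intro mult_left_mono divide_right_mono kb L0) simp
    also have "\<dots> = ?c / real n" using p0 by (simp add: mult_ac)
    finally show "\<bar>G n d' - G n d\<bar> \<le> ?c / real n" .
  qed
  have conc: "AE \<omega> in M. (\<lambda>n. G n (data \<omega>) - expectation (\<lambda>\<omega>. G n (data \<omega>))) \<longlonglongrightarrow> 0"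
    by (rule AE_tendsto_zero_fourth_moment[of n0, OF _ fourth]) (use GmM in auto)
  let ?e1 = "\<lambda>n. (1 / (real n - 1) + sqrt ((32 * \<kappa> + 8) / real (p n)) / 2 + 1 / (2 * real n)) / x\<^sup>2"
  let ?e2 = "\<lambda>n. 2 * (1 + c n / (2 * x)) * (sqrt (4 * (\<kappa> + 1) / (x\<^sup>2 * real (p n))) / 2 + 1 / (4 * real n * x\<^sup>2))"
  have EG: "\<bar>expectation (\<lambda>\<omega>. G n (data \<omega>))\<bar> \<le> L * ?e1 n + ?e2 n" if n: "n \<ge> n0" for n
  proof -
    let ?K = "\<lambda>d. stieltjes (p n) x (kendall_mat (p n) n d)" and ?S = "\<lambda>d. stieltjes (p n) x (half_cov (p n) n {1..n} d)"
    have n2: "n \<ge> 2" "n \<ge> 1" "p n > 0" using n n0(1) p[of n] by auto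
    have lK: "local_on array_index ?K" by (rule local_on_kendall_stieltjes) (use x in auto)
    have lS: "local_on array_index ?S"
      unfolding stieltjes_def by (intro local_intros local_on_mtrace_resolvent local_on_half_cov x) (auto intro: half_cov_psd)
    note mK = local_measurable[OF lK order_refl] and mS = local_measurable[OF lS order_refl]
    have iD: "integrable M (\<lambda>\<omega>. ?K (data \<omega>) - ?S (data \<omega>))"
    proof (rule integrable_const_bound[of _ "1 / x + 1 / x"])
      show "AE \<omega> in M. norm (?K (data \<omega>) - ?S (data \<omega>)) \<le> 1 / x + 1 / x"
      proof (intro AE_I2)
        fix \<omega>
        show "norm (?K (data \<omega>) - ?S (data \<omega>)) \<le> 1 / x + 1 / x"
          unfolding real_norm_def using st[OF n kendall_psd, of n "data \<omega>"] st[OF n half_cov_psd, of n "{1..n}" "data \<omega>"]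
          by linarith
      qed
    qed (use mK mS in auto)
    have iQ: "integrable M (\<lambda>\<omega>. mp_quadratic x (c n) (?S (data \<omega>)))"
    proof (rule integrable_const_bound[of _ "L / x + 2"])
      show "AE \<omega> in M. norm (mp_quadratic x (c n) (?S (data \<omega>))) \<le> L / x + 2"
        unfolding real_norm_def L_def
        by (intro AE_I2 mp_quadratic_bound x c0 n0(2)[OF n] st[OF n half_cov_psd])
      show "(\<lambda>\<omega>. mp_quadratic x (c n) (?S (data \<omega>))) \<in> borel_measurable M"
        by (rule local_measurable[OF local_on_mp_quadratic[OF lS] order_refl])
    qed
    have "\<bar>expectation (\<lambda>\<omega>. G n (data \<omega>))\<bar> \<le> expectation (\<lambda>\<omega>. \<bar>G n (data \<omega>)\<bar>)" by (rule integral_abs_bound)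
    also have "\<dots> \<le> expectation (\<lambda>\<omega>. L * \<bar>?K (data \<omega>) - ?S (data \<omega>)\<bar> + \<bar>mp_quadratic x (c n) (?S (data \<omega>))\<bar>)"
    proof (intro integral_mono integrable_abs Gint[OF n] Bochner_Integration.integrable_add integrable_mult_right iD iQ)
      fix \<omega>
      show "\<bar>G n (data \<omega>)\<bar> \<le> L * \<bar>?K (data \<omega>) - ?S (data \<omega>)\<bar> + \<bar>mp_quadratic x (c n) (?S (data \<omega>))\<bar>"
        using lip[OF n kendall_psd half_cov_psd, of n "data \<omega>" n "{1..n}" "data \<omega>"] unfolding G_def by linarith
    qed
    also have "\<dots> = L * expectation (\<lambda>\<omega>. \<bar>?K (data \<omega>) - ?S (data \<omega>)\<bar>) + expectation (\<lambda>\<omega>. \<bar>mp_quadratic x (c n) (?S (data \<omega>))\<bar>)"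
      using iD iQ by simp
    also have "\<dots> \<le> L * ?e1 n + ?e2 n"
      unfolding c_def by (intro add_mono mult_left_mono expected_kendall_cov_comparison expected_cov_quadratic n2 x L0)
    finally show ?thesis .
  qed
  have "filterlim (\<lambda>n. real (p n)) at_top sequentially"
  proof -
    have "filterlim (\<lambda>n. c n * real n) at_top sequentially"
      using filterlim_tendsto_pos_mult_at_top[OF pn y(1) filterlim_real_sequentially] by (simp add: c_def)
    moreover have "eventually (\<lambda>n. c n * real n = real (p n)) sequentially"
      using eventually_gt_at_top[of 0] by eventually_elim (simp add: c_def)
    ultimately show ?thesis by (rule filterlim_cong[OF refl refl, THEN iffD1, rotated])
  qed
  then have ip: "(\<lambda>n. inverse (real (p n))) \<longlonglongrightarrow> 0" by (rule tendsto_inverse_0_at_top)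
  have lim_in: "(\<lambda>n. inverse (real n)) \<longlonglongrightarrow> 0" by (rule LIMSEQ_inverse_real_of_nat[THEN LIMSEQ_imp_Suc])
  have "filterlim (\<lambda>n. real n - 1) at_top sequentially"
    using filterlim_tendsto_add_at_top[OF tendsto_const filterlim_real_sequentially, of "- 1"] by simp
  then have lim_in1: "(\<lambda>n. inverse (real n - 1)) \<longlonglongrightarrow> 0" by (rule tendsto_inverse_0_at_top)
  have null: "(\<lambda>n. 1 / (real n - 1)) \<longlonglongrightarrow> 0" "(\<lambda>n. 1 / (2 * real n)) \<longlonglongrightarrow> 0"
    "(\<lambda>n. 1 / (4 * real n * x\<^sup>2)) \<longlonglongrightarrow> 0" "(\<lambda>n. (32 * \<kappa> + 8) / real (p n)) \<longlonglongrightarrow> 0"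
    "(\<lambda>n. 4 * (\<kappa> + 1) / (x\<^sup>2 * real (p n))) \<longlonglongrightarrow> 0"
    subgoal using lim_in1 by (simp add: divide_inverse)
    subgoal using tendsto_mult_right_zero[OF lim_in, of "1 / 2"] by (simp add: field_simps)
    subgoal using tendsto_mult_right_zero[OF lim_in, of "1 / (4 * x\<^sup>2)"] by (simp add: field_simps)
    subgoal using tendsto_mult_right_zero[OF ip, of "32 * \<kappa> + 8"] by (simp add: divide_inverse)
    subgoal using tendsto_mult_right_zero[OF ip, of "4 * (\<kappa> + 1) / x\<^sup>2"] by (simp add: field_simps)
    done
  have "(\<lambda>n. L * ?e1 n + ?e2 n) \<longlonglongrightarrow> L * ((0 + sqrt 0 / 2 + 0) / x\<^sup>2) + 2 * (1 + y / (2 * x)) * (sqrt 0 / 2 + 0)"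
    using x pn unfolding c_def by (intro tendsto_intros null) auto
  then have lim0: "(\<lambda>n. L * ?e1 n + ?e2 n) \<longlonglongrightarrow> 0" by simp
  have Elim: "(\<lambda>n. expectation (\<lambda>\<omega>. G n (data \<omega>))) \<longlonglongrightarrow> 0"
    by (rule Lim_null_comparison[OF _ lim0])
      (use EG in \<open>auto simp: eventually_sequentially intro!: exI[of _ n0]\<close>)
  show ?thesis using conc
  proof eventually_elim
    case (elim \<omega>)
    from tendsto_add[OF elim Elim] show ?case by (simp add: G_def c_def)
  qed
qed

lemma kendall_esd_weak_conv:
  fixes p :: "nat \<Rightarrow> nat"
  assumes p: "\<And>n. n \<ge> 2 \<Longrightarrow> p n > 0" and pn: "(\<lambda>n. real (p n) / real n) \<longlonglongrightarrow> y" and y: "0 < y" "y < 1"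
  shows "AE \<omega> in M. weak_conv (\<lambda>n. esd (kendall_mat (p n) n (data \<omega>))) (cdf (mp_distr y))"
proof -
  define s where "s j = inverse (real (Suc j))" for j
  have s: "0 < s j" "s \<longlonglongrightarrow> 0" for j using LIMSEQ_inverse_real_of_nat by (auto simp: s_def[abs_def])
  have "AE \<omega> in M. \<forall>j. (\<lambda>n. mp_quadratic (1 + s j) (real (p n) / real n)
      (stieltjes (p n) (1 + s j) (kendall_mat (p n) n (data \<omega>)))) \<longlonglongrightarrow> 0"
    unfolding AE_all_countable
    by (intro allI kendall_quadratic_tendsto[OF p pn y]) (use s(1) in \<open>auto intro: add_pos_pos\<close>)
  then show ?thesis
  proof eventually_elim
    case (elim \<omega>)
    show ?case
    proof (rule esd_weak_conv[where ?n0.0 = 2 and s = s])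
      fix j
      have x: "0 < 1 + s j" using s(1)[of j] by simp
      have "(\<lambda>n. stieltjes (p n) (1 + s j) (kendall_mat (p n) n (data \<omega>))) \<longlonglongrightarrow> mp_resolvent y (1 + s j)"
      proof (rule mp_quadratic_root_stable[OF x y _ pn])
        show "0 \<le> stieltjes (p n) (1 + s j) (kendall_mat (p n) n (data \<omega>)) \<and>
          stieltjes (p n) (1 + s j) (kendall_mat (p n) n (data \<omega>)) \<le> 1 / (1 + s j)" if "2 \<le> n" for n
          using stieltjes_bounds[OF kendall_psd x p[OF that]] by blast
        show "mp_quadratic (1 + s j) y (mp_resolvent y (1 + s j)) = 0" "0 \<le> mp_resolvent y (1 + s j)"
          using mp_resolvent_quadratic[OF y x] by (auto simp: mp_quadratic_def)
      qed (use elim in auto)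
      then show "(\<lambda>n. mtrace (resolvent (1 + s j) (kendall_mat (p n) n (data \<omega>))) / real (p n))
        \<longlonglongrightarrow> (\<integral>u. 1 / (u + (1 + s j)) \<partial>mp_distr y)"
        unfolding stieltjes_def mp_resolvent_def .
    qed (use p s kendall_psd mp_distr_real_distribution[OF y] mp_distr_nonneg[OF y] in auto)
  qed
qed

end

theorem theorem2p1:
  fixes M :: "'a measure"
    and X :: "nat \<Rightarrow> nat \<Rightarrow> 'a \<Rightarrow> real"
    and p :: "nat \<Rightarrow> nat"
    and y :: real
  assumes "prob_space M"
    and "prob_space.indep_vars M (\<lambda>_. borel) (\<lambda>(k, i). X k i) ({1..} \<times> {1..})"
    and "\<And>k i. k \<ge> 1 \<Longrightarrow> i \<ge> 1 \<Longrightarrow> distr M borel (X k i) = distr M borel (X 1 1)"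
    and "\<And>k i. k \<ge> 1 \<Longrightarrow> i \<ge> 1 \<Longrightarrow> integrable M (\<lambda>\<omega>. X k i \<omega> ^ 4)"
    and "\<And>k i. k \<ge> 1 \<Longrightarrow> i \<ge> 1 \<Longrightarrow> prob_space.expectation M (X k i) = 0"
    and "\<And>k i. k \<ge> 1 \<Longrightarrow> i \<ge> 1 \<Longrightarrow> prob_space.variance M (X k i) = 1"
    and "\<And>n. n \<ge> 2 \<Longrightarrow> p n > 0"
    and "(\<lambda>n. real (p n) / real n) \<longlonglongrightarrow> y"
    and "0 < y" and "y < 1"
  shows "AE \<omega> in M.
           weak_conv
             (\<lambda>n. esd ((real (p n) / 2) \<cdot>\<^sub>m kendall_tau (p n) n (sample_vec X (p n) \<omega>)))
             (cdf (mp_distr y))"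
proof -
  interpret prob_space M by fact
  have m: "X k i \<in> borel_measurable M" if "k \<ge> 1" "i \<ge> 1" for k i
    using assms(2) that by (auto simp: indep_vars_def)
  interpret iid_array M X "expectation (\<lambda>\<omega>. X 1 1 \<omega> ^ 4)"
  proof
    fix k i :: nat assume ki: "k \<ge> 1" "i \<ge> 1"
    have "expectation (\<lambda>\<omega>. X k i \<omega> ^ 4) = (\<integral>u. u ^ 4 \<partial>distr M borel (X k i))"
      using m[OF ki] by (subst integral_distr) auto
    also have "\<dots> = expectation (\<lambda>\<omega>. X 1 1 \<omega> ^ 4)"
      unfolding assms(3)[OF ki] using m[of 1 1] by (subst integral_distr) auto
    finally show "expectation (\<lambda>\<omega>. X k i \<omega> ^ 4) \<le> expectation (\<lambda>\<omega>. X 1 1 \<omega> ^ 4)" by simp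
    show "expectation (\<lambda>\<omega>. (X k i \<omega>)\<^sup>2) = 1" using assms(5,6)[OF ki] by simp
  qed (use assms(2,4,5) in auto)
  have "kendall_mat (p n) n (data \<omega>) = (real (p n) / 2) \<cdot>\<^sub>m kendall_tau (p n) n (sample_vec X (p n) \<omega>)" for n \<omega>
  proof -
    have "colvec (p n) (data \<omega>) = sample_vec X (p n) \<omega>"
      by (simp add: fun_eq_iff colvec_def sample_vec_def data_apply)
    then show ?thesis by (simp add: kendall_mat_def)
  qed
  then show ?thesis using kendall_esd_weak_conv[of p y] assms(7-10) by simp
qed

end
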